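(* Let $L$ be a finite language with no relation symbols, and let $A$ be a computable, Hopfian, finitely presented $L$-structure. Then $A$ has a computable $d$-$\Sigma_2$ Scott sentence if and only if the weak Whitehead problem for $A$ is decidable.
   Context: Computable structure: the domain is a computable subset of $\omega$ and the interpretations of the symbols of $L$ are computable. Finitely presented: fix an ambient class $K$ of $L$-structures with $A\in K$ (for example, the class of all groups in the language of groups). $A$ is finitely presented if for some $n$ there are a tuple $\bar a\in A^n$ generating $A$ and a finite conjunction $\psi(\bar x)$ of atomic $L$-formulas (equations between terms), $\bar x=(x_1,\dots,x_n)$, such that $A\models\psi(\bar a)$ and, whenever $B\in K$ and $\bar b\in B^n$ satisfy $B\models\psi(\bar b)$, the map $\bar a\mapsto\bar b$ extends (uniquely) to a homomorphism $A\to B$. In that case one writes $A=\langle\bar a\mid\psi(\bar x)\rangle$. Hopfian: every surjective endomorphism of $A$ is an automorphism of $A$. Decidable weak Whitehead problem: for every finite tuple $\bar a$ generating $A$, of length $n$ say, the set $\{\alpha(\bar a):\alpha\in\mathrm{Aut}(A)\}$ is a computable subset of $A^n$. Infinitary formulas (of $\mathfrak L_{\omega_1,\omega}$; all tuples of variables are finite): computable $\Sigma_0$ = computable $\Pi_0$ = finitary quantifier-free. For a computable ordinal $\alpha>0$, a formula $\varphi(\bar x)$ is computable $\Sigma_\alpha$ if it is a computably enumerable disjunction of formulas $\exists\bar y\,\theta(\bar x,\bar y)$ with each $\theta$ computable $\Pi_\beta$ for some $\beta<\alpha$; it is computable $\Pi_\alpha$ if it is a computably enumerable conjunction of formulas $\forall\bar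 y\,\theta(\bar x,\bar y)$ with each $\theta$ computable $\Sigma_\beta$ for some $\beta<\alpha$. A computable $d$-$\Sigma_2$ formula is the conjunction of a computable $\Sigma_2$ formula and a computable $\Pi_2$ formula. A Scott sentence for a countable structure $A$ is a sentence of $\mathfrak L_{\omega_1,\omega}$ whose countable models are exactly the countable $L$-structures isomorphic to $A$. *)

theory Defs
  imports Main "HOL-Library.Nat_Bijection" "HOL-Library.Countable_Set_Type"
begin

section \<open>Computability\<close>

datatype recf =
    Zero
  | Succ
  | Proj nat
  | Comp recf "recf list"
  | Prec recf recf
  | Mu recf

text \<open>\<open>computes f xs y\<close>: the partial recursive function described by \<open>f\<close>
  is defined on the argument tuple \<open>xs\<close> and has the value \<open>y\<close>.
  Recursion and minimisation act on the first argument.\<close>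

inductive computes :: "recf \<Rightarrow> nat list \<Rightarrow> nat \<Rightarrow> bool" where
  zero: "computes Zero xs 0"
| succ: "computes Succ (x # xs) (Suc x)"
| proj: "i < length xs \<Longrightarrow> computes (Proj i) xs (xs ! i)"
| comp: "length ys = length gs \<Longrightarrow> (\<forall>i<length gs. computes (gs ! i) xs (ys ! i)) \<Longrightarrow>
    computes f ys z \<Longrightarrow> computes (Comp f gs) xs z"
| prec_0: "computes g xs y \<Longrightarrow> computes (Prec g h) (0 # xs) y"
| prec_Suc: "computes (Prec g h) (m # xs) y \<Longrightarrow> computes h (m # y # xs) z \<Longrightarrow>
    computes (Prec g h) (Suc m # xs) z"
| mu: "computes f (m # xs) 0 \<Longrightarrow> (\<forall>i<m. \<exists>k. computes f (i # xs) (Suc k)) \<Longrightarrow>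
    computes (Mu f) xs m"

text \<open>A subset of \<open>\<omega>\<^sup>k\<close>, given as a set of lists of length \<open>k\<close>.\<close>

definition computable_rel :: "nat \<Rightarrow> nat list set \<Rightarrow> bool" where
  "computable_rel k R \<longleftrightarrow>
    (\<exists>f. \<forall>xs. length xs = k \<longrightarrow> computes f xs (if xs \<in> R then 1 else 0))"

definition computable_set :: "nat set \<Rightarrow> bool" where
  "computable_set S \<longleftrightarrow> computable_rel 1 {[x] |x. x \<in> S}"

text \<open>The computably enumerable sets are the domains of the partial recursive functions.\<close>

definition ce_set :: "recf \<Rightarrow> nat set" where
  "ce_set f = {x. \<exists>y. computes f [x] y}"

text \<open>An explicit (hence acceptable) Goedel numbering. An abstract injection such as
  the one of class \<open>countable\<close> would not do here, as it need not be computable.\<close>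

primrec recf_code :: "recf \<Rightarrow> nat" where
  "recf_code Zero = prod_encode (0, 0)"
| "recf_code Succ = prod_encode (1, 0)"
| "recf_code (Proj i) = prod_encode (2, i)"
| "recf_code (Comp f gs) =
    prod_encode (3, prod_encode (recf_code f, list_encode (map recf_code gs)))"
| "recf_code (Prec g h) = prod_encode (4, prod_encode (recf_code g, recf_code h))"
| "recf_code (Mu f) = prod_encode (5, recf_code f)"

lemma recf_code_inject: "recf_code f = recf_code g \<longleftrightarrow> f = g"
proof
  show "recf_code f = recf_code g \<Longrightarrow> f = g"
  proof (induction f arbitrary: g)
    case (Comp f gs)
    then obtain f' gs' where g: "g = Comp f' gs'" "recf_code f = recf_code f'"
      "map recf_code gs = map recf_code gs'"
      by (cases g) (auto dest: injD[OF inj_list_encode])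
    moreover have "gs = gs'" using g(3) Comp.IH(2)
      by (intro nth_equalityI) (auto simp: list_eq_iff_nth_eq)
    ultimately show ?case using Comp.IH(1) by blast
  qed (case_tac g; auto)+
qed simp

section \<open>Structures for finite functional languages\<close>

text \<open>A finite language without relation symbols is the list of the arities of its function
  symbols: the symbols are the numbers \<open>i < length L\<close>, and \<open>i\<close> has arity \<open>L ! i\<close>.
  Constants have arity 0.\<close>

type_synonym lang = "nat list"

record 'a struct =
  dom :: "'a set"
  fn :: "nat \<Rightarrow> 'a list \<Rightarrow> 'a"

definition tuples :: "'a struct \<Rightarrow> nat \<Rightarrow> 'a list set" where
  "tuples A n = {xs. length xs = n \<and> set xs \<subseteq> dom A}"

definition structure_of :: "lang \<Rightarrow> 'a struct \<Rightarrow> bool" where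
  "structure_of L A \<longleftrightarrow> dom A \<noteq> {} \<and>
    (\<forall>i<length L. \<forall>xs \<in> tuples A (L ! i). fn A i xs \<in> dom A)"

definition hom :: "lang \<Rightarrow> 'a struct \<Rightarrow> 'b struct \<Rightarrow> ('a \<Rightarrow> 'b) \<Rightarrow> bool" where
  "hom L A B h \<longleftrightarrow> h ` dom A \<subseteq> dom B \<and>
    (\<forall>i<length L. \<forall>xs \<in> tuples A (L ! i). h (fn A i xs) = fn B i (map h xs))"

text \<open>There are no relation symbols, so a bijective homomorphism is an isomorphism.\<close>

definition iso :: "lang \<Rightarrow> 'a struct \<Rightarrow> 'b struct \<Rightarrow> ('a \<Rightarrow> 'b) \<Rightarrow> bool" where
  "iso L A B h \<longleftrightarrow> hom L A B h \<and> bij_betw h (dom A) (dom B)"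

definition isomorphic :: "lang \<Rightarrow> 'a struct \<Rightarrow> 'b struct \<Rightarrow> bool" where
  "isomorphic L A B \<longleftrightarrow> (\<exists>h. iso L A B h)"

abbreviation automorphism :: "lang \<Rightarrow> 'a struct \<Rightarrow> ('a \<Rightarrow> 'a) \<Rightarrow> bool" where
  "automorphism L A h \<equiv> iso L A A h"

definition hopfian :: "lang \<Rightarrow> 'a struct \<Rightarrow> bool" where
  "hopfian L A \<longleftrightarrow> (\<forall>h. hom L A A h \<and> h ` dom A = dom A \<longrightarrow> automorphism L A h)"

inductive_set generated :: "lang \<Rightarrow> 'a struct \<Rightarrow> 'a set \<Rightarrow> 'a set"
  for L :: lang and A :: "'a struct" and X :: "'a set" where
  base: "x \<in> X \<Longrightarrow> x \<in> generated L A X"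
| app: "i < length L \<Longrightarrow> length xs = L ! i \<Longrightarrow> (\<forall>x \<in> set xs. x \<in> generated L A X) \<Longrightarrow>
    fn A i xs \<in> generated L A X"

definition generates :: "lang \<Rightarrow> 'a struct \<Rightarrow> 'a list \<Rightarrow> bool" where
  "generates L A as \<longleftrightarrow> set as \<subseteq> dom A \<and> generated L A (set as) = dom A"

definition computable_structure :: "lang \<Rightarrow> nat struct \<Rightarrow> bool" where
  "computable_structure L A \<longleftrightarrow> structure_of L A \<and> computable_set (dom A) \<and>
    (\<forall>i<length L. \<exists>f. \<forall>xs \<in> tuples A (L ! i). computes f xs (fn A i xs))"

definition decidable_weak_whitehead :: "lang \<Rightarrow> nat struct \<Rightarrow> bool" where
  "decidable_weak_whitehead L A \<longleftrightarrow> (\<forall>as. generates L A as \<longrightarrow>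
    computable_rel (length as) {map h as |h. automorphism L A h})"

section \<open>Terms and finite presentations\<close>

datatype tm = Var nat | App nat "tm list"

primrec wf_tm :: "lang \<Rightarrow> nat \<Rightarrow> tm \<Rightarrow> bool" where
  "wf_tm L k (Var i) \<longleftrightarrow> i < k"
| "wf_tm L k (App i ts) \<longleftrightarrow> i < length L \<and> length ts = L ! i \<and> list_all (wf_tm L k) ts"

primrec val :: "'a struct \<Rightarrow> 'a list \<Rightarrow> tm \<Rightarrow> 'a" where
  "val A v (Var i) = v ! i"
| "val A v (App i ts) = fn A i (map (val A v) ts)"

text \<open>The ambient class \<open>K\<close> may live on any universe \<open>'b\<close>; \<open>A \<in> K\<close> is read
  up to isomorphism, so that \<open>A\<close> and the members of \<open>K\<close> can have different
  universes. The list \<open>\<psi>\<close> of pairs of terms is a finite conjunction of equations. The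
  homomorphism is unique on \<open>dom A\<close> because \<open>as\<close> generates \<open>A\<close>.\<close>

definition finitely_presented :: "lang \<Rightarrow> 'b struct set \<Rightarrow> 'a struct \<Rightarrow> bool" where
  "finitely_presented L K A \<longleftrightarrow> (\<exists>A' \<in> K. isomorphic L A A') \<and>
    (\<exists>n as \<psi>. as \<in> tuples A n \<and> generates L A as \<and>
      (\<forall>(s, t) \<in> set \<psi>. wf_tm L n s \<and> wf_tm L n t) \<and>
      (\<forall>(s, t) \<in> set \<psi>. val A as s = val A as t) \<and>
      (\<forall>B \<in> K. \<forall>bs \<in> tuples B n. (\<forall>(s, t) \<in> set \<psi>. val B bs s = val B bs t) \<longrightarrow>
        (\<exists>h. hom L A B h \<and> map h as = bs)))"

section \<open>Infinitary formulas\<close>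

text \<open>Finitary quantifier-free formulas.\<close>

datatype qf = Eq tm tm | Neg qf | And qf qf | Or qf qf

primrec wf_qf :: "lang \<Rightarrow> nat \<Rightarrow> qf \<Rightarrow> bool" where
  "wf_qf L k (Eq s t) \<longleftrightarrow> wf_tm L k s \<and> wf_tm L k t"
| "wf_qf L k (Neg p) \<longleftrightarrow> wf_qf L k p"
| "wf_qf L k (And p q) \<longleftrightarrow> wf_qf L k p \<and> wf_qf L k q"
| "wf_qf L k (Or p q) \<longleftrightarrow> wf_qf L k p \<and> wf_qf L k q"

primrec sat_qf :: "'a struct \<Rightarrow> 'a list \<Rightarrow> qf \<Rightarrow> bool" where
  "sat_qf A v (Eq s t) \<longleftrightarrow> val A v s = val A v t"
| "sat_qf A v (Neg p) \<longleftrightarrow> \<not> sat_qf A v p"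
| "sat_qf A v (And p q) \<longleftrightarrow> sat_qf A v p \<and> sat_qf A v q"
| "sat_qf A v (Or p q) \<longleftrightarrow> sat_qf A v p \<or> sat_qf A v q"

text \<open>Formulas of \<open>L\<^sub>\<omega>\<^sub>1\<^sub>,\<^sub>\<omega>\<close> are taken in a context of \<open>k\<close> free
  variables, numbered \<open>0, \<dots>, k - 1\<close>. The quantifiers \<open>Ex m\<close> and \<open>All m\<close> bind
  the tuple of the next \<open>m\<close> variables \<open>k, \<dots>, k + m - 1\<close>.\<close>

datatype form =
    QF qf
  | FNot form
  | Disj "form cset"
  | Conj "form cset"
  | Ex nat form
  | All nat form

primrec wf_form :: "lang \<Rightarrow> form \<Rightarrow> nat \<Rightarrow> bool" where
  "wf_form L (QF q) = (\<lambda>k. wf_qf L k q)"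
| "wf_form L (FNot \<phi>) = (\<lambda>k. wf_form L \<phi> k)"
| "wf_form L (Disj F) = (\<lambda>k. \<forall>P \<in> rcset (cimage (wf_form L) F). P k)"
| "wf_form L (Conj F) = (\<lambda>k. \<forall>P \<in> rcset (cimage (wf_form L) F). P k)"
| "wf_form L (Ex m \<phi>) = (\<lambda>k. wf_form L \<phi> (k + m))"
| "wf_form L (All m \<phi>) = (\<lambda>k. wf_form L \<phi> (k + m))"

primrec sat :: "'a struct \<Rightarrow> form \<Rightarrow> 'a list \<Rightarrow> bool" where
  "sat A (QF q) = (\<lambda>v. sat_qf A v q)"
| "sat A (FNot \<phi>) = (\<lambda>v. \<not> sat A \<phi> v)"
| "sat A (Disj F) = (\<lambda>v. \<exists>P \<in> rcset (cimage (sat A) F). P v)"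
| "sat A (Conj F) = (\<lambda>v. \<forall>P \<in> rcset (cimage (sat A) F). P v)"
| "sat A (Ex m \<phi>) = (\<lambda>v. \<exists>ys \<in> tuples A m. sat A \<phi> (v @ ys))"
| "sat A (All m \<phi>) = (\<lambda>v. \<forall>ys \<in> tuples A m. sat A \<phi> (v @ ys))"

text \<open>Every countable structure is isomorphic to one whose universe is a set of natural
  numbers (finite or infinite), so it suffices to test those.\<close>

definition scott_sentence :: "lang \<Rightarrow> 'a struct \<Rightarrow> form \<Rightarrow> bool" where
  "scott_sentence L A \<phi> \<longleftrightarrow> wf_form L \<phi> 0 \<and>
    (\<forall>B :: nat struct. structure_of L B \<longrightarrow> (sat B \<phi> [] \<longleftrightarrow> isomorphic L A B))"

section \<open>Computable infinitary formulas of finite level\<close>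

primrec tm_code :: "tm \<Rightarrow> nat" where
  "tm_code (Var i) = prod_encode (0, i)"
| "tm_code (App i ts) = prod_encode (1, prod_encode (i, list_encode (map tm_code ts)))"

primrec qf_code :: "qf \<Rightarrow> nat" where
  "qf_code (Eq s t) = prod_encode (0, prod_encode (tm_code s, tm_code t))"
| "qf_code (Neg p) = prod_encode (1, qf_code p)"
| "qf_code (And p q) = prod_encode (2, prod_encode (qf_code p, qf_code q))"
| "qf_code (Or p q) = prod_encode (3, prod_encode (qf_code p, qf_code q))"

lemma tm_code_inject: "tm_code s = tm_code t \<longleftrightarrow> s = t"
proof
  show "tm_code s = tm_code t \<Longrightarrow> s = t"
  proof (induction s arbitrary: t)
    case (App i ts)
    then obtain ts' where t: "t = App i ts'" "map tm_code ts = map tm_code ts'"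
      by (cases t) (auto dest: injD[OF inj_list_encode])
    moreover have "ts = ts'" using t(2) App.IH
      by (intro nth_equalityI) (auto simp: list_eq_iff_nth_eq)
    ultimately show ?case by simp
  qed (case_tac t; auto)
qed simp

lemma qf_code_inject: "qf_code p = qf_code q \<longleftrightarrow> p = q"
proof
  show "qf_code p = qf_code q \<Longrightarrow> p = q"
    by (induction p arbitrary: q; case_tac q; auto simp: tm_code_inject)
qed simp

text \<open>\<open>sigma_index L n k e \<phi>\<close>: the number \<open>e\<close> is an index of the computable
  \<open>\<Sigma>\<^sub>n\<close> formula \<open>\<phi>\<close> with free variables \<open>0, \<dots>, k - 1\<close>. For \<open>n > 0\<close> it is
  the code of a program whose domain is the set of all triples \<open>(j, m, d)\<close> such that \<open>\<phi>\<close> has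
  a disjunct \<open>\<exists>\<^sub>m \<theta>\<close>, where \<open>\<theta>\<close> is the computable \<open>\<Pi>\<^sub>j\<close> formula with index \<open>d\<close>
  and \<open>j < n\<close>. Dually for \<open>pi_index\<close>.\<close>

function (sequential)
  sigma_index :: "lang \<Rightarrow> nat \<Rightarrow> nat \<Rightarrow> nat \<Rightarrow> form \<Rightarrow> bool" and
  pi_index :: "lang \<Rightarrow> nat \<Rightarrow> nat \<Rightarrow> nat \<Rightarrow> form \<Rightarrow> bool"
where
  "sigma_index L 0 k e \<phi> \<longleftrightarrow> (\<exists>q. wf_qf L k q \<and> e = qf_code q \<and> \<phi> = QF q)"
| "sigma_index L (Suc n) k e \<phi> \<longleftrightarrow> (\<exists>f F. e = recf_code f \<and> \<phi> = Disj F \<and>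
    (\<forall>c \<in> ce_set f. \<exists>j \<in> {..n}. \<exists>m d \<theta>.
      c = prod_encode (j, prod_encode (m, d)) \<and> pi_index L j (k + m) d \<theta>) \<and>
    (\<forall>\<chi>. \<chi> \<in> rcset F \<longleftrightarrow> (\<exists>j \<in> {..n}. \<exists>m d \<theta>. \<chi> = Ex m \<theta> \<and>
      prod_encode (j, prod_encode (m, d)) \<in> ce_set f \<and> pi_index L j (k + m) d \<theta>)))"
| "pi_index L 0 k e \<phi> \<longleftrightarrow> (\<exists>q. wf_qf L k q \<and> e = qf_code q \<and> \<phi> = QF q)"
| "pi_index L (Suc n) k e \<phi> \<longleftrightarrow> (\<exists>f F. e = recf_code f \<and> \<phi> = Conj F \<and>
    (\<forall>c \<in> ce_set f. \<exists>j \<in> {..n}. \<exists>m d \<theta>.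
      c = prod_encode (j, prod_encode (m, d)) \<and> sigma_index L j (k + m) d \<theta>) \<and>
    (\<forall>\<chi>. \<chi> \<in> rcset F \<longleftrightarrow> (\<exists>j \<in> {..n}. \<exists>m d \<theta>. \<chi> = All m \<theta> \<and>
      prod_encode (j, prod_encode (m, d)) \<in> ce_set f \<and> sigma_index L j (k + m) d \<theta>)))"
  by pat_completeness auto
termination
  by (relation "measure (\<lambda>x. case x of Inl (L, n, k, e, \<phi>) \<Rightarrow> n | Inr (L, n, k, e, \<phi>) \<Rightarrow> n)")
     auto

definition computable_Sigma :: "lang \<Rightarrow> nat \<Rightarrow> nat \<Rightarrow> form \<Rightarrow> bool" where
  "computable_Sigma L n k \<phi> \<longleftrightarrow> (\<exists>e. sigma_index L n k e \<phi>)"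

definition computable_Pi :: "lang \<Rightarrow> nat \<Rightarrow> nat \<Rightarrow> form \<Rightarrow> bool" where
  "computable_Pi L n k \<phi> \<longleftrightarrow> (\<exists>e. pi_index L n k e \<phi>)"

definition computable_d_Sigma2 :: "lang \<Rightarrow> nat \<Rightarrow> form \<Rightarrow> bool" where
  "computable_d_Sigma2 L k \<phi> \<longleftrightarrow> (\<exists>\<sigma> \<pi>. computable_Sigma L 2 k \<sigma> \<and> computable_Pi L 2 k \<pi> \<and>
    \<phi> = Conj (cinsert \<sigma> (csingle \<pi>)))"

end

theory Submission
  imports Defs
begin

text \<open>Let \<open>A\<close> be presented by \<open>v\<close> and \<open>\<psi>\<close>. Since \<open>A\<close> is Hopfian, a tuple \<open>w\<close> is in the orbit of
  \<open>v\<close> if and only if it satisfies \<open>\<psi>\<close> and generates \<open>A\<close>, which is an enumerable condition.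

  If the orbit is computable, then a \<open>\<Sigma>\<^sub>1\<close> formula defines its complement in \<open>A\<close>: \<open>y\<close> is not in
  the orbit if and only if \<open>y = t(x)\<close> for some \<open>x\<close> that satisfies \<open>\<psi>\<close> and some terms \<open>t\<close> such that
  \<open>t(v)\<close> is not in the orbit. Indeed \<open>v \<mapsto> x\<close> extends to an endomorphism that maps \<open>t(v)\<close> to \<open>y\<close>; if
  \<open>y\<close> generates \<open>A\<close>, then it is onto, hence an automorphism. Let \<open>\<theta>\<close> be the negation of this formula
  together with the equations and inequations of \<open>v\<close>. The Scott sentence says that some tuple
  satisfies \<open>\<theta>\<close>, and that every tuple that satisfies \<open>\<theta>\<close> generates the structure.

  Conversely, let \<open>\<sigma> \<and> \<pi>\<close> be a Scott sentence. Some tuple \<open>c\<close> of \<open>A\<close> satisfies a \<open>\<Pi>\<^sub>1\<close> formula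
  \<open>\<theta>\<close> such that \<open>\<exists>x \<theta>(x)\<close> is a disjunct of \<open>\<sigma>\<close>. If \<open>w\<close> has the same equations as a generating tuple
  \<open>v\<close>, then \<open>v \<mapsto> w\<close> extends to an embedding \<open>f\<close> of \<open>A\<close> into itself. If \<open>f\<close> is not onto, then the
  direct limit of \<open>A \<rightarrow> A \<rightarrow> \<dots>\<close> along \<open>f\<close> is not finitely generated, so it is not a model of
  \<open>\<sigma> \<and> \<pi>\<close>. But \<open>\<pi>\<close> is preserved by unions of chains; so \<open>\<sigma>\<close> fails in the limit, and \<open>\<theta>\<close> fails at
  some \<open>f\<^sup>k(c)\<close>. This can be recognized effectively, so the complement of the orbit is
  enumerable.\<close>

section \<open>Computable functions and enumerable predicates\<close>

text \<open>In the case of minimisation, the smaller of two different results would be an argument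
  at which the searched function is both zero and positive.\<close>

lemma computes_det: "computes f xs y \<Longrightarrow> computes f xs z \<Longrightarrow> y = z"
proof (induction f xs y arbitrary: z rule: computes.induct)
  case (comp ys gs xs f y)
  from comp.prems show ?case
  proof cases
    case (comp ys')
    then have "ys' = ys" using comp.IH(1) comp.hyps
      by (intro nth_equalityI) (simp, metis)
    then show ?thesis using comp comp.IH by blast
  qed
next
  case (mu f m xs)
  from mu.prems show ?case
  proof cases
    case mu': mu
    show ?thesis
    proof (rule linorder_cases[of m z])
      assume "m < z"
      then show ?thesis using mu' mu.IH by fastforce
    next
      assume "z < m"
      then show ?thesis using mu' mu.IH by fastforce
    qed
  qed
next
  case (prec_0 g xs y h)
  from prec_0.prems show ?case by cases (auto dest: prec_0.IH)
next
  case (prec_Suc g h m xs y z')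
  from prec_Suc.prems show ?case by cases (use prec_Suc.IH in blast)
qed (erule computes.cases; simp)+

lemma computes_Comp1:
  "computes g xs y \<Longrightarrow> computes f [y] z \<Longrightarrow> computes (Comp f [g]) xs z"
  by (rule computes.comp[where ys = "[y]"]) auto

lemma computes_Comp2:
  "computes g xs y \<Longrightarrow> computes h xs y' \<Longrightarrow> computes f [y, y'] z \<Longrightarrow>
    computes (Comp f [g, h]) xs z"
  by (rule computes.comp[where ys = "[y, y']"]) (auto simp: less_Suc_eq)

lemma computes_Proj: "i < length xs \<Longrightarrow> y = xs ! i \<Longrightarrow> computes (Proj i) xs y"
  using computes.proj by simp

section \<open>Total computable functions of one and two arguments\<close>

definition computable_fun :: "(nat \<Rightarrow> nat) \<Rightarrow> bool" where
  "computable_fun F \<longleftrightarrow> (\<exists>f. \<forall>x. computes f [x] (F x))"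

definition computable_fun2 :: "(nat \<Rightarrow> nat \<Rightarrow> nat) \<Rightarrow> bool" where
  "computable_fun2 F \<longleftrightarrow> (\<exists>f. \<forall>x y. computes f [x, y] (F x y))"

lemma computable_fun_compose:
  assumes "computable_fun F" "computable_fun G"
  shows "computable_fun (\<lambda>n. F (G n))"
proof -
  obtain f g where "\<And>x. computes f [x] (F x)" "\<And>x. computes g [x] (G x)"
    using assms unfolding computable_fun_def by auto
  then have "computes (Comp f [g]) [x] (F (G x))" for x
    by (rule computes_Comp1[rotated])
  then show ?thesis unfolding computable_fun_def by blast
qed

lemma computable_fun2_compose:
  assumes "computable_fun2 F" "computable_fun G" "computable_fun H"
  shows "computable_fun (\<lambda>n. F (G n) (H n))"
proof -
  obtain f g h where "\<And>x y. computes f [x, y] (F x y)"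
    and "\<And>x. computes g [x] (G x)" "\<And>x. computes h [x] (H x)"
    using assms unfolding computable_fun_def computable_fun2_def by auto
  then have "computes (Comp f [g, h]) [x] (F (G x) (H x))" for x
    by (metis computes_Comp2)
  then show ?thesis unfolding computable_fun_def by blast
qed

lemma computable_fun2_compose2:
  assumes "computable_fun2 F" "computable_fun2 G" "computable_fun2 H"
  shows "computable_fun2 (\<lambda>x y. F (G x y) (H x y))"
proof -
  obtain f g h where "\<And>x y. computes f [x, y] (F x y)"
    and "\<And>x y. computes g [x, y] (G x y)" "\<And>x y. computes h [x, y] (H x y)"
    using assms unfolding computable_fun2_def by auto
  then have "computes (Comp f [g, h]) [x, y] (F (G x y) (H x y))" for x y
    by (metis computes_Comp2)
  then show ?thesis unfolding computable_fun2_def by blast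
qed

lemma computable_fun2_compose1:
  assumes "computable_fun F" "computable_fun2 G"
  shows "computable_fun2 (\<lambda>x y. F (G x y))"
proof -
  obtain f g where "\<And>x. computes f [x] (F x)" "\<And>x y. computes g [x, y] (G x y)"
    using assms unfolding computable_fun_def computable_fun2_def by auto
  then have "computes (Comp f [g]) [x, y] (F (G x y))" for x y
    by (rule computes_Comp1[rotated])
  then show ?thesis unfolding computable_fun2_def by blast
qed

lemma computable_fun_id: "computable_fun (\<lambda>n. n)"
  unfolding computable_fun_def by (rule exI[of _ "Proj 0"]) (auto intro: computes_Proj)

lemma computable_fun2_fst: "computable_fun2 (\<lambda>x y. x)"
  unfolding computable_fun2_def by (rule exI[of _ "Proj 0"]) (auto intro: computes_Proj)

lemma computable_fun2_snd: "computable_fun2 (\<lambda>x y. y)"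
  unfolding computable_fun2_def by (rule exI[of _ "Proj 1"]) (auto intro: computes_Proj)

lemma computable_fun_Suc: "computable_fun Suc"
  unfolding computable_fun_def by (rule exI[of _ Succ]) (auto intro: computes.intros)

lemma computable_fun_const: "computable_fun (\<lambda>n. c)"
proof (induction c)
  case 0
  show ?case unfolding computable_fun_def by (rule exI[of _ Zero]) (auto intro: computes.intros)
next
  case (Suc c)
  then show ?case using computable_fun_compose[OF computable_fun_Suc] by blast
qed

lemma computable_fun2_const: "computable_fun2 (\<lambda>x y. c)"
  using computable_fun2_compose1[OF computable_fun_const computable_fun2_fst] .

text \<open>Iteration is the source of most later constructions: sums, truncated differences, the
  choice between two values and the runs of the search machine.\<close>

lemma computable_fun2_funpow:
  assumes "computable_fun F"
  shows "computable_fun2 (\<lambda>m x. (F ^^ m) x)"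
proof -
  obtain f where f: "\<And>x. computes f [x] (F x)"
    using assms unfolding computable_fun_def by blast
  have "computes (Prec (Proj 0) (Comp f [Proj 1])) [m, x] ((F ^^ m) x)" for m x
  proof (induction m)
    case 0
    show ?case by (auto intro!: computes.prec_0 computes_Proj)
  next
    case (Suc m)
    show ?case
      by (rule computes.prec_Suc[OF Suc]) (auto intro!: computes_Comp1 computes_Proj f)
  qed
  then show ?thesis unfolding computable_fun2_def by blast
qed

text \<open>The base value is fixed at 0, which suits the predecessor, the triangular numbers and
  \<open>diagonal\<close>.\<close>

lemma computable_fun_primrec:
  assumes "computable_fun2 H" and "R 0 = 0" and "\<And>m. R (Suc m) = H m (R m)"
  shows "computable_fun R"
proof -
  obtain h where h: "\<And>x y. computes h [x, y] (H x y)"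
    using assms(1) unfolding computable_fun2_def by blast
  have "computes (Prec Zero h) [m] (R m)" for m
  proof (induction m)
    case 0
    show ?case by (auto intro!: computes.prec_0 computes.zero simp: assms)
  next
    case (Suc m)
    show ?case by (rule computes.prec_Suc[OF Suc]) (simp add: assms h)
  qed
  then show ?thesis unfolding computable_fun_def by blast
qed

lemma computable_fun2_add: "computable_fun2 (+)"
proof -
  have "(\<lambda>m x. (Suc ^^ m) x) = (+)" by (intro ext) simp
  then show ?thesis using computable_fun2_funpow[OF computable_fun_Suc] by simp
qed

lemma computable_fun_pred: "computable_fun (\<lambda>n. n - 1)"
  by (rule computable_fun_primrec[OF computable_fun2_fst]) auto

lemma computable_fun2_diff: "computable_fun2 (-)"
proof -
  have "((\<lambda>n. n - Suc 0) ^^ m) x = x - m" for m x :: nat by (induction m) auto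
  then have "computable_fun2 (\<lambda>m x. x - m)"
    using computable_fun2_funpow[OF computable_fun_pred] by simp
  then obtain f where f: "\<And>m x. computes f [m, x] (x - m)"
    unfolding computable_fun2_def by blast
  \<comment> \<open>The iteration counts along its first argument, but the number to be subtracted
    comes second; hence the two projections are swapped.\<close>
  have "computes (Comp f [Proj 1, Proj 0]) [x, m] (x - m)" for x m
    by (rule computes_Comp2[OF _ _ f]) (auto intro: computes_Proj)
  then show ?thesis unfolding computable_fun2_def by blast
qed

lemma computable_fun_triangle: "computable_fun triangle"
  by (rule computable_fun_primrec[where H = "\<lambda>m y. y + Suc m"])
    (intro computable_fun2_compose2[OF computable_fun2_add] computable_fun2_fst
      computable_fun2_snd computable_fun2_compose1[OF computable_fun_Suc], simp_all)

section \<open>Decoding of pairs\<close>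

definition pfst :: "nat \<Rightarrow> nat" where "pfst n = fst (prod_decode n)"
definition psnd :: "nat \<Rightarrow> nat" where "psnd n = snd (prod_decode n)"

lemma pfst_encode [simp]: "pfst (prod_encode (x, y)) = x"
  and psnd_encode [simp]: "psnd (prod_encode (x, y)) = y"
  and prod_encode_pfst_psnd [simp]: "prod_encode (pfst n, psnd n) = n"
  by (simp_all add: pfst_def psnd_def)

lemma computable_fun2_prod_encode: "computable_fun2 (\<lambda>x y. prod_encode (x, y))"
  unfolding prod_encode_def
  by (auto intro!: computable_fun2_compose2[OF computable_fun2_add] computable_fun2_fst
      computable_fun2_snd computable_fun2_compose1[OF computable_fun_triangle])

text \<open>The number of the diagonal on which \<open>n\<close> lies in Cantor's enumeration, that
  is, the largest \<open>d\<close> with \<open>triangle d \<le> n\<close>. Both differences are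
  truncated, so the added term is 1 exactly when \<open>Suc n\<close> has reached the next
  triangular number, and 0 otherwise.\<close>

fun diagonal :: "nat \<Rightarrow> nat" where
  "diagonal 0 = 0"
| "diagonal (Suc n) = diagonal n + (1 - (triangle (Suc (diagonal n)) - Suc n))"

lemma diagonal_bounds: "triangle (diagonal n) \<le> n \<and> n < triangle (Suc (diagonal n))"
proof (induction n)
  case (Suc n)
  then show ?case
    by (cases "triangle (Suc (diagonal n)) - Suc n") auto
qed simp

lemma triangle_mono: "m \<le> n \<Longrightarrow> triangle m \<le> triangle n"
  by (induction n rule: nat_induct) (auto simp: le_Suc_eq)

lemma diagonal_prod_encode: "diagonal (prod_encode (x, y)) = x + y"
proof -
  let ?d = "diagonal (prod_encode (x, y))"
  have "prod_encode (x, y) < triangle (Suc (x + y))" "triangle (x + y) \<le> prod_encode (x, y)"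
    by (auto simp: prod_encode_def)
  then have "triangle ?d < triangle (Suc (x + y))" "triangle (x + y) < triangle (Suc ?d)"
    using diagonal_bounds[of "prod_encode (x, y)"] by linarith+
  then have "\<not> Suc (x + y) \<le> ?d" "\<not> Suc ?d \<le> x + y"
    using triangle_mono not_less by blast+
  then show ?thesis by linarith
qed

lemma computable_fun_diagonal: "computable_fun diagonal"
  by (rule computable_fun_primrec
      [where H = "\<lambda>n d. d + (1 - (triangle (Suc d) - Suc n))"])
    (auto intro!: computable_fun2_compose2[OF computable_fun2_add]
      computable_fun2_compose2[OF computable_fun2_diff] computable_fun2_fst
      computable_fun2_snd computable_fun2_compose1[OF computable_fun_Suc] computable_fun2_const
      computable_fun2_compose1[OF computable_fun_triangle] simp del: triangle_Suc)

text \<open>Since \<open>prod_encode (x, y) = triangle (x + y) + x\<close>, the first component is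
  the offset of the code on its diagonal.\<close>

lemma computable_fun_pfst: "computable_fun pfst"
proof -
  have "pfst n = n - triangle (diagonal n)" for n
  proof -
    obtain x y where n: "n = prod_encode (x, y)"
      using prod_encode_pfst_psnd by metis
    show ?thesis unfolding n by (simp add: diagonal_prod_encode) (simp add: prod_encode_def)
  qed
  then have "pfst = (\<lambda>n. n - triangle (diagonal n))" by blast
  then show ?thesis
    using computable_fun2_compose[OF computable_fun2_diff computable_fun_id
        computable_fun_compose[OF computable_fun_triangle computable_fun_diagonal]] by simp
qed

lemma computable_fun_psnd: "computable_fun psnd"
proof -
  have "psnd = (\<lambda>n. diagonal n - pfst n)"
    by (metis add_diff_cancel_left' diagonal_prod_encode prod_encode_pfst_psnd)
  then show ?thesis
    using computable_fun2_compose[OF computable_fun2_diff computable_fun_diagonal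
        computable_fun_pfst] by simp
qed

lemma computable_fun_if:
  assumes "computable_fun C" "computable_fun F" "computable_fun G"
  shows "computable_fun (\<lambda>n. if C n = 0 then F n else G n)"
proof -
  \<comment> \<open>One application overwrites the first component of a pair by the second, and
    further ones change nothing. So the first component after \<open>C n\<close> applications
    depends only on whether \<open>C n = 0\<close>.\<close>
  let ?s = "\<lambda>p. prod_encode (psnd p, psnd p)"
  have s: "computable_fun ?s"
    by (rule computable_fun2_compose[OF computable_fun2_prod_encode
          computable_fun_psnd computable_fun_psnd])
  have *: "pfst ((?s ^^ c) (prod_encode (x, y))) = (if c = 0 then x else y)" for c x y
  proof -
    have "(?s ^^ Suc k) (prod_encode (x, y)) = prod_encode (y, y)" for k
      by (induction k) auto
    then show ?thesis by (cases c) (simp_all del: funpow.simps(2))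
  qed
  have "computable_fun (\<lambda>n. pfst ((?s ^^ C n) (prod_encode (F n, G n))))"
    by (rule computable_fun_compose[OF computable_fun_pfst]
        computable_fun2_compose[OF computable_fun2_funpow[OF s]]
        computable_fun2_compose[OF computable_fun2_prod_encode] assms)+
  then show ?thesis unfolding * .
qed

lemmas computable_intros = computable_fun_id computable_fun_const
  computable_fun_compose[OF computable_fun_Suc]
  computable_fun_compose[OF computable_fun_pred]
  computable_fun_compose[OF computable_fun_pfst]
  computable_fun_compose[OF computable_fun_psnd]
  computable_fun2_compose[OF computable_fun2_prod_encode]
  computable_fun2_compose[OF computable_fun2_add]
  computable_fun2_compose[OF computable_fun2_diff]
  computable_fun_if

section \<open>Enumerable predicates\<close>

lemma ex_pfst_psnd: "(\<exists>w. R (pfst w) (psnd w)) \<longleftrightarrow> (\<exists>x y. R x y)"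
  by (metis pfst_encode psnd_encode)

text \<open>Enumerable predicates are treated as projections of zero sets of total functions, which
  keeps partiality out of the closure properties. The link with the domains of programs is made by
  \<open>ce_pred_imp_ce_set\<close> and \<open>ce_pred_ce_set\<close>.\<close>

definition ce_by :: "(nat \<Rightarrow> nat) \<Rightarrow> (nat \<Rightarrow> bool) \<Rightarrow> bool" where
  "ce_by G P \<longleftrightarrow> computable_fun G \<and> (\<forall>x. P x \<longleftrightarrow> (\<exists>w. G (prod_encode (w, x)) = 0))"

lemma ce_by_computable: "ce_by G P \<Longrightarrow> computable_fun G"
  and ce_by_iff: "ce_by G P \<Longrightarrow> P x \<longleftrightarrow> (\<exists>w. G (prod_encode (w, x)) = 0)"
  unfolding ce_by_def by blast+

definition ce_pred :: "(nat \<Rightarrow> bool) \<Rightarrow> bool" where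
  "ce_pred P \<longleftrightarrow> (\<exists>G. ce_by G P)"

lemma ce_predI:
  "computable_fun G \<Longrightarrow> (\<And>x. P x \<longleftrightarrow> (\<exists>w. G (prod_encode (w, x)) = 0)) \<Longrightarrow> ce_pred P"
  unfolding ce_pred_def ce_by_def by blast

lemma ce_pred_eq:
  assumes "computable_fun F" "computable_fun G"
  shows "ce_pred (\<lambda>x. F x = G x)"
  by (rule ce_predI[of "\<lambda>n. (F (psnd n) - G (psnd n)) + (G (psnd n) - F (psnd n))"])
    (intro computable_intros computable_fun_compose[OF assms(1)]
      computable_fun_compose[OF assms(2)], auto)

lemma ce_pred_neq:
  assumes "computable_fun F" "computable_fun G"
  shows "ce_pred (\<lambda>x. F x \<noteq> G x)"
  by (rule ce_predI
      [of "\<lambda>n. 1 - ((F (psnd n) - G (psnd n)) + (G (psnd n) - F (psnd n)))"])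
    (intro computable_intros computable_fun_compose[OF assms(1)]
      computable_fun_compose[OF assms(2)], auto)

lemma ce_pred_subst:
  assumes "ce_pred P" "computable_fun F"
  shows "ce_pred (\<lambda>x. P (F x))"
proof -
  obtain G where "ce_by G P"
    using assms(1) unfolding ce_pred_def by blast
  note G = ce_by_computable[OF this] ce_by_iff[OF this]
  show ?thesis
    by (rule ce_predI[of "\<lambda>n. G (prod_encode (pfst n, F (psnd n)))"])
      (intro computable_intros computable_fun_compose[OF assms(2)]
        computable_fun_compose[OF G(1)], simp add: G(2))
qed

lemma ce_pred_subst2:
  assumes "ce_pred (\<lambda>n. R (pfst n) (psnd n))" "computable_fun F" "computable_fun G"
  shows "ce_pred (\<lambda>x. R (F x) (G x))"
  using ce_pred_subst[OF assms(1), of "\<lambda>x. prod_encode (F x, G x)"] assms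
  by (simp add: computable_intros)

lemma ce_pred_subst3:
  assumes "ce_pred (\<lambda>n. R (pfst n) (pfst (psnd n)) (psnd (psnd n)))"
    "computable_fun F" "computable_fun G" "computable_fun H"
  shows "ce_pred (\<lambda>x. R (F x) (G x) (H x))"
  using ce_pred_subst[OF assms(1), of "\<lambda>x. prod_encode (F x, prod_encode (G x, H x))"] assms
  by (simp add: computable_intros)

lemma ce_pred_conj:
  assumes "ce_pred P" "ce_pred Q"
  shows "ce_pred (\<lambda>x. P x \<and> Q x)"
proof -
  obtain G H where G: "ce_by G P" and H: "ce_by H Q"
    using assms unfolding ce_pred_def by blast
  note G = ce_by_computable[OF G] ce_by_iff[OF G] and H = ce_by_computable[OF H] ce_by_iff[OF H]
  show ?thesis
  proof (rule ce_predI[of "\<lambda>n. G (prod_encode (pfst (pfst n), psnd n))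
      + H (prod_encode (psnd (pfst n), psnd n))"])
    show "P x \<and> Q x \<longleftrightarrow> (\<exists>w. G (prod_encode (pfst (pfst (prod_encode (w, x))),
      psnd (prod_encode (w, x)))) + H (prod_encode (psnd (pfst (prod_encode (w, x))),
      psnd (prod_encode (w, x)))) = 0)" for x
      unfolding G(2) H(2)
      using ex_pfst_psnd[of "\<lambda>v w. G (prod_encode (v, x)) + H (prod_encode (w, x)) = 0"]
      by simp
  qed (rule computable_intros computable_fun_compose[OF G(1)] computable_fun_compose[OF H(1)])+
qed

lemma ce_pred_disj:
  assumes "ce_pred P" "ce_pred Q"
  shows "ce_pred (\<lambda>x. P x \<or> Q x)"
proof -
  obtain G H where G: "ce_by G P" and H: "ce_by H Q"
    using assms unfolding ce_pred_def by blast
  note G = ce_by_computable[OF G] ce_by_iff[OF G] and H = ce_by_computable[OF H] ce_by_iff[OF H]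
  show ?thesis
  \<comment> \<open>The first component of the witness announces which disjunct the second component
    verifies.\<close>
  proof (rule ce_predI[of "\<lambda>n. if pfst (pfst n) = 0 then G (prod_encode (psnd (pfst n), psnd n))
      else H (prod_encode (psnd (pfst n), psnd n))"])
    show "P x \<or> Q x \<longleftrightarrow> (\<exists>w. (if pfst (pfst (prod_encode (w, x))) = 0 then
      G (prod_encode (psnd (pfst (prod_encode (w, x))), psnd (prod_encode (w, x)))) else
      H (prod_encode (psnd (pfst (prod_encode (w, x))), psnd (prod_encode (w, x))))) = 0)" for x
      unfolding G(2) H(2) pfst_encode psnd_encode ex_pfst_psnd[of "\<lambda>i w.
        (if i = 0 then G (prod_encode (w, x)) else H (prod_encode (w, x))) = 0"]
      by (metis zero_neq_one)
  qed (rule computable_intros computable_fun_compose[OF G(1)] computable_fun_compose[OF H(1)])+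
qed

lemma ce_pred_ex:
  assumes "ce_pred (\<lambda>n. Q (pfst n) (psnd n))"
  shows "ce_pred (\<lambda>x. \<exists>y. Q y x)"
proof -
  obtain G where "ce_by G (\<lambda>n. Q (pfst n) (psnd n))"
    using assms unfolding ce_pred_def by blast
  note G = ce_by_computable[OF this] ce_by_iff[OF this]
  have G2: "Q y x \<longleftrightarrow> (\<exists>w. G (prod_encode (w, prod_encode (y, x))) = 0)" for x y
    using G(2)[of "prod_encode (y, x)"] by simp
  show ?thesis
  proof (rule ce_predI
      [of "\<lambda>n. G (prod_encode (pfst (pfst n), prod_encode (psnd (pfst n), psnd n)))"])
    show "(\<exists>y. Q y x) \<longleftrightarrow> (\<exists>w. G (prod_encode (pfst (pfst (prod_encode (w, x))),
      prod_encode (psnd (pfst (prod_encode (w, x))), psnd (prod_encode (w, x))))) = 0)" for x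
      unfolding G2 pfst_encode psnd_encode
        ex_pfst_psnd[of "\<lambda>w y. G (prod_encode (w, prod_encode (y, x))) = 0"] by (rule ex_comm)
  qed (intro computable_intros computable_fun_compose[OF G(1)])
qed

lemma ce_pred_const: "ce_pred (\<lambda>x. P)"
  using ce_pred_eq[of "\<lambda>x. 0" "\<lambda>x. if P then 0 else 1"] by (cases P) (simp_all add: computable_intros)

lemma ce_pred_all_list:
  "(\<And>y. y \<in> set ys \<Longrightarrow> ce_pred (P y)) \<Longrightarrow> ce_pred (\<lambda>x. \<forall>y\<in>set ys. P y x)"
  by (induction ys) (simp_all add: ce_pred_conj ce_pred_const)

lemma ce_pred_ex_less:
  "(\<And>i. i < k \<Longrightarrow> ce_pred (P i)) \<Longrightarrow> ce_pred (\<lambda>x. \<exists>i<k. P i x)" for k :: nat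
  by (induction k) (simp_all add: ce_pred_disj ce_pred_const less_Suc_eq conj_disj_distribR ex_disj_distrib)

lemmas ce_intros = ce_pred_eq ce_pred_neq ce_pred_conj ce_pred_disj ce_pred_ex ce_pred_const
  computable_intros

section \<open>Predicates generated by enumerable rules\<close>

lemma list_decode_Suc: "list_decode (Suc n) = pfst n # list_decode (psnd n)"
  by (simp add: pfst_def psnd_def split: prod.split)

lemma list_decode_eq_Nil: "list_decode c = [] \<longleftrightarrow> c = 0"
  by (metis list_decode.simps(1) list_decode_inverse list_encode.simps(1))

lemma list_decode_eq_Cons:
  "list_decode c = x # xs \<longleftrightarrow> c = Suc (prod_encode (x, list_encode xs))"
  by (metis list_decode_inverse list_encode.simps(2) list_encode_inverse)

declare list_decode.simps(2) [simp del] list_decode_Suc [simp]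

lemma ex_code_eq: "(\<exists>x r. d = prod_encode (x, r) \<and> Q x r) \<longleftrightarrow> Q (pfst d) (psnd d)"
  by (metis pfst_encode psnd_encode prod_encode_pfst_psnd)

text \<open>Recursion over coded lists, terms, formulas and computations is cast in this form below.
  Every rule has exactly two premises; where one is enough, it is repeated.\<close>

inductive ce_closure :: "(nat \<Rightarrow> bool) \<Rightarrow> (nat \<Rightarrow> nat \<Rightarrow> nat \<Rightarrow> bool) \<Rightarrow> nat \<Rightarrow> bool"
  for Ax R where
  ax: "Ax c \<Longrightarrow> ce_closure Ax R c"
| step: "R c p q \<Longrightarrow> ce_closure Ax R p \<Longrightarrow> ce_closure Ax R q \<Longrightarrow> ce_closure Ax R c"

text \<open>Derivations are searched for by a machine whose state \<open>(s, ws)\<close> consists of a stack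
  of goals and a stream of instructions. An instruction \<open>(k, v, p, q)\<close> asks to discharge the
  topmost goal as an axiom (\<open>k = 0\<close>) or to replace it by \<open>p\<close> and \<open>q\<close>, where \<open>v\<close>
  witnesses that this is allowed. Illegal instructions leave the state unchanged.\<close>

theorem ce_pred_closure:
  assumes "ce_pred Ax" and "ce_pred (\<lambda>n. R (pfst n) (pfst (psnd n)) (psnd (psnd n)))"
  shows "ce_pred (ce_closure Ax R)"
proof -
  obtain G H where G: "ce_by G Ax"
    and H: "ce_by H (\<lambda>n. R (pfst n) (pfst (psnd n)) (psnd (psnd n)))"
    using assms unfolding ce_pred_def by blast
  have R_iff: "R c p q \<longleftrightarrow> (\<exists>w. H (prod_encode (w, prod_encode (c, prod_encode (p, q)))) = 0)"
    for c p q
    using ce_by_iff[OF H, of "prod_encode (c, prod_encode (p, q))"] by simp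
  note Ax_iff = ce_by_iff[OF G]
  define st where "st n = (if pfst n = 0 then n
    else if pfst (pfst (psnd n)) = 0 then
      (if G (prod_encode (pfst (psnd (pfst (psnd n))), pfst (pfst n - 1))) = 0
       then prod_encode (psnd (pfst n - 1), psnd (psnd n)) else n)
    else (if H (prod_encode (pfst (psnd (pfst (psnd n))),
          prod_encode (pfst (pfst n - 1), psnd (psnd (pfst (psnd n)))))) = 0
       then prod_encode (Suc (prod_encode (pfst (psnd (psnd (pfst (psnd n)))),
          Suc (prod_encode (psnd (psnd (psnd (pfst (psnd n)))), psnd (pfst n - 1))))),
          psnd (psnd n)) else n))" for n
  have st: "computable_fun st"
    unfolding st_def
    by (intro computable_intros computable_fun_compose[OF ce_by_computable[OF G]]
        computable_fun_compose[OF ce_by_computable[OF H]])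
  \<comment> \<open>The invariant is followed backwards: if all goals on the stack after a step are
    derivable, then so were all goals before it. The empty stack satisfies it trivially, so every
    goal of a run that empties the stack is derivable.\<close>
  let ?I = "\<lambda>n. \<forall>c\<in>set (list_decode (pfst n)). ce_closure Ax R c"
  have sound1: "?I n" if I: "?I (st n)" for n
  proof (cases "pfst n")
    case (Suc s)
    define c r ws k v p q where "c = pfst s" and "r = psnd s" and "ws = psnd (psnd n)"
      and "k = pfst (pfst (psnd n))" and "v = pfst (psnd (pfst (psnd n)))"
      and "p = pfst (psnd (psnd (pfst (psnd n))))" and "q = psnd (psnd (psnd (pfst (psnd n))))"
    note defs = this
    have st_n: "st n = (if k = 0 then if G (prod_encode (v, c)) = 0 then prod_encode (r, ws) else n
      else if H (prod_encode (v, prod_encode (c, prod_encode (p, q)))) = 0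
        then prod_encode (Suc (prod_encode (p, Suc (prod_encode (q, r)))), ws) else n)"
      unfolding st_def defs by (simp add: Suc)
    have ax: "ce_closure Ax R c" if "G (prod_encode (v, c)) = 0"
      using that Ax_iff by (blast intro: ce_closure.ax)
    have step: "ce_closure Ax R c" if "H (prod_encode (v, prod_encode (c, prod_encode (p, q)))) = 0"
      "ce_closure Ax R p" "ce_closure Ax R q"
      using that R_iff by (blast intro: ce_closure.step)
    have "?I n \<longleftrightarrow> ce_closure Ax R c \<and> (\<forall>c\<in>set (list_decode r). ce_closure Ax R c)"
      by (simp add: Suc c_def r_def)
    then show ?thesis using I ax step unfolding st_n by (auto split: if_splits)
  qed simp
  have sound: "?I n" if "?I ((st ^^ k) n)" for n k
    using that
  proof (induction k)
    case (Suc k)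
    have "?I ((st ^^ k) n)" by (rule sound1) (use Suc.prems in simp)
    then show ?case by (rule Suc.IH)
  qed simp
  \<comment> \<open>A derivation of \<open>c\<close> gives instructions that remove \<open>c\<close>
    and leave the stack \<open>s\<close> below untouched. The remaining stream \<open>ws\<close> is
    arbitrary, so that the instructions for \<open>p\<close> can be put in front of those for
    \<open>q\<close>.\<close>
  have complete: "\<exists>k ws'. (st ^^ k) (prod_encode (Suc (prod_encode (c, s)), ws')) = prod_encode (s, ws)"
    if "ce_closure Ax R c" for c s ws
    using that
  proof (induction arbitrary: s ws)
    case (ax c)
    then obtain w where "G (prod_encode (w, c)) = 0" using Ax_iff by blast
    then have "(st ^^ 1) (prod_encode (Suc (prod_encode (c, s)),
        prod_encode (prod_encode (0, prod_encode (w, 0)), ws))) = prod_encode (s, ws)"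
      by (simp add: st_def)
    then show ?case by blast
  next
    case (step c p q)
    obtain w where w: "H (prod_encode (w, prod_encode (c, prod_encode (p, q)))) = 0"
      using step.hyps R_iff by blast
    obtain k2 ws2
      where 2: "(st ^^ k2) (prod_encode (Suc (prod_encode (q, s)), ws2)) = prod_encode (s, ws)"
      using step.IH(2) by blast
    obtain k1 ws1 where 1: "(st ^^ k1) (prod_encode
        (Suc (prod_encode (p, Suc (prod_encode (q, s)))), ws1)) =
        prod_encode (Suc (prod_encode (q, s)), ws2)"
      using step.IH(1) by blast
    have 0: "(st ^^ 1) (prod_encode (Suc (prod_encode (c, s)),
        prod_encode (prod_encode (1, prod_encode (w, prod_encode (p, q))), ws1))) =
        prod_encode (Suc (prod_encode (p, Suc (prod_encode (q, s)))), ws1)"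
      by (simp add: st_def w)
    have "(st ^^ (k2 + (k1 + 1))) (prod_encode (Suc (prod_encode (c, s)),
        prod_encode (prod_encode (1, prod_encode (w, prod_encode (p, q))), ws1))) =
        prod_encode (s, ws)"
      unfolding funpow_add o_apply 0 1 2 ..
    then show ?case by blast
  qed
  have "ce_closure Ax R c \<longleftrightarrow> (\<exists>k ws. pfst ((st ^^ k)
      (prod_encode (Suc (prod_encode (c, 0)), ws))) = 0)" for c
  proof
    assume "ce_closure Ax R c"
    then show "\<exists>k ws. pfst ((st ^^ k) (prod_encode (Suc (prod_encode (c, 0)), ws))) = 0"
      using complete[of c 0 0] by (metis pfst_encode)
  next
    assume "\<exists>k ws. pfst ((st ^^ k) (prod_encode (Suc (prod_encode (c, 0)), ws))) = 0"
    then obtain k ws where "pfst ((st ^^ k) (prod_encode (Suc (prod_encode (c, 0)), ws))) = 0"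
      by blast
    then show "ce_closure Ax R c"
      using sound[of k "prod_encode (Suc (prod_encode (c, 0)), ws)"] by simp
  qed
  then have *: "ce_closure Ax R = (\<lambda>c. \<exists>k ws. pfst ((st ^^ k)
      (prod_encode (Suc (prod_encode (c, 0)), ws))) = 0)" by (intro ext)
  show ?thesis unfolding *
    by (intro ce_intros computable_fun2_compose[OF computable_fun2_funpow[OF st]])
qed

section \<open>Unbounded search\<close>

lemma computable_fun_Least:
  assumes K: "computable_fun K" and ex: "\<And>x. \<exists>m. K (prod_encode (m, x)) = 0"
  shows "computable_fun (\<lambda>x. LEAST m. K (prod_encode (m, x)) = 0)"
proof -
  have "computable_fun2 (\<lambda>m x. K (prod_encode (m, x)))"
    by (rule computable_fun2_compose1[OF K computable_fun2_prod_encode])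
  then obtain f where f: "\<And>m x. computes f [m, x] (K (prod_encode (m, x)))"
    unfolding computable_fun2_def by blast
  have "computes (Mu f) [x] (LEAST m. K (prod_encode (m, x)) = 0)" for x
  proof (rule computes.mu)
    show "computes f [LEAST m. K (prod_encode (m, x)) = 0, x] 0"
      using f[of "LEAST m. K (prod_encode (m, x)) = 0" x] LeastI_ex[OF ex] by simp
    show "\<forall>i<LEAST m. K (prod_encode (m, x)) = 0. \<exists>k. computes f [i, x] (Suc k)"
      using f by (metis not_less_Least not0_implies_Suc)
  qed
  then show ?thesis unfolding computable_fun_def by blast
qed

text \<open>The search runs over pairs of a witness and a candidate value. It ends because
  \<open>F\<close> is total, and its second component is then the value of \<open>F\<close>.\<close>

lemma computable_fun_graph:
  assumes "ce_pred (\<lambda>n. F (pfst n) = psnd n)"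
  shows "computable_fun F"
proof -
  obtain G where G: "ce_by G (\<lambda>n. F (pfst n) = psnd n)"
    using assms unfolding ce_pred_def by blast
  have F: "F x = y \<longleftrightarrow> (\<exists>w. G (prod_encode (w, prod_encode (x, y))) = 0)" for x y
    using ce_by_iff[OF G, of "prod_encode (x, y)"] by simp
  let ?K = "\<lambda>n. G (prod_encode (pfst (pfst n), prod_encode (psnd n, psnd (pfst n))))"
  have K: "computable_fun ?K"
    by (intro computable_intros computable_fun_compose[OF ce_by_computable[OF G]])
  have ex: "\<exists>m. ?K (prod_encode (m, x)) = 0" for x
    using F[of x "F x"] by (metis pfst_encode psnd_encode)
  have "psnd (LEAST m. ?K (prod_encode (m, x)) = 0) = F x" for x
    using LeastI_ex[OF ex, of x] F[of x "psnd (LEAST m. ?K (prod_encode (m, x)) = 0)"]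
    by auto
  then show ?thesis
    using computable_fun_compose[OF computable_fun_psnd computable_fun_Least[OF K ex]] by simp
qed

text \<open>The program that searches for a witness halts exactly on the members of the set.\<close>

lemma ce_pred_imp_ce_set:
  assumes "ce_pred P"
  shows "\<exists>f. ce_set f = {x. P x}"
proof -
  obtain G where G: "ce_by G P"
    using assms unfolding ce_pred_def by blast
  have "computable_fun2 (\<lambda>m x. G (prod_encode (m, x)))"
    by (rule computable_fun2_compose1[OF ce_by_computable[OF G] computable_fun2_prod_encode])
  then obtain f where f: "\<And>m x. computes f [m, x] (G (prod_encode (m, x)))"
    unfolding computable_fun2_def by blast
  have "(\<exists>y. computes (Mu f) [x] y) \<longleftrightarrow> P x" for x
  proof
    assume "\<exists>y. computes (Mu f) [x] y"
    then obtain y where "computes f [y, x] 0" by (auto elim: computes.cases)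
    then have "G (prod_encode (y, x)) = 0" using computes_det f by blast
    then show "P x" using ce_by_iff[OF G] by blast
  next
    assume "P x"
    then have ex: "\<exists>m. G (prod_encode (m, x)) = 0" using ce_by_iff[OF G] by blast
    have "computes (Mu f) [x] (LEAST m. G (prod_encode (m, x)) = 0)"
    proof (rule computes.mu)
      show "computes f [LEAST m. G (prod_encode (m, x)) = 0, x] 0"
        using f[of "LEAST m. G (prod_encode (m, x)) = 0" x] LeastI_ex[OF ex] by simp
      show "\<forall>i<LEAST m. G (prod_encode (m, x)) = 0. \<exists>k. computes f [i, x] (Suc k)"
        using f by (metis not_less_Least not0_implies_Suc)
    qed
    then show "\<exists>y. computes (Mu f) [x] y" by blast
  qed
  then show ?thesis unfolding ce_set_def by blast
qed

section \<open>Enumerability of the graphs of programs\<close>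

definition nth_rel :: "nat \<Rightarrow> nat \<Rightarrow> nat \<Rightarrow> bool" where
  "nth_rel c i v \<longleftrightarrow> i < length (list_decode c) \<and> list_decode c ! i = v"

lemma ce_pred_nth_rel: "ce_pred (\<lambda>n. nth_rel (pfst n) (pfst (psnd n)) (psnd (psnd n)))"
proof -
  \<comment> \<open>Here \<open>n\<close> codes \<open>(c, (i, v))\<close>. A derivation strips
    heads off the list while the index decreases to 0.\<close>
  define Ax where "Ax n \<longleftrightarrow> pfst (psnd n) = 0 \<and>
    (\<exists>r. pfst n = Suc (prod_encode (psnd (psnd n), r)))" for n
  define R where "R n p q \<longleftrightarrow> pfst (psnd n) = Suc (pfst (psnd p)) \<and> psnd (psnd n) = psnd (psnd p) \<and>
    (\<exists>x. pfst n = Suc (prod_encode (x, pfst p)))" for n p q :: nat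
  have "ce_pred (ce_closure Ax R)"
    by (rule ce_pred_closure; unfold Ax_def R_def; intro ce_intros)
  moreover have "nth_rel (pfst n) (pfst (psnd n)) (psnd (psnd n))" if "ce_closure Ax R n" for n
    using that by induction (auto simp: Ax_def R_def nth_rel_def)
  moreover have "ce_closure Ax R (prod_encode (c, prod_encode (i, v)))" if "nth_rel c i v" for c i v
    using that
  proof (induction i arbitrary: c)
    case 0
    then obtain x xs where "list_decode c = x # xs" unfolding nth_rel_def by (cases "list_decode c") auto
    then show ?case using 0 by (auto intro!: ce_closure.ax simp: Ax_def nth_rel_def list_decode_eq_Cons)
  next
    case (Suc i)
    then obtain x xs where xs: "list_decode c = x # xs" unfolding nth_rel_def by (cases "list_decode c") auto
    then have "nth_rel (list_encode xs) i v" using Suc.prems by (auto simp: nth_rel_def)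
    then show ?case using xs
      by (intro ce_closure.step[OF _ Suc.IH Suc.IH]) (auto simp: R_def list_decode_eq_Cons)
  qed
  ultimately have "(\<lambda>n. nth_rel (pfst n) (pfst (psnd n)) (psnd (psnd n))) = ce_closure Ax R"
    by (intro ext) (metis prod_encode_pfst_psnd)
  then show ?thesis using \<open>ce_pred (ce_closure Ax R)\<close> by simp
qed

lemmas ce_nth_rel = ce_pred_subst3[of nth_rel, OF ce_pred_nth_rel]

lemma computes_Comp_iff:
  "computes (Comp f gs) xs z \<longleftrightarrow>
    (\<exists>ys. list_all2 (\<lambda>g y. computes g xs y) gs ys \<and> computes f ys z)"
proof
  assume "computes (Comp f gs) xs z"
  then show "\<exists>ys. list_all2 (\<lambda>g y. computes g xs y) gs ys \<and> computes f ys z"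
  proof cases
    case (comp ys)
    then show ?thesis by (intro exI[of _ ys]) (simp add: list_all2_conv_all_nth)
  qed
next
  assume "\<exists>ys. list_all2 (\<lambda>g y. computes g xs y) gs ys \<and> computes f ys z"
  then show "computes (Comp f gs) xs z"
    by (auto simp: list_all2_conv_all_nth intro: computes.comp)
qed

lemma ce_pred_list_all2:
  assumes "\<And>g. g \<in> set gs \<Longrightarrow> ce_pred (\<lambda>n. P g (pfst n) (psnd n))"
  shows "ce_pred (\<lambda>n. list_all2 (\<lambda>g y. P g (pfst n) y) gs (list_decode (psnd n)))"
  using assms
proof (induction gs)
  case Nil
  show ?case by (simp add: list_decode_eq_Nil) (intro ce_intros)
next
  case (Cons g gs)
  have eq: "list_all2 (\<lambda>g y. P g a y) (g # gs) (list_decode c) \<longleftrightarrow> (\<exists>y r.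
      c = Suc (prod_encode (y, r)) \<and> P g a y \<and> list_all2 (\<lambda>g y. P g a y) gs (list_decode r))"
    for a c
  proof (cases c)
    case (Suc d)
    then show ?thesis by (simp add: ex_code_eq)
  qed simp
  have 1: "ce_pred (\<lambda>n. P g (pfst n) (psnd n))"
    and 2: "ce_pred (\<lambda>n. list_all2 (\<lambda>g y. P g (pfst n) y) gs (list_decode (psnd n)))"
    using Cons by auto
  show ?case unfolding eq
    by (intro ce_pred_subst2[of "P g", OF 1] ce_pred_subst2[OF 2] ce_intros)
qed

text \<open>Induction on a fixed program. A composition guesses the list of intermediate values;
  recursion and minimisation become closures whose derivations pass through all earlier
  stages.\<close>

theorem ce_pred_computes: "ce_pred (\<lambda>n. computes f (list_decode (pfst n)) (psnd n))"
proof (induction f)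
  case Zero
  have "computes Zero xs y \<longleftrightarrow> y = 0" for xs y
    by (auto intro: computes.zero elim: computes.cases)
  then show ?case by simp (intro ce_intros)
next
  case Succ
  have "computes Succ (list_decode a) y \<longleftrightarrow> (\<exists>x r. a = Suc (prod_encode (x, r)) \<and> y = Suc x)" for a y
  proof
    assume "computes Succ (list_decode a) y"
    then show "\<exists>x r. a = Suc (prod_encode (x, r)) \<and> y = Suc x"
      by cases (auto simp: list_decode_eq_Cons dest!: sym[of _ "list_decode a"])
  qed (auto intro: computes.succ)
  then show ?case by simp (intro ce_intros)
next
  case (Proj i)
  have "computes (Proj i) (list_decode a) y \<longleftrightarrow> nth_rel a i y" for a y
    by (auto simp: nth_rel_def intro: computes.proj elim: computes.cases)
  then show ?case by simp (intro ce_nth_rel ce_intros)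
next
  case (Comp f gs)
  have *: "computes (Comp f gs) xs z \<longleftrightarrow> (\<exists>c. list_all2 (\<lambda>g y. computes g xs y) gs (list_decode c)
      \<and> computes f (list_decode c) z)" for xs z
    unfolding computes_Comp_iff by (metis list_encode_inverse)
  show ?case
    unfolding * by (intro ce_intros ce_pred_subst2[OF Comp.IH(1)]
        ce_pred_subst2[OF ce_pred_list_all2[OF Comp.IH(2)]])
next
  case (Prec g h)
  note g = ce_pred_subst2[OF Prec.IH(1)] and h = ce_pred_subst2[OF Prec.IH(2)]
  \<comment> \<open>Here \<open>n\<close> codes \<open>(m, (r, y))\<close>, to be read as: the
    recursion has the value \<open>y\<close> at \<open>m\<close> with the parameters
    \<open>r\<close>.\<close>
  define Ax where "Ax n \<longleftrightarrow> pfst n = 0 \<and>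
    computes g (list_decode (pfst (psnd n))) (psnd (psnd n))" for n
  define R where "R n p q \<longleftrightarrow> pfst n = Suc (pfst p) \<and> pfst (psnd n) = pfst (psnd p) \<and>
    computes h (list_decode (Suc (prod_encode (pfst p,
      Suc (prod_encode (psnd (psnd p), pfst (psnd p))))))) (psnd (psnd n))" for n p q :: nat
  have ce: "ce_pred (ce_closure Ax R)"
    by (rule ce_pred_closure; unfold Ax_def R_def; intro ce_intros g h)
  have 1: "computes (Prec g h) (pfst n # list_decode (pfst (psnd n))) (psnd (psnd n))"
    if "ce_closure Ax R n" for n
    using that by induction (auto simp: Ax_def R_def intro: computes.prec_0 computes.prec_Suc)
  have 2: "ce_closure Ax R (prod_encode (m, prod_encode (r, y)))"
    if "computes (Prec g h) (m # list_decode r) y" for m r y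
    using that
  proof (induction m arbitrary: y)
    case 0
    then show ?case by cases (auto intro!: ce_closure.ax simp: Ax_def)
  next
    case (Suc m)
    from Suc.prems show ?case
    proof cases
      case (prec_Suc y')
      note c = Suc.IH[OF prec_Suc(1)]
      show ?thesis
        by (rule ce_closure.step[OF _ c c]) (use prec_Suc(2) in \<open>simp add: R_def\<close>)
    qed
  qed
  have *: "computes (Prec g h) (list_decode a) y \<longleftrightarrow> (\<exists>m r. a = Suc (prod_encode (m, r)) \<and>
      ce_closure Ax R (prod_encode (m, prod_encode (r, y))))" for a y
  proof
    assume c: "computes (Prec g h) (list_decode a) y"
    then obtain m xs where "list_decode a = m # xs"
      by cases auto
    then show "\<exists>m r. a = Suc (prod_encode (m, r)) \<and>
        ce_closure Ax R (prod_encode (m, prod_encode (r, y)))"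
      using c 2[of m "list_encode xs" y] by (auto simp: list_decode_eq_Cons)
  qed (use 1 in fastforce)
  show ?case unfolding * by (intro ce_intros ce_pred_subst[OF ce])
next
  case (Mu f)
  note f = ce_pred_subst2[OF Mu.IH]
  \<comment> \<open>Here \<open>n\<close> codes \<open>(m, r)\<close>, to be read as:
    \<open>f\<close> is defined and positive at all arguments below \<open>m\<close>. This turns the
    bounded quantifier in the rule for \<open>Mu\<close> into an enumerable condition.\<close>
  define Ax where "Ax n \<longleftrightarrow> pfst n = 0" for n
  define R where "R n p q \<longleftrightarrow> pfst n = Suc (pfst p) \<and> psnd n = psnd p \<and>
    (\<exists>k. computes f (list_decode (Suc (prod_encode (pfst p, psnd p)))) (Suc k))" for n p q :: nat
  have ce: "ce_pred (ce_closure Ax R)"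
    by (rule ce_pred_closure; unfold Ax_def R_def; intro ce_intros f)
  have 1: "\<forall>i<pfst n. \<exists>k. computes f (i # list_decode (psnd n)) (Suc k)"
    if "ce_closure Ax R n" for n
    using that by induction (auto simp: Ax_def R_def less_Suc_eq)
  have 2: "ce_closure Ax R (prod_encode (m, r))"
    if "\<forall>i<m. \<exists>k. computes f (i # list_decode r) (Suc k)" for m r
    using that
  proof (induction m)
    case 0
    then show ?case by (auto intro!: ce_closure.ax simp: Ax_def)
  next
    case (Suc m)
    then have c: "ce_closure Ax R (prod_encode (m, r))" by simp
    show ?case
      by (rule ce_closure.step[OF _ c c]) (use Suc.prems in \<open>simp add: R_def\<close>)
  qed
  have *: "computes (Mu f) (list_decode a) y \<longleftrightarrow> ce_closure Ax R (prod_encode (y, a)) \<and>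
      computes f (list_decode (Suc (prod_encode (y, a)))) 0" for a y
  proof
    assume "computes (Mu f) (list_decode a) y"
    then show "ce_closure Ax R (prod_encode (y, a)) \<and>
        computes f (list_decode (Suc (prod_encode (y, a)))) 0"
      by cases (simp add: 2)
  next
    assume "ce_closure Ax R (prod_encode (y, a)) \<and>
        computes f (list_decode (Suc (prod_encode (y, a)))) 0"
    then show "computes (Mu f) (list_decode a) y"
      using 1[of "prod_encode (y, a)"] by (auto intro: computes.mu)
  qed
  show ?case unfolding * by (intro ce_intros f ce_pred_subst[OF ce])
qed

lemmas ce_computes = ce_pred_subst2[OF ce_pred_computes]

lemma ce_pred_ce_set: "ce_pred (\<lambda>x. x \<in> ce_set f)"
proof -
  have *: "x \<in> ce_set f \<longleftrightarrow> (\<exists>y. computes f (list_decode (Suc (prod_encode (x, 0)))) y)" for x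
    by (simp add: ce_set_def)
  show ?thesis unfolding * by (intro ce_intros ce_computes)
qed

section \<open>Passage between enumerability and computable relations\<close>

lemma ce_pred_length:
  "ce_pred (\<lambda>c. length (list_decode c) = k) \<and> ce_pred (\<lambda>c. length (list_decode c) \<noteq> k)"
proof (induction k)
  case 0
  show ?case unfolding length_0_conv list_decode_eq_Nil by (intro conjI ce_intros)
next
  case (Suc k)
  have 1: "length (list_decode c) = Suc k \<longleftrightarrow>
      (\<exists>x r. c = Suc (prod_encode (x, r)) \<and> length (list_decode r) = k)"
    and 2: "length (list_decode c) \<noteq> Suc k \<longleftrightarrow>
      c = 0 \<or> (\<exists>x r. c = Suc (prod_encode (x, r)) \<and> length (list_decode r) \<noteq> k)" for c
    by (cases c; simp add: ex_code_eq)+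
  note ce = Suc[THEN conjunct1, THEN ce_pred_subst] Suc[THEN conjunct2, THEN ce_pred_subst]
  have "ce_pred (\<lambda>c. length (list_decode c) = Suc k)"
    unfolding 1 by (intro ce ce_intros)
  moreover have "ce_pred (\<lambda>c. length (list_decode c) \<noteq> Suc k)"
    unfolding 2 by (intro ce ce_intros)
  ultimately show ?case by blast
qed

text \<open>Post's theorem: the graph of the characteristic function is enumerable, so the function
  is computable.\<close>

lemma computable_fun_decide:
  assumes "ce_pred P" "ce_pred (\<lambda>x. \<not> P x)"
  shows "computable_fun (\<lambda>x. if P x then 1 else 0)"
proof (rule computable_fun_graph)
  have "(if P x then 1 else 0) = y \<longleftrightarrow> P x \<and> y = 1 \<or> \<not> P x \<and> y = (0 :: nat)" for x y by auto
  then show "ce_pred (\<lambda>n. (if P (pfst n) then 1 else 0) = psnd n)"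
    by simp (intro ce_intros assms[THEN ce_pred_subst])
qed

text \<open>Programs for relations receive \<open>k\<close> separate arguments, whereas enumerable
  predicates speak about one code. The program that collects the arguments is built from the last
  entry forwards, over suffixes of length \<open>j\<close>.\<close>

lemma list_encode_computes:
  assumes "j \<le> k"
  shows "\<exists>f. \<forall>xs. length xs = k \<longrightarrow> computes f xs (list_encode (drop (k - j) xs))"
  using assms
proof (induction j)
  case 0
  show ?case by (intro exI[of _ Zero]) (auto intro: computes.zero)
next
  case (Suc j)
  then obtain f where f: "\<And>xs. length xs = k \<Longrightarrow> computes f xs (list_encode (drop (k - j) xs))"
    by auto
  have "computable_fun2 (\<lambda>x y. Suc (prod_encode (x, y)))"
    by (rule computable_fun2_compose1[OF computable_fun_Suc computable_fun2_prod_encode])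
  then obtain g where g: "\<And>x y. computes g [x, y] (Suc (prod_encode (x, y)))"
    unfolding computable_fun2_def by blast
  have "computes (Comp g [Proj (k - Suc j), f]) xs (list_encode (drop (k - Suc j) xs))"
    if l: "length xs = k" for xs
  proof -
    have "drop (k - Suc j) xs = xs ! (k - Suc j) # drop (k - j) xs"
      using l Suc.prems Cons_nth_drop_Suc[of "k - Suc j" xs] by (simp add: Suc_diff_Suc)
    moreover have "computes (Proj (k - Suc j)) xs (xs ! (k - Suc j))"
      using l Suc.prems by (auto intro: computes.proj)
    ultimately show ?thesis
      using computes_Comp2[OF _ f[OF l] g] by simp
  qed
  then show ?case by blast
qed

text \<open>Post's theorem for \<open>k\<close>-tuples. Nothing is assumed about \<open>P\<close>
  and \<open>Q\<close> on codes of lists of other lengths, so these are assigned to the complement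
  before deciding.\<close>

lemma computable_relI:
  assumes "ce_pred P" "ce_pred Q"
    and "\<And>xs. length xs = k \<Longrightarrow> xs \<in> R \<longleftrightarrow> P (list_encode xs)"
    and "\<And>xs. length xs = k \<Longrightarrow> xs \<notin> R \<longleftrightarrow> Q (list_encode xs)"
  shows "computable_rel k R"
proof -
  let ?P = "\<lambda>c. length (list_decode c) = k \<and> P c"
  have neg: "\<not> ?P c \<longleftrightarrow> length (list_decode c) \<noteq> k \<or> Q c \<and> length (list_decode c) = k" for c
    using assms(3,4)[of "list_decode c"] unfolding list_decode_inverse by blast
  have "ce_pred ?P"
    by (intro ce_pred_conj ce_pred_length[THEN conjunct1] assms(1))
  moreover have "ce_pred (\<lambda>c. \<not> ?P c)"
    unfolding neg by (intro ce_pred_disj ce_pred_conj ce_pred_length[THEN conjunct1]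
        ce_pred_length[THEN conjunct2] assms(2))
  ultimately have "computable_fun (\<lambda>c. if ?P c then 1 else 0)"
    by (rule computable_fun_decide)
  then obtain f where f: "\<And>c. computes f [c] (if ?P c then 1 else 0)"
    unfolding computable_fun_def by blast
  obtain e where e: "\<And>xs. length xs = k \<Longrightarrow> computes e xs (list_encode xs)"
    using list_encode_computes[of k k] by auto
  have "computes (Comp f [e]) xs (if xs \<in> R then 1 else 0)" if l: "length xs = k" for xs
  proof -
    have "(if xs \<in> R then 1 else 0) = (if ?P (list_encode xs) then 1 else (0 :: nat))"
      using assms(3) l by simp
    then show ?thesis using computes_Comp1[OF e[OF l] f] by (simp only:)
  qed
  then show ?thesis unfolding computable_rel_def by blast
qed

lemma computable_relD:
  assumes "computable_rel k R"
  shows "ce_pred (\<lambda>c. length (list_decode c) = k \<and> list_decode c \<in> R)"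
    and "ce_pred (\<lambda>c. length (list_decode c) = k \<and> list_decode c \<notin> R)"
proof -
  obtain f where f: "\<And>xs. length xs = k \<Longrightarrow> computes f xs (if xs \<in> R then 1 else 0)"
    using assms unfolding computable_rel_def by blast
  have "xs \<in> R \<longleftrightarrow> computes f xs 1" "xs \<notin> R \<longleftrightarrow> computes f xs 0" if "length xs = k" for xs
    using f[OF that] computes_det by (metis zero_neq_one)+
  then have *: "length (list_decode c) = k \<and> list_decode c \<in> R \<longleftrightarrow>
      length (list_decode c) = k \<and> computes f (list_decode c) 1"
    "length (list_decode c) = k \<and> list_decode c \<notin> R \<longleftrightarrow>
      length (list_decode c) = k \<and> computes f (list_decode c) 0" for c
    by blast+
  show "ce_pred (\<lambda>c. length (list_decode c) = k \<and> list_decode c \<in> R)"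
    unfolding *(1) by (intro ce_pred_length[THEN conjunct1] ce_computes ce_intros)
  show "ce_pred (\<lambda>c. length (list_decode c) = k \<and> list_decode c \<notin> R)"
    unfolding *(2) by (intro ce_pred_length[THEN conjunct1] ce_computes ce_intros)
qed

section \<open>Terms and homomorphisms\<close>

lemma val_in_dom:
  assumes "structure_of L A" "set v \<subseteq> dom A" "wf_tm L (length v) t"
  shows "val A v t \<in> dom A"
  using assms(3)
proof (induction t)
  case (App i ts)
  then have "map (val A v) ts \<in> tuples A (L ! i)"
    by (auto simp: tuples_def list_all_iff)
  then show ?case using assms(1) App.prems by (auto simp: structure_of_def)
qed (use assms(2) in auto)

lemma hom_dom: "hom L A B h \<Longrightarrow> x \<in> dom A \<Longrightarrow> h x \<in> dom B"
  unfolding hom_def by blast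

lemma hom_tuples: "hom L A B h \<Longrightarrow> xs \<in> tuples A n \<Longrightarrow> map h xs \<in> tuples B n"
  by (auto simp: tuples_def dest: hom_dom)

lemma val_hom:
  assumes A: "structure_of L A" and h: "hom L A B h"
    and v: "set v \<subseteq> dom A" and t: "wf_tm L (length v) t"
  shows "val B (map h v) t = h (val A v t)"
  using t
proof (induction t)
  case (App i ts)
  then have wf: "\<forall>t\<in>set ts. wf_tm L (length v) t" by (simp add: list_all_iff)
  then have "map (val A v) ts \<in> tuples A (L ! i)"
    using App.prems val_in_dom[OF A v] by (auto simp: tuples_def)
  then have "h (fn A i (map (val A v) ts)) = fn B i (map h (map (val A v) ts))"
    using h App.prems unfolding hom_def by auto
  moreover have "map (val B (map h v)) ts = map h (map (val A v) ts)"
    using App.IH wf by simp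
  ultimately show ?case by (simp only: val.simps)
qed simp

lemma sat_qf_hom:
  assumes A: "structure_of L A" and h: "hom L A B h" "inj_on h (dom A)"
    and v: "set v \<subseteq> dom A" and q: "wf_qf L (length v) q"
  shows "sat_qf B (map h v) q \<longleftrightarrow> sat_qf A v q"
  using q
proof (induction q)
  case (Eq s t)
  then show ?case
    using val_hom[OF A h(1) v] val_in_dom[OF A v] h(2) by (auto dest: inj_onD)
qed auto

lemma generated_subset:
  assumes A: "structure_of L A" and X: "X \<subseteq> dom A" and x: "x \<in> generated L A X"
  shows "x \<in> dom A"
  using x
proof induction
  case (app i xs)
  then have "xs \<in> tuples A (L ! i)" by (auto simp: tuples_def)
  then show ?case using A app by (auto simp: structure_of_def)
qed (use X in blast)

lemma generated_iff_val:
  "x \<in> generated L A (set v) \<longleftrightarrow> (\<exists>t. wf_tm L (length v) t \<and> val A v t = x)"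
proof
  assume "x \<in> generated L A (set v)"
  then show "\<exists>t. wf_tm L (length v) t \<and> val A v t = x"
  proof induction
    case (base x)
    then obtain i where "i < length v" "v ! i = x" by (auto simp: in_set_conv_nth)
    then show ?case by (intro exI[of _ "Var i"]) simp
  next
    case (app i xs)
    then obtain f where f: "\<And>x. x \<in> set xs \<Longrightarrow> wf_tm L (length v) (f x) \<and> val A v (f x) = x"
      by metis
    have "map (\<lambda>x. val A v (f x)) xs = xs" using f by (simp add: map_idI)
    then have "wf_tm L (length v) (App i (map f xs)) \<and> val A v (App i (map f xs)) = fn A i xs"
      using f app by (simp add: list_all_iff comp_def)
    then show ?case by blast
  qed
next
  have "val A v t \<in> generated L A (set v)" if "wf_tm L (length v) t" for t
    using that
  proof (induction t)
    case (App i ts)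
    then show ?case
      using generated.app[of i L "map (val A v) ts"] by (auto simp: list_all_iff)
  qed (auto intro: generated.base)
  then show "\<exists>t. wf_tm L (length v) t \<and> val A v t = x \<Longrightarrow> x \<in> generated L A (set v)"
    by blast
qed

lemma generates_iff_val:
  assumes "structure_of L A"
  shows "generates L A v \<longleftrightarrow> set v \<subseteq> dom A \<and>
    (\<forall>x\<in>dom A. \<exists>t. wf_tm L (length v) t \<and> val A v t = x)"
  unfolding generates_def using generated_subset[OF assms] generated_iff_val[of _ L A v]
  by blast

lemma generates_vals:
  assumes "structure_of L A" "generates L A v" "set xs \<subseteq> dom A"
  obtains ts where "\<forall>t\<in>set ts. wf_tm L (length v) t" "map (val A v) ts = xs"
proof -
  have "\<forall>x\<in>set xs. \<exists>t. wf_tm L (length v) t \<and> val A v t = x"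
    using assms generates_iff_val by blast
  then obtain f where f: "\<And>x. x \<in> set xs \<Longrightarrow> wf_tm L (length v) (f x) \<and> val A v (f x) = x"
    by metis
  then have "map (val A v) (map f xs) = xs" by (simp add: map_idI)
  then show thesis using f that[of "map f xs"] by auto
qed

lemma hom_comp:
  assumes "hom L A B g" "hom L B C h"
  shows "hom L A C (h \<circ> g)"
proof -
  have "map g xs \<in> tuples B n" if "xs \<in> tuples A n" for xs n
    using hom_tuples[OF assms(1) that] .
  then show ?thesis using assms unfolding hom_def by (auto simp: image_subset_iff)
qed

lemma iso_hom: "iso L A B h \<Longrightarrow> hom L A B h"
  and iso_inj: "iso L A B h \<Longrightarrow> inj_on h (dom A)"
  and iso_image: "iso L A B h \<Longrightarrow> h ` dom A = dom B"
  unfolding iso_def bij_betw_def by auto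

lemma iso_inv:
  assumes A: "structure_of L A" and h: "iso L A B h"
  shows "iso L B A (inv_into (dom A) h)"
proof -
  let ?g = "inv_into (dom A) h"
  have bij: "bij_betw ?g (dom B) (dom A)"
    using h bij_betw_inv_into unfolding iso_def by blast
  have "?g (fn B i ys) = fn A i (map ?g ys)" if i: "i < length L" and ys: "ys \<in> tuples B (L ! i)"
    for i ys
  proof -
    have xs: "map ?g ys \<in> tuples A (L ! i)"
      using ys bij by (auto simp: tuples_def bij_betw_def)
    have "\<forall>y\<in>set ys. h (?g y) = y"
      using ys f_inv_into_f[of _ h "dom A"] unfolding tuples_def iso_image[OF h] by blast
    then have "map h (map ?g ys) = ys" by (simp add: map_idI)
    then have "fn B i ys = h (fn A i (map ?g ys))"
      using iso_hom[OF h] i xs unfolding hom_def by metis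
    moreover have "fn A i (map ?g ys) \<in> dom A"
      using A i xs by (auto simp: structure_of_def)
    ultimately show ?thesis using iso_inj[OF h] by simp
  qed
  then show ?thesis using bij unfolding iso_def hom_def bij_betw_def by blast
qed

text \<open>The image contains the value of every term at \<open>map h v\<close>, hence everything
  that this tuple generates.\<close>

lemma hom_generates:
  assumes A: "structure_of L A" and B: "structure_of L B" and h: "hom L A B h"
    and v: "set v \<subseteq> dom A" and gen: "generates L B (map h v)"
  shows "h ` dom A = dom B"
proof -
  have "y \<in> h ` dom A" if y: "y \<in> dom B" for y
  proof -
    obtain t where "wf_tm L (length v) t" "val B (map h v) t = y"
      using gen y generates_iff_val[OF B] by fastforce
    then show ?thesis using val_hom[OF A h v] val_in_dom[OF A v] by force
  qed
  then show ?thesis using h unfolding hom_def by blast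
qed

lemma surj_generates:
  assumes A: "structure_of L A" and B: "structure_of L B" and h: "hom L A B h"
    and surj: "h ` dom A = dom B" and gen: "generates L A v"
  shows "generates L B (map h v)"
proof -
  have v: "set v \<subseteq> dom A" using gen unfolding generates_def by blast
  have "\<exists>t. wf_tm L (length (map h v)) t \<and> val B (map h v) t = y" if "y \<in> dom B" for y
  proof -
    obtain x where "x \<in> dom A" "y = h x" using \<open>y \<in> dom B\<close> surj by blast
    then obtain t where "wf_tm L (length v) t" "val A v t = x"
      using gen generates_iff_val[OF A] by blast
    then show ?thesis using val_hom[OF A h v] \<open>y = h x\<close> by auto
  qed
  moreover have "set (map h v) \<subseteq> dom B" using v surj by auto
  ultimately show ?thesis using generates_iff_val[OF B] by blast
qed

lemma map_hom_vals:
  assumes A: "structure_of L A" and h: "hom L A B h"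
    and v: "set v \<subseteq> dom A" and ts: "\<forall>t\<in>set ts. wf_tm L (length v) t"
  shows "map h (map (val A v) ts) = map (val B (map h v)) ts"
  using val_hom[OF A h v] ts by simp

section \<open>Evaluation of terms and quantifier-free formulas in computable structures\<close>

text \<open>Places a term in a block of variables that follows \<open>k\<close> others, as required
  for the tuple \<open>x\<close> in the formulas of the Scott sentence.\<close>

primrec shift_tm :: "nat \<Rightarrow> tm \<Rightarrow> tm" where
  "shift_tm k (Var i) = Var (k + i)"
| "shift_tm k (App i ts) = App i (map (shift_tm k) ts)"

lemma shift_tm_0 [simp]: "shift_tm 0 t = t"
  by (induction t) (auto intro: map_idI)

lemma wf_shift_tm: "wf_tm L n t \<Longrightarrow> wf_tm L (k + n) (shift_tm k t)"
  by (induction t) (auto simp: list_all_iff)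

lemma val_shift_tm:
  "length us = k \<Longrightarrow> wf_tm L (length v) t \<Longrightarrow> val A (us @ v) (shift_tm k t) = val A v t"
proof (induction t)
  case (App i ts)
  then have "map (val A (us @ v)) (map (shift_tm k) ts) = map (val A v) ts"
    by (simp add: list_all_iff)
  then show ?case by (simp only: shift_tm.simps val.simps)
qed (simp add: nth_append)

text \<open>The code \<open>t\<close> belongs to the shifted term, the value \<open>v\<close> to the
  original one. For \<open>k = 0\<close> this is plain evaluation; for larger \<open>k\<close> it
  enumerates codes fit for a longer context together with values at the tuple coded by
  \<open>a\<close>.\<close>

definition val_rel :: "lang \<Rightarrow> nat struct \<Rightarrow> nat \<Rightarrow> nat \<Rightarrow> nat \<Rightarrow> nat \<Rightarrow> bool" where
  "val_rel L A k a t v \<longleftrightarrow> set (list_decode a) \<subseteq> dom A \<and> (\<exists>s. t = tm_code (shift_tm k s) \<and>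
    wf_tm L (length (list_decode a)) s \<and> v = val A (list_decode a) s)"

definition vals_rel :: "lang \<Rightarrow> nat struct \<Rightarrow> nat \<Rightarrow> nat \<Rightarrow> nat \<Rightarrow> nat \<Rightarrow> bool" where
  "vals_rel L A k a c v \<longleftrightarrow> set (list_decode a) \<subseteq> dom A \<and>
    (\<exists>ts. c = list_encode (map (\<lambda>t. tm_code (shift_tm k t)) ts) \<and>
    (\<forall>t\<in>set ts. wf_tm L (length (list_decode a)) t) \<and>
    v = list_encode (map (val A (list_decode a)) ts))"

text \<open>The truth value \<open>b\<close> is an argument because enumerability of truth alone
  would not survive negation.\<close>

definition qf_rel :: "lang \<Rightarrow> nat struct \<Rightarrow> nat \<Rightarrow> nat \<Rightarrow> nat \<Rightarrow> bool" where
  "qf_rel L A b a c \<longleftrightarrow> set (list_decode a) \<subseteq> dom A \<and> (\<exists>q. c = qf_code q \<and>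
    wf_qf L (length (list_decode a)) q \<and> b = (if sat_qf A (list_decode a) q then 1 else 0))"

context
  fixes L :: lang and A :: "nat struct"
  assumes comp: "computable_structure L A"
begin

lemma structure_A: "structure_of L A"
  using comp unfolding computable_structure_def by blast

lemma ce_pred_dom: "ce_pred (\<lambda>x. x \<in> dom A)" "ce_pred (\<lambda>x. x \<notin> dom A)"
proof -
  have "computable_rel 1 {[x] |x. x \<in> dom A}"
    using comp unfolding computable_structure_def computable_set_def by blast
  note computable_relD[OF this, THEN ce_pred_subst, of "\<lambda>x. Suc (prod_encode (x, 0))"]
  then show "ce_pred (\<lambda>x. x \<in> dom A)" "ce_pred (\<lambda>x. x \<notin> dom A)"
    by (auto simp: computable_intros)
qed

lemmas ce_dom = ce_pred_dom[THEN ce_pred_subst]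

lemma ce_pred_subset_dom: "ce_pred (\<lambda>c. set (list_decode c) \<subseteq> dom A)"
proof -
  define R where "R n p q \<longleftrightarrow> (\<exists>x. n = Suc (prod_encode (x, p)) \<and> x \<in> dom A)" for n p q :: nat
  have ce: "ce_pred (ce_closure (\<lambda>n. n = 0) R)"
    by (rule ce_pred_closure; (unfold R_def)?; intro ce_dom ce_intros)
  have *: "ce_closure (\<lambda>n. n = 0) R c \<longleftrightarrow> set (list_decode c) \<subseteq> dom A" for c
  proof
    assume "ce_closure (\<lambda>n. n = 0) R c"
    then show "set (list_decode c) \<subseteq> dom A" by induction (auto simp: R_def)
  next
    have "set xs \<subseteq> dom A \<Longrightarrow> ce_closure (\<lambda>n. n = 0) R (list_encode xs)" for xs
    proof (induction xs)
      case (Cons x xs)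
      then have c: "ce_closure (\<lambda>n. n = 0) R (list_encode xs)" by simp
      show ?case by (rule ce_closure.step[OF _ c c]) (use Cons.prems in \<open>auto simp: R_def\<close>)
    qed (auto intro: ce_closure.ax)
    from this[of "list_decode c"]
    show "set (list_decode c) \<subseteq> dom A \<Longrightarrow> ce_closure (\<lambda>n. n = 0) R c" by simp
  qed
  show ?thesis unfolding *[symmetric] by (fact ce)
qed

lemmas ce_subset_dom = ce_pred_subset_dom[THEN ce_pred_subst]

definition fn_rel :: "nat \<Rightarrow> nat \<Rightarrow> nat \<Rightarrow> bool" where
  "fn_rel i c v \<longleftrightarrow> i < length L \<and> list_decode c \<in> tuples A (L ! i) \<and> fn A i (list_decode c) = v"

text \<open>Each function symbol has its own program. As the language is finite, a finite
  disjunction over the symbols makes the relation enumerable with \<open>i\<close> as an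
  argument.\<close>

lemma ce_pred_fn_rel: "ce_pred (\<lambda>n. fn_rel (pfst n) (pfst (psnd n)) (psnd (psnd n)))"
proof -
  have "\<forall>i. \<exists>f. i < length L \<longrightarrow> (\<forall>xs\<in>tuples A (L ! i). computes f xs (fn A i xs))"
    using comp unfolding computable_structure_def by blast
  then obtain f where f: "\<And>i xs. i < length L \<Longrightarrow> xs \<in> tuples A (L ! i) \<Longrightarrow>
      computes (f i) xs (fn A i xs)" by metis
  have "fn A i xs = v \<longleftrightarrow> computes (f i) xs v" if "i < length L" "xs \<in> tuples A (L ! i)" for i xs v
    using f[OF that] computes_det by blast
  then have *: "fn_rel i c v \<longleftrightarrow> (\<exists>j<length L. length (list_decode c) = L ! j \<and> i = j \<and>
      set (list_decode c) \<subseteq> dom A \<and> computes (f j) (list_decode c) v)" for i c v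
    unfolding fn_rel_def by (auto simp: tuples_def)
  show ?thesis
    unfolding * by (intro ce_pred_ex_less ce_pred_conj ce_computes ce_subset_dom
        ce_pred_length[THEN conjunct1, THEN ce_pred_subst]) (intro ce_intros)+
qed

lemmas ce_fn_rel = ce_pred_subst3[of fn_rel, OF ce_pred_fn_rel]

text \<open>Terms and lists of terms are evaluated by one mutual recursion. Its nodes are codes of
  \<open>(b, (a, (t, v)))\<close>, where the tag \<open>b\<close> is 0 for a term and 1 for a list:
  an application is derived from its list of arguments, and a list from its head and tail.\<close>

lemma ce_pred_val_rel:
  "ce_pred (\<lambda>n. val_rel L A k (pfst n) (pfst (psnd n)) (psnd (psnd n)))" (is ?val)
  and ce_pred_vals_rel:
  "ce_pred (\<lambda>n. vals_rel L A k (pfst n) (pfst (psnd n)) (psnd (psnd n)))" (is ?vals)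
proof -
  define Ax where "Ax n \<longleftrightarrow> set (list_decode (pfst (psnd n))) \<subseteq> dom A \<and>
    (pfst n = 0 \<and> (\<exists>i. pfst (psnd (psnd n)) = prod_encode (0, k + i) \<and>
        nth_rel (pfst (psnd n)) i (psnd (psnd (psnd n)))) \<or>
     pfst n = 1 \<and> pfst (psnd (psnd n)) = 0 \<and> psnd (psnd (psnd n)) = 0)" for n
  define R where "R n p q \<longleftrightarrow>
    pfst n = 0 \<and> pfst p = 1 \<and> pfst (psnd n) = pfst (psnd p) \<and>
      (\<exists>i. pfst (psnd (psnd n)) = prod_encode (1, prod_encode (i, pfst (psnd (psnd p)))) \<and>
        fn_rel i (psnd (psnd (psnd p))) (psnd (psnd (psnd n)))) \<or>
    pfst n = 1 \<and> pfst p = 0 \<and> pfst q = 1 \<and> pfst (psnd n) = pfst (psnd p) \<and>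
      pfst (psnd n) = pfst (psnd q) \<and>
      pfst (psnd (psnd n)) = Suc (prod_encode (pfst (psnd (psnd p)), pfst (psnd (psnd q)))) \<and>
      psnd (psnd (psnd n)) = Suc (prod_encode (psnd (psnd (psnd p)), psnd (psnd (psnd q))))"
    for n p q :: nat
  let ?I = "\<lambda>b a t v. ce_closure Ax R (prod_encode (b, prod_encode (a, prod_encode (t, v))))"
  have ce: "ce_pred (ce_closure Ax R)"
    by (rule ce_pred_closure; unfold Ax_def R_def;
        intro ce_subset_dom ce_nth_rel ce_fn_rel ce_intros)
  have sound: "(pfst n = 0 \<longrightarrow>
      val_rel L A k (pfst (psnd n)) (pfst (psnd (psnd n))) (psnd (psnd (psnd n)))) \<and>
    (pfst n = 1 \<longrightarrow>
      vals_rel L A k (pfst (psnd n)) (pfst (psnd (psnd n))) (psnd (psnd (psnd n))))"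
    if "ce_closure Ax R n" for n
    using that
  proof induction
    case (ax n)
    have "val_rel L A k a (prod_encode (0, k + i)) v"
      if "set (list_decode a) \<subseteq> dom A" "nth_rel a i v" for a i v
      using that unfolding val_rel_def nth_rel_def by (auto intro!: exI[of _ "Var i"])
    moreover have "vals_rel L A k a 0 0" if "set (list_decode a) \<subseteq> dom A" for a
      using that unfolding vals_rel_def by (auto intro!: exI[of _ "[]"])
    ultimately show ?case using ax unfolding Ax_def by auto
  next
    case (step n p q)
    have app: "val_rel L A k a (prod_encode (1, prod_encode (i, c))) v"
      if vs: "vals_rel L A k a c w" and fn: "fn_rel i w v" for a i c w v
    proof -
      obtain ts where ts: "c = list_encode (map (\<lambda>t. tm_code (shift_tm k t)) ts)"
        "\<forall>t\<in>set ts. wf_tm L (length (list_decode a)) t"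
        "w = list_encode (map (val A (list_decode a)) ts)"
        and a: "set (list_decode a) \<subseteq> dom A"
        using vs unfolding vals_rel_def by blast
      have "wf_tm L (length (list_decode a)) (App i ts)" "v = val A (list_decode a) (App i ts)"
        using fn ts unfolding fn_rel_def by (auto simp: list_all_iff tuples_def)
      moreover have "prod_encode (1, prod_encode (i, c)) = tm_code (shift_tm k (App i ts))"
        using ts by (simp add: comp_def)
      ultimately show ?thesis using a unfolding val_rel_def by blast
    qed
    have cons: "vals_rel L A k a (Suc (prod_encode (t, c))) (Suc (prod_encode (v, w)))"
      if v: "val_rel L A k a t v" and vs: "vals_rel L A k a c w" for a t v c w
    proof -
      obtain s where "t = tm_code (shift_tm k s)" "wf_tm L (length (list_decode a)) s"
        "v = val A (list_decode a) s"
        using v unfolding val_rel_def by blast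
      moreover obtain ts where
        "c = list_encode (map (\<lambda>t. tm_code (shift_tm k t)) ts)"
        "\<forall>t\<in>set ts. wf_tm L (length (list_decode a)) t"
        "w = list_encode (map (val A (list_decode a)) ts)"
        using vs unfolding vals_rel_def by blast
      ultimately show ?thesis
        using vs unfolding vals_rel_def by (auto intro!: exI[of _ "s # ts"])
    qed
    show ?case
    proof (cases "pfst n = 0")
      case True
      then show ?thesis using step.hyps(1) step.IH(1) app unfolding R_def by auto
    next
      case False
      then show ?thesis using step.hyps(1) step.IH cons unfolding R_def by auto
    qed
  qed
  have list: "?I 1 a (list_encode (map (\<lambda>t. tm_code (shift_tm k t)) ts))
      (list_encode (map (val A (list_decode a)) ts))"
    if "set (list_decode a) \<subseteq> dom A"
      "\<forall>t\<in>set ts. ?I 0 a (tm_code (shift_tm k t)) (val A (list_decode a) t)" for a ts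
    using that(2)
  proof (induction ts)
    case Nil
    then show ?case using that(1) by (auto intro!: ce_closure.ax simp: Ax_def)
  next
    case (Cons t ts)
    then have c: "?I 0 a (tm_code (shift_tm k t)) (val A (list_decode a) t)"
      "?I 1 a (list_encode (map (\<lambda>t. tm_code (shift_tm k t)) ts))
        (list_encode (map (val A (list_decode a)) ts))" by auto
    show ?case by (rule ce_closure.step[OF _ c]) (simp add: R_def)
  qed
  have tm: "?I 0 a (tm_code (shift_tm k t)) (val A (list_decode a) t)"
    if a: "set (list_decode a) \<subseteq> dom A" and wf: "wf_tm L (length (list_decode a)) t" for a t
    using wf
  proof (induction t)
    case (Var i)
    then show ?case using a by (auto intro!: ce_closure.ax simp: Ax_def nth_rel_def)
  next
    case (App i ts)
    then have "\<forall>t\<in>set ts. ?I 0 a (tm_code (shift_tm k t)) (val A (list_decode a) t)"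
      by (simp add: list_all_iff)
    note c = list[OF a this]
    have "fn_rel i (list_encode (map (val A (list_decode a)) ts)) (val A (list_decode a) (App i ts))"
      using App.prems val_in_dom[OF structure_A a]
      by (auto simp: fn_rel_def tuples_def list_all_iff)
    then show ?case
      by (intro ce_closure.step[OF _ c c]) (simp add: R_def comp_def)
  qed
  have "val_rel L A k a t v \<longleftrightarrow> ?I 0 a t v" for a t v
  proof
    show "val_rel L A k a t v \<Longrightarrow> ?I 0 a t v" using tm unfolding val_rel_def by blast
    show "?I 0 a t v \<Longrightarrow> val_rel L A k a t v"
      using sound[of "prod_encode (0, prod_encode (a, prod_encode (t, v)))"] by simp
  qed
  then show ?val by simp (intro ce_pred_subst[OF ce] ce_intros)
  have "vals_rel L A k a t v \<longleftrightarrow> ?I 1 a t v" for a t v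
  proof
    show "vals_rel L A k a t v \<Longrightarrow> ?I 1 a t v" using list tm unfolding vals_rel_def by blast
    show "?I 1 a t v \<Longrightarrow> vals_rel L A k a t v"
      using sound[of "prod_encode (1, prod_encode (a, prod_encode (t, v)))"] by simp
  qed
  then show ?vals by simp (intro ce_pred_subst[OF ce] ce_intros)
qed

lemmas ce_val_rel = ce_pred_subst3[of "val_rel L A k" for k, OF ce_pred_val_rel]
lemmas ce_vals_rel = ce_pred_subst3[of "vals_rel L A k" for k, OF ce_pred_vals_rel]

text \<open>For two computed numbers, inequality can be verified just like equality, so both truth
  values are available for atoms and propagate through the connectives.\<close>

lemma ce_pred_qf_rel:
  "ce_pred (\<lambda>n. qf_rel L A (pfst n) (pfst (psnd n)) (psnd (psnd n)))"
proof -
  define Ax where "Ax n \<longleftrightarrow> (\<exists>s t v w. psnd (psnd n) = prod_encode (0, prod_encode (s, t)) \<and>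
    val_rel L A 0 (pfst (psnd n)) s v \<and> val_rel L A 0 (pfst (psnd n)) t w \<and>
    (pfst n = 1 \<and> v = w \<or> pfst n = 0 \<and> v \<noteq> w))" for n
  define R where "R n p q \<longleftrightarrow> pfst (psnd n) = pfst (psnd p) \<and> pfst (psnd n) = pfst (psnd q) \<and>
    (psnd (psnd n) = prod_encode (1, psnd (psnd p)) \<and> pfst n = 1 - pfst p \<or>
     psnd (psnd n) = prod_encode (2, prod_encode (psnd (psnd p), psnd (psnd q))) \<and>
       pfst n = (if pfst p = 0 then 0 else pfst q) \<or>
     psnd (psnd n) = prod_encode (3, prod_encode (psnd (psnd p), psnd (psnd q))) \<and>
       pfst n = (if pfst p = 0 then pfst q else 1))" for n p q :: nat
  let ?I = "\<lambda>b a c. ce_closure Ax R (prod_encode (b, prod_encode (a, c)))"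
  have ce: "ce_pred (ce_closure Ax R)"
    by (rule ce_pred_closure; unfold Ax_def R_def; intro ce_val_rel ce_intros)
  have sound: "qf_rel L A (pfst n) (pfst (psnd n)) (psnd (psnd n))" if "ce_closure Ax R n" for n
    using that
  proof induction
    case (ax n)
    have "qf_rel L A b a (prod_encode (0, prod_encode (s, t)))"
      if s: "val_rel L A 0 a s v" and t: "val_rel L A 0 a t w" and b: "b = 1 \<and> v = w \<or> b = 0 \<and> v \<noteq> w"
      for a b s t v w
    proof -
      obtain s' t' where "s = tm_code s'" "t = tm_code t'"
        "wf_tm L (length (list_decode a)) s'" "wf_tm L (length (list_decode a)) t'"
        "v = val A (list_decode a) s'" "w = val A (list_decode a) t'"
        using s t unfolding val_rel_def shift_tm_0 by blast
      then show ?thesis using s b unfolding qf_rel_def val_rel_def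
        by (auto intro!: exI[of _ "Eq s' t'"])
    qed
    then show ?case using ax unfolding Ax_def by metis
  next
    case (step n p q)
    obtain a p' q' where p: "pfst (psnd n) = a" "pfst (psnd p) = a" "pfst (psnd q) = a"
      "psnd (psnd p) = qf_code p'" "psnd (psnd q) = qf_code q'"
      "wf_qf L (length (list_decode a)) p'" "wf_qf L (length (list_decode a)) q'"
      "pfst p = (if sat_qf A (list_decode a) p' then 1 else 0)"
      "pfst q = (if sat_qf A (list_decode a) q' then 1 else 0)"
      "set (list_decode a) \<subseteq> dom A"
      using step.hyps(1) step.IH unfolding R_def qf_rel_def by auto
    have "\<exists>r. psnd (psnd n) = qf_code r \<and> wf_qf L (length (list_decode a)) r \<and>
        pfst n = (if sat_qf A (list_decode a) r then 1 else 0)"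
      using step.hyps(1) unfolding R_def p(4,5,8,9)
    proof (elim conjE disjE)
      assume "psnd (psnd n) = prod_encode (1, qf_code p')"
        "pfst n = 1 - (if sat_qf A (list_decode a) p' then 1 else 0)"
      then show ?thesis using p by (intro exI[of _ "Neg p'"]) simp
    next
      assume "psnd (psnd n) = prod_encode (2, prod_encode (qf_code p', qf_code q'))"
        "pfst n = (if (if sat_qf A (list_decode a) p' then 1 else 0) = (0 :: nat) then 0
          else if sat_qf A (list_decode a) q' then 1 else 0)"
      then show ?thesis using p by (intro exI[of _ "And p' q'"]) simp
    next
      assume "psnd (psnd n) = prod_encode (3, prod_encode (qf_code p', qf_code q'))"
        "pfst n = (if (if sat_qf A (list_decode a) p' then 1 else 0) = (0 :: nat)
          then if sat_qf A (list_decode a) q' then 1 else 0 else 1)"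
      then show ?thesis using p by (intro exI[of _ "Or p' q'"]) simp
    qed
    then show ?case using p unfolding qf_rel_def by auto
  qed
  have complete: "?I (if sat_qf A (list_decode a) q then 1 else 0) a (qf_code q)"
    if a: "set (list_decode a) \<subseteq> dom A" and wf: "wf_qf L (length (list_decode a)) q" for a q
    using wf
  proof (induction q)
    case (Eq s t)
    have "val_rel L A 0 a (tm_code r) (val A (list_decode a) r)"
      if "wf_tm L (length (list_decode a)) r" for r
      using a that unfolding val_rel_def by (auto intro!: exI[of _ r])
    note this[of s] this[of t]
    then show ?case using Eq
      by (intro ce_closure.ax) (cases "val A (list_decode a) s = val A (list_decode a) t";
        auto simp: Ax_def)
  next
    case (Neg q)
    then have c: "?I (if sat_qf A (list_decode a) q then 1 else 0) a (qf_code q)" by simp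
    show ?case by (rule ce_closure.step[OF _ c c]) (simp add: R_def)
  next
    case (And p q)
    then have c: "?I (if sat_qf A (list_decode a) p then 1 else 0) a (qf_code p)"
      "?I (if sat_qf A (list_decode a) q then 1 else 0) a (qf_code q)" by simp_all
    show ?case by (rule ce_closure.step[OF _ c]) (simp add: R_def)
  next
    case (Or p q)
    then have c: "?I (if sat_qf A (list_decode a) p then 1 else 0) a (qf_code p)"
      "?I (if sat_qf A (list_decode a) q then 1 else 0) a (qf_code q)" by simp_all
    show ?case by (rule ce_closure.step[OF _ c]) (simp add: R_def)
  qed
  have "qf_rel L A b a c \<longleftrightarrow> ?I b a c" for a b c
  proof
    show "qf_rel L A b a c \<Longrightarrow> ?I b a c" using complete unfolding qf_rel_def by blast
    show "?I b a c \<Longrightarrow> qf_rel L A b a c"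
      using sound[of "prod_encode (b, prod_encode (a, c))"] by simp
  qed
  then show ?thesis by simp (intro ce_pred_subst[OF ce] ce_intros)
qed

lemmas ce_qf_rel = ce_pred_subst3[of "qf_rel L A", OF ce_pred_qf_rel]

end

section \<open>Computable infinitary formulas of low complexity\<close>

lemma sat_Disj: "sat A (Disj F) v \<longleftrightarrow> (\<exists>\<phi>\<in>rcset F. sat A \<phi> v)"
  and sat_Conj: "sat A (Conj F) v \<longleftrightarrow> (\<forall>\<phi>\<in>rcset F. sat A \<phi> v)"
  by (simp_all add: cimage.rep_eq)

lemma wf_form_Disj: "wf_form L (Disj F) k \<longleftrightarrow> (\<forall>\<phi>\<in>rcset F. wf_form L \<phi> k)"
  and wf_form_Conj: "wf_form L (Conj F) k \<longleftrightarrow> (\<forall>\<phi>\<in>rcset F. wf_form L \<phi> k)"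
  by (simp_all add: cimage.rep_eq)

lemma tuples_0 [simp]: "tuples A 0 = {[]}"
  by (auto simp: tuples_def)

lemma sigma_index_0_disjuncts:
  "(\<exists>j\<in>{..0}. \<exists>m d \<theta>. \<chi> = Q m \<theta> \<and> prod_encode (j, prod_encode (m, d)) \<in> S \<and>
      sigma_index L j (k + m) d \<theta>) \<longleftrightarrow>
    (\<exists>m q. \<chi> = Q m (QF q) \<and> prod_encode (0, prod_encode (m, qf_code q)) \<in> S \<and> wf_qf L (k + m) q)"
  and sigma_index_0_codes:
  "(\<exists>j\<in>{..0}. \<exists>m d \<theta>. c = prod_encode (j, prod_encode (m, d)) \<and> sigma_index L j (k + m) d \<theta>) \<longleftrightarrow>
    (\<exists>m q. c = prod_encode (0, prod_encode (m, qf_code q)) \<and> wf_qf L (k + m) q)"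
  and pi_index_0_disjuncts:
  "(\<exists>j\<in>{..0}. \<exists>m d \<theta>. \<chi> = Q m \<theta> \<and> prod_encode (j, prod_encode (m, d)) \<in> S \<and>
      pi_index L j (k + m) d \<theta>) \<longleftrightarrow>
    (\<exists>m q. \<chi> = Q m (QF q) \<and> prod_encode (0, prod_encode (m, qf_code q)) \<in> S \<and> wf_qf L (k + m) q)"
  and pi_index_0_codes:
  "(\<exists>j\<in>{..0}. \<exists>m d \<theta>. c = prod_encode (j, prod_encode (m, d)) \<and> pi_index L j (k + m) d \<theta>) \<longleftrightarrow>
    (\<exists>m q. c = prod_encode (0, prod_encode (m, qf_code q)) \<and> wf_qf L (k + m) q)"
  by (simp_all add: ex_simps[symmetric] del: ex_simps)

text \<open>At level one the only possible \<open>j\<close> is 0, so the recursion in the definition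
  of indices disappears.\<close>

lemma sigma_index_1:
  "sigma_index L (Suc 0) k e \<phi> \<longleftrightarrow> (\<exists>f F. e = recf_code f \<and> \<phi> = Disj F \<and>
    (\<forall>c\<in>ce_set f. \<exists>m q. c = prod_encode (0, prod_encode (m, qf_code q)) \<and> wf_qf L (k + m) q) \<and>
    (\<forall>\<chi>. \<chi> \<in> rcset F \<longleftrightarrow> (\<exists>m q. \<chi> = Ex m (QF q) \<and>
      prod_encode (0, prod_encode (m, qf_code q)) \<in> ce_set f \<and> wf_qf L (k + m) q)))"
  and pi_index_1:
  "pi_index L (Suc 0) k e \<phi> \<longleftrightarrow> (\<exists>f F. e = recf_code f \<and> \<phi> = Conj F \<and>
    (\<forall>c\<in>ce_set f. \<exists>m q. c = prod_encode (0, prod_encode (m, qf_code q)) \<and> wf_qf L (k + m) q) \<and>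
    (\<forall>\<chi>. \<chi> \<in> rcset F \<longleftrightarrow> (\<exists>m q. \<chi> = All m (QF q) \<and>
      prod_encode (0, prod_encode (m, qf_code q)) \<in> ce_set f \<and> wf_qf L (k + m) q)))"
  by (simp_all only: sigma_index.simps(2) pi_index.simps(2) sigma_index_0_disjuncts
      sigma_index_0_codes pi_index_0_disjuncts pi_index_0_codes)

text \<open>The set \<open>W\<close> below consists of the pairs \<open>(m, q)\<close> such that \<open>All m (QF q)\<close> is a conjunct.
  A quantifier-free formula counts as its only conjunct, with \<open>m = 0\<close>.\<close>

lemma pi_index_le_1:
  assumes "pi_index L j k e \<theta>" "j \<le> 1"
  shows "\<exists>W. (\<forall>(m, q)\<in>W. wf_qf L (k + m) q) \<and>
    ce_pred (\<lambda>c. \<exists>m q. c = prod_encode (m, qf_code q) \<and> (m, q) \<in> W) \<and>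
    (\<forall>(B :: nat struct) v. sat B \<theta> v \<longleftrightarrow>
      (\<forall>(m, q)\<in>W. \<forall>ys\<in>tuples B m. sat_qf B (v @ ys) q))"
proof (cases j)
  case 0
  then obtain q where q: "wf_qf L k q" "\<theta> = QF q" using assms(1) by auto
  have *: "(\<exists>m q'. c = prod_encode (m, qf_code q') \<and> (m, q') \<in> {(0, q)}) \<longleftrightarrow>
      c = prod_encode (0, qf_code q)" for c
    by blast
  have "ce_pred (\<lambda>c. \<exists>m q'. c = prod_encode (m, qf_code q') \<and> (m, q') \<in> {(0, q)})"
    unfolding * by (intro ce_intros)
  then show ?thesis using q by (intro exI[of _ "{(0, q)}"] conjI) auto
next
  case (Suc j')
  then have "pi_index L (Suc 0) k e \<theta>" using assms by (cases j') auto
  then obtain f F where F: "\<theta> = Conj F"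
    and f: "\<forall>c\<in>ce_set f. \<exists>m q. c = prod_encode (0, prod_encode (m, qf_code q)) \<and> wf_qf L (k + m) q"
    and mem: "\<forall>\<chi>. \<chi> \<in> rcset F \<longleftrightarrow> (\<exists>m q. \<chi> = All m (QF q) \<and>
      prod_encode (0, prod_encode (m, qf_code q)) \<in> ce_set f \<and> wf_qf L (k + m) q)"
    unfolding pi_index_1 by (elim exE conjE)
  define W where "W = {(m, q). prod_encode (0, prod_encode (m, qf_code q)) \<in> ce_set f \<and>
    wf_qf L (k + m) q}"
  have rcset_F: "rcset F = (\<lambda>(m, q). All m (QF q)) ` W"
    by (intro set_eqI) (auto simp: mem[rule_format] image_iff W_def)
  have *: "(\<exists>m q. c = prod_encode (m, qf_code q) \<and> (m, q) \<in> W) \<longleftrightarrow> prod_encode (0, c) \<in> ce_set f"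
    for c
  proof
    assume "prod_encode (0, c) \<in> ce_set f"
    then obtain m q where "prod_encode (0, c) = prod_encode (0, prod_encode (m, qf_code q))"
      "wf_qf L (k + m) q"
      using f by blast
    then show "\<exists>m q. c = prod_encode (m, qf_code q) \<and> (m, q) \<in> W"
      using \<open>prod_encode (0, c) \<in> ce_set f\<close> unfolding W_def by auto
  qed (auto simp: W_def)
  have "ce_pred (\<lambda>c. \<exists>m q. c = prod_encode (m, qf_code q) \<and> (m, q) \<in> W)"
    unfolding * by (intro ce_pred_subst[OF ce_pred_ce_set] ce_intros)
  moreover have "sat B \<theta> v \<longleftrightarrow> (\<forall>(m, q)\<in>W. \<forall>ys\<in>tuples B m. sat_qf B (v @ ys) q)"
    for B :: "nat struct" and v
    unfolding F sat_Conj rcset_F by (simp add: case_prod_unfold)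
  ultimately show ?thesis by (intro exI[of _ W]) (auto simp: W_def)
qed

text \<open>The semantic dual of \<open>pi_index_le_1\<close>; it serves to show that
  \<open>\<pi>\<close> is preserved in the direct limit.\<close>

lemma sigma_index_le_1:
  assumes "sigma_index L j k e \<theta>" "j \<le> 1"
  shows "\<exists>W. (\<forall>(m, q)\<in>W. wf_qf L (k + m) q) \<and> (\<forall>(B :: nat struct) v. sat B \<theta> v \<longleftrightarrow>
    (\<exists>(m, q)\<in>W. \<exists>ys\<in>tuples B m. sat_qf B (v @ ys) q))"
proof (cases j)
  case 0
  then obtain q where q: "wf_qf L k q" "\<theta> = QF q" using assms(1) by auto
  then show ?thesis by (intro exI[of _ "{(0, q)}"]) auto
next
  case (Suc j')
  then have "sigma_index L (Suc 0) k e \<theta>" using assms by (cases j') auto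
  then obtain f F where F: "\<theta> = Disj F"
    and mem: "\<forall>\<chi>. \<chi> \<in> rcset F \<longleftrightarrow> (\<exists>m q. \<chi> = Ex m (QF q) \<and>
      prod_encode (0, prod_encode (m, qf_code q)) \<in> ce_set f \<and> wf_qf L (k + m) q)"
    unfolding sigma_index_1 by (elim exE conjE)
  define W where "W = {(m, q). prod_encode (0, prod_encode (m, qf_code q)) \<in> ce_set f \<and>
    wf_qf L (k + m) q}"
  have rcset_F: "rcset F = (\<lambda>(m, q). Ex m (QF q)) ` W"
    by (intro set_eqI) (auto simp: mem[rule_format] image_iff W_def)
  have "sat B \<theta> v \<longleftrightarrow> (\<exists>(m, q)\<in>W. \<exists>ys\<in>tuples B m. sat_qf B (v @ ys) q)"
    for B :: "nat struct" and v
    unfolding F sat_Disj rcset_F by (simp add: case_prod_unfold)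
  then show ?thesis by (intro exI[of _ W]) (auto simp: W_def)
qed

text \<open>Each \<open>\<theta>\<close> retains an index of its own. This suffices for
  effectiveness later, when a single disjunct true in \<open>A\<close> is fixed.\<close>

lemma computable_Sigma_2_sat:
  assumes "computable_Sigma L 2 0 \<sigma>"
  shows "\<exists>S. (\<forall>(m, \<theta>)\<in>S. \<exists>j\<le>1. \<exists>e. pi_index L j m e \<theta>) \<and>
    (\<forall>B :: nat struct. sat B \<sigma> [] \<longleftrightarrow> (\<exists>(m, \<theta>)\<in>S. \<exists>ys\<in>tuples B m. sat B \<theta> ys))"
proof -
  obtain f F where F: "\<sigma> = Disj F"
    and mem: "\<And>\<chi>. \<chi> \<in> rcset F \<longleftrightarrow> (\<exists>j\<in>{..1}. \<exists>m d \<theta>. \<chi> = Ex m \<theta> \<and>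
      prod_encode (j, prod_encode (m, d)) \<in> ce_set f \<and> pi_index L j (0 + m) d \<theta>)"
    using assms unfolding computable_Sigma_def numeral_2_eq_2 One_nat_def sigma_index.simps(2) by blast
  define S where "S = {(m, \<theta>). Ex m \<theta> \<in> rcset F}"
  have "\<exists>m \<theta>. \<chi> = Ex m \<theta>" if "\<chi> \<in> rcset F" for \<chi>
    using that unfolding mem by blast
  then have "rcset F = (\<lambda>(m, \<theta>). Ex m \<theta>) ` S"
    unfolding S_def by (force simp: image_iff)
  then have "sat B \<sigma> [] \<longleftrightarrow> (\<exists>(m, \<theta>)\<in>S. \<exists>ys\<in>tuples B m. sat B \<theta> ys)" for B :: "nat struct"
    unfolding F sat_Disj by (simp add: case_prod_unfold)
  moreover have "\<exists>j\<le>1. \<exists>e. pi_index L j m e \<theta>" if "(m, \<theta>) \<in> S" for m \<theta>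
    using that unfolding S_def mem by auto
  ultimately show ?thesis by (intro exI[of _ S]) auto
qed

lemma computable_Pi_2_sat:
  assumes "computable_Pi L 2 0 \<pi>"
  shows "\<exists>S. (\<forall>(m, \<theta>)\<in>S. \<exists>j\<le>1. \<exists>e. sigma_index L j m e \<theta>) \<and>
    (\<forall>B :: nat struct. sat B \<pi> [] \<longleftrightarrow> (\<forall>(m, \<theta>)\<in>S. \<forall>ys\<in>tuples B m. sat B \<theta> ys))"
proof -
  obtain f F where F: "\<pi> = Conj F"
    and mem: "\<And>\<chi>. \<chi> \<in> rcset F \<longleftrightarrow> (\<exists>j\<in>{..1}. \<exists>m d \<theta>. \<chi> = All m \<theta> \<and>
      prod_encode (j, prod_encode (m, d)) \<in> ce_set f \<and> sigma_index L j (0 + m) d \<theta>)"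
    using assms unfolding computable_Pi_def numeral_2_eq_2 One_nat_def pi_index.simps(2) by blast
  define S where "S = {(m, \<theta>). All m \<theta> \<in> rcset F}"
  have "\<exists>m \<theta>. \<chi> = All m \<theta>" if "\<chi> \<in> rcset F" for \<chi>
    using that unfolding mem by blast
  then have "rcset F = (\<lambda>(m, \<theta>). All m \<theta>) ` S"
    unfolding S_def by (force simp: image_iff)
  then have "sat B \<pi> [] \<longleftrightarrow> (\<forall>(m, \<theta>)\<in>S. \<forall>ys\<in>tuples B m. sat B \<theta> ys)" for B :: "nat struct"
    unfolding F sat_Conj by (simp add: case_prod_unfold)
  moreover have "\<exists>j\<le>1. \<exists>e. sigma_index L j m e \<theta>" if "(m, \<theta>) \<in> S" for m \<theta>
    using that unfolding S_def mem by auto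
  ultimately show ?thesis by (intro exI[of _ S]) auto
qed

section \<open>The direct limit of an injective endomorphism\<close>

lemma hom_funpow: "hom L A A f \<Longrightarrow> hom L A A (f ^^ n)"
proof (induction n)
  case 0
  show ?case by (auto simp: hom_def)
next
  case (Suc n)
  then show ?case using hom_comp[of L A A "f ^^ n" A f] by (simp add: comp_def)
qed

text \<open>The element \<open>x\<close> of the \<open>k\<close>-th copy of \<open>A\<close> in the limit of
  \<open>A \<rightarrow> A \<rightarrow> A \<rightarrow> \<dots>\<close> is represented by the earliest copy that contains it.\<close>

primrec lim_emb :: "(nat \<Rightarrow> nat) \<Rightarrow> nat set \<Rightarrow> nat \<Rightarrow> nat \<Rightarrow> nat" where
  "lim_emb f D 0 x = prod_encode (0, x)"
| "lim_emb f D (Suc k) x = (if x \<in> f ` D then lim_emb f D k (inv_into D f x)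
    else prod_encode (Suc k, x))"

lemma lim_emb_level: "pfst (lim_emb f D k x) \<le> k"
  by (induction k arbitrary: x) (auto intro: le_SucI)

text \<open>An element that is new at stage \<open>Suc k\<close> has a code of level
  \<open>Suc k\<close>, above the levels of all codes from earlier stages; the old elements are
  separated by induction.\<close>

lemma lim_emb_inj: "inj_on f D \<Longrightarrow> inj_on (lim_emb f D k) D"
proof (induction k)
  case (Suc k)
  then have IH: "inj_on (lim_emb f D k) D" by simp
  have "Suc k \<noteq> pfst (lim_emb f D k y)" for y
    using lim_emb_level[of f D k y] by linarith
  then have new: "lim_emb f D k y \<noteq> prod_encode (Suc k, x)" for x y
    by (metis pfst_encode)
  show ?case
  proof (rule inj_onI)
    fix x y assume "x \<in> D" "y \<in> D" and eq: "lim_emb f D (Suc k) x = lim_emb f D (Suc k) y"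
    show "x = y"
    proof (cases "x \<in> f ` D"; cases "y \<in> f ` D")
      assume xy: "x \<in> f ` D" "y \<in> f ` D"
      then have "inv_into D f x = inv_into D f y"
        using eq inj_onD[OF IH] by (simp add: inv_into_into)
      then show ?thesis using xy by (metis f_inv_into_f)
    qed (use eq new new[symmetric] in auto)
  qed
qed (auto intro: inj_onI dest: injD[OF inj_prod_encode])

text \<open>The limit is the union of the images of the copies, and an operation is evaluated in any
  copy that contains all arguments. The last clause, that a finite tuple always comes from a single
  copy, carries the preservation arguments below.\<close>

lemma direct_limit:
  fixes A :: "nat struct"
  assumes A: "structure_of L A" and f: "hom L A A f" and inj: "inj_on f (dom A)"
  shows "\<exists>(B :: nat struct) e. structure_of L B \<and>
    (\<forall>k. hom L A B (e k) \<and> inj_on (e k) (dom A) \<and> (\<forall>x\<in>dom A. e (Suc k) (f x) = e k x)) \<and>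
    (\<forall>ys. set ys \<subseteq> dom B \<longrightarrow> (\<exists>k xs. set xs \<subseteq> dom A \<and> ys = map (e k) xs))"
proof -
  let ?e = "lim_emb f (dom A)"
  have e_inj: "inj_on (?e k) (dom A)" for k by (rule lim_emb_inj[OF inj])
  have e_f: "?e (Suc k) (f x) = ?e k x" if "x \<in> dom A" for k x
    using that inj by simp
  have fn: "(f ^^ n) x \<in> dom A" if "x \<in> dom A" for n x
    using hom_dom[OF hom_funpow[OF f] that] .
  have e_fn: "?e (k + n) ((f ^^ n) x) = ?e k x" if "x \<in> dom A" for k n x
    using that by (induction n) (use e_f fn in auto)
  have e_map: "map (?e (k + n)) (map (f ^^ n) xs) = map (?e k) xs" if "set xs \<subseteq> dom A" for k n xs
    using that e_fn by auto
  let ?D = "\<Union>k. ?e k ` dom A"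
  have cover: "\<exists>k xs. set xs \<subseteq> dom A \<and> ys = map (?e k) xs" if "set ys \<subseteq> ?D" for ys
    using that
  proof (induction ys)
    case (Cons y ys)
    then obtain k xs k' x where 1: "set xs \<subseteq> dom A" "ys = map (?e k) xs"
      and 2: "x \<in> dom A" "y = ?e k' x" by auto
    \<comment> \<open>The head comes from copy \<open>k'\<close> and the tail from copy
      \<open>k\<close>; both are pushed forward into copy \<open>k + k'\<close>.\<close>
    have "y # ys = map (?e (k + k')) ((f ^^ k) x # map (f ^^ k') xs)"
      using e_fn[OF 2(1), of k' k] e_map[OF 1(1), of k k'] 1(2) 2(2) by (simp add: add.commute)
    then show ?case using 1(1) 2(1) fn
      by (intro exI[of _ "k + k'"] exI[of _ "(f ^^ k) x # map (f ^^ k') xs"]) auto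
  qed simp
  \<comment> \<open>The copy and the preimages of the arguments are picked arbitrarily;
    \<open>indep\<close> shows that the result does not depend on this choice.\<close>
  define B where "B = \<lparr>dom = ?D, fn = \<lambda>i ys. let (k, xs) =
    (SOME (k, xs). set xs \<subseteq> dom A \<and> ys = map (?e k) xs) in ?e k (fn A i xs)\<rparr>"
  \<comment> \<open>The arguments move from copy \<open>k\<close> to copy \<open>k + n\<close> by
    \<open>f ^^ n\<close>, where injectivity of the embedding identifies them with
    \<open>xs'\<close>.\<close>
  have indep_le: "?e k (fn A i xs) = ?e (k + n) (fn A i xs')"
    if i: "i < length L" "length xs = L ! i" and xs: "set xs \<subseteq> dom A" "set xs' \<subseteq> dom A"
      and eq: "map (?e k) xs = map (?e (k + n)) xs'" for i k n xs xs'
  proof -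
    have "map (?e (k + n)) (map (f ^^ n) xs) = map (?e (k + n)) xs'"
      unfolding e_map[OF xs(1)] eq ..
    then have "map (f ^^ n) xs = xs'"
      by (rule map_inj_on) (rule inj_on_subset[OF e_inj], use xs fn in auto)
    moreover have t: "xs \<in> tuples A (L ! i)" using i xs by (simp add: tuples_def)
    moreover have "(f ^^ n) (fn A i xs) = fn A i (map (f ^^ n) xs)"
      using hom_funpow[OF f, of n] i t unfolding hom_def by blast
    moreover have "fn A i xs \<in> dom A" using A i t unfolding structure_of_def by blast
    ultimately show ?thesis using e_fn by metis
  qed
  have indep: "?e k (fn A i xs) = ?e k' (fn A i xs')"
    if i: "i < length L" "length xs = L ! i" and xs: "set xs \<subseteq> dom A" "set xs' \<subseteq> dom A"
      and eq: "map (?e k) xs = map (?e k') xs'" for i k k' xs xs'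
  proof (cases "k \<le> k'")
    case True
    then show ?thesis using indep_le[of i xs xs' k "k' - k"] that by simp
  next
    case False
    moreover have "length xs' = L ! i" using i eq by (metis length_map)
    ultimately show ?thesis using indep_le[of i xs' xs k' "k - k'"] that by simp
  qed
  have fn_B: "fn B i (map (?e k) xs) = ?e k (fn A i xs)"
    if i: "i < length L" "xs \<in> tuples A (L ! i)" for i k xs
  proof -
    let ?P = "\<lambda>(k', xs'). set xs' \<subseteq> dom A \<and> map (?e k) xs = map (?e k') xs'"
    obtain k' xs' where some: "(SOME p. ?P p) = (k', xs')" by fastforce
    have "?P (k, xs)" using i by (simp add: tuples_def)
    then have "?P (k', xs')" unfolding some[symmetric] by (rule someI)
    then have "?e k (fn A i xs) = ?e k' (fn A i xs')"
      using i by (intro indep) (auto simp: tuples_def)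
    then show ?thesis unfolding B_def using some by simp
  qed
  have hom: "hom L A B (?e k)" for k
    unfolding hom_def using fn_B by (auto simp: B_def)
  have "structure_of L B"
    unfolding structure_of_def
  proof (intro conjI allI impI ballI)
    show "dom B \<noteq> {}" using A unfolding structure_of_def B_def by auto
    fix i ys assume i: "i < length L" and ys: "ys \<in> tuples B (L ! i)"
    then obtain k xs where xs: "set xs \<subseteq> dom A" "ys = map (?e k) xs"
      using cover[of ys] by (auto simp: tuples_def B_def)
    then have t: "xs \<in> tuples A (L ! i)" using ys by (simp add: tuples_def)
    then have "fn A i xs \<in> dom A" using A i unfolding structure_of_def by blast
    then show "fn B i ys \<in> dom B" using fn_B[OF i t] xs hom_dom[OF hom] by simp
  qed
  moreover have "dom B = ?D" unfolding B_def by simp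
  ultimately show ?thesis using hom e_inj e_f cover
    by (intro exI[of _ B] exI[of _ ?e] conjI allI ballI impI) simp_all
qed

text \<open>If \<open>f\<close> is not surjective, then the limit is not finitely generated. But it satisfies
  \<open>\<pi>\<close> because \<open>\<Pi>\<^sub>2\<close> sentences are preserved by unions of chains, and it satisfies \<open>\<sigma>\<close>
  because the image of \<open>c\<close> in the limit satisfies \<open>\<theta>\<close>.\<close>

lemma surj_if_Pi_1_preserved:
  fixes A :: "nat struct"
  assumes A: "structure_of L A" and gen: "generates L A as"
    and \<sigma>: "computable_Sigma L 2 0 \<sigma>" and \<pi>: "computable_Pi L 2 0 \<pi>"
    and scott: "scott_sentence L A (Conj (cinsert \<sigma> (csingle \<pi>)))"
    and W: "\<And>m q. (m, q) \<in> W \<Longrightarrow> wf_qf L (length c + m) q"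
    and \<theta>: "\<And>(B :: nat struct) v. sat B \<theta> v \<longleftrightarrow>
      (\<forall>(m, q)\<in>W. \<forall>ys\<in>tuples B m. sat_qf B (v @ ys) q)"
    and \<theta>_\<sigma>: "\<And>(B :: nat struct) v. v \<in> tuples B (length c) \<Longrightarrow> sat B \<theta> v \<Longrightarrow> sat B \<sigma> []"
    and c: "set c \<subseteq> dom A"
    and f: "hom L A A f" "inj_on f (dom A)"
    and sat: "\<And>k. sat A \<theta> (map (f ^^ k) c)"
  shows "f ` dom A = dom A"
proof -
  obtain B :: "nat struct" and e where B: "structure_of L B"
    and e': "\<forall>k. hom L A B (e k) \<and> inj_on (e k) (dom A) \<and> (\<forall>x\<in>dom A. e (Suc k) (f x) = e k x)"
    and cover: "\<forall>ys. set ys \<subseteq> dom B \<longrightarrow> (\<exists>k xs. set xs \<subseteq> dom A \<and> ys = map (e k) xs)"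
    using direct_limit[OF A f] by (elim exE conjE)
  have e: "hom L A B (e k)" "inj_on (e k) (dom A)"
    and e_f: "x \<in> dom A \<Longrightarrow> e (Suc k) (f x) = e k x" for k x
    using e' by blast+
  have sat_iff: "sat C (Conj (cinsert \<sigma> (csingle \<pi>))) [] \<longleftrightarrow> sat C \<sigma> [] \<and> sat C \<pi> []"
    for C :: "nat struct"
    unfolding sat_Conj by (simp add: cinsert.rep_eq bot_cset.rep_eq)
  have "isomorphic L A A"
    unfolding isomorphic_def iso_def hom_def by (intro exI[of _ id]) auto
  then have "sat A \<sigma> []" "sat A \<pi> []"
    using scott A sat_iff unfolding scott_sentence_def by blast+
  have e_fn: "e k ((f ^^ k) x) = e 0 x" if "x \<in> dom A" for k x
    using that
  proof (induction k)
    case (Suc k)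
    have "(f ^^ k) x \<in> dom A" using hom_dom[OF hom_funpow[OF f(1)] Suc.prems] .
    then show ?case using e_f Suc by simp
  qed simp
  have "sat B \<theta> (map (e 0) c)"
    unfolding \<theta>
  proof safe
    fix m q ys assume mq: "(m, q) \<in> W" and ys: "ys \<in> tuples B m"
    obtain k xs where xs: "set xs \<subseteq> dom A" "ys = map (e k) xs"
      using cover ys unfolding tuples_def by blast
    \<comment> \<open>In copy \<open>k\<close> the image of \<open>c\<close> is represented by
      \<open>(f ^^ k) c\<close>. So a test of \<open>\<theta>\<close> against elements of copy
      \<open>k\<close> is one in \<open>A\<close> at that tuple, which is why all iterates occur in
      the assumption \<open>sat\<close>.\<close>
    have eq: "map (e 0) c @ ys = map (e k) (map (f ^^ k) c @ xs)"
      using e_fn c xs by auto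
    have "xs \<in> tuples A m" using ys xs unfolding tuples_def by simp
    then have "sat_qf A (map (f ^^ k) c @ xs) q" using sat[of k] mq unfolding \<theta> by blast
    moreover have "set (map (f ^^ k) c @ xs) \<subseteq> dom A"
      using xs c hom_dom[OF hom_funpow[OF f(1)]] by auto
    moreover have "wf_qf L (length (map (f ^^ k) c @ xs)) q"
      using W[OF mq] ys xs unfolding tuples_def by simp
    ultimately show "sat_qf B (map (e 0) c @ ys) q"
      unfolding eq using sat_qf_hom[OF A e] by blast
  qed
  moreover have "map (e 0) c \<in> tuples B (length c)"
    using c hom_dom[OF e(1)] by (auto simp: tuples_def)
  ultimately have "sat B \<sigma> []" using \<theta>_\<sigma> by blast
  moreover have "sat B \<pi> []"
  proof -
    obtain S where S: "\<forall>(m, \<chi>)\<in>S. \<exists>j\<le>1. \<exists>e. sigma_index L j m e \<chi>"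
      and "\<forall>B :: nat struct. sat B \<pi> [] \<longleftrightarrow> (\<forall>(m, \<chi>)\<in>S. \<forall>ys\<in>tuples B m. sat B \<chi> ys)"
      using computable_Pi_2_sat[OF \<pi>] by (elim exE conjE)
    note sat_\<pi> = this(2)[rule_format]
    show ?thesis
      unfolding sat_\<pi>
    proof safe
      fix m \<chi> ys assume mem: "(m, \<chi>) \<in> S" and ys: "ys \<in> tuples B m"
      obtain j d where j: "j \<le> 1" "sigma_index L j m d \<chi>" using S mem by blast
      obtain V where V: "\<forall>(m', q)\<in>V. wf_qf L (m + m') q"
        and "\<forall>(B :: nat struct) v. sat B \<chi> v \<longleftrightarrow>
          (\<exists>(m, q)\<in>V. \<exists>ys\<in>tuples B m. sat_qf B (v @ ys) q)"
        using sigma_index_le_1[OF j(2,1)] by (elim exE conjE)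
      note sat_\<chi> = this(2)[rule_format]
      obtain k xs where xs: "set xs \<subseteq> dom A" "ys = map (e k) xs"
        using cover ys unfolding tuples_def by blast
      then have t: "xs \<in> tuples A m" using ys unfolding tuples_def by simp
      then have "sat A \<chi> xs" using \<open>sat A \<pi> []\<close> mem unfolding sat_\<pi> by blast
      then obtain m' q zs where q: "(m', q) \<in> V" "zs \<in> tuples A m'" "sat_qf A (xs @ zs) q"
        unfolding sat_\<chi> by blast
      \<comment> \<open>Existential witnesses found in \<open>A\<close> remain witnesses under the
        embedding \<open>e k\<close>.\<close>
      have "sat_qf B (map (e k) (xs @ zs)) q"
        using sat_qf_hom[OF A e(1,2), of "xs @ zs" q k] q V t by (auto simp: tuples_def)
      then show "sat B \<chi> ys"
        unfolding sat_\<chi> using q(1) hom_tuples[OF e(1) q(2)] xs by fastforce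
    qed
  qed
  ultimately have "isomorphic L A B"
    using scott B sat_iff unfolding scott_sentence_def by blast
  then obtain h where h: "iso L A B h" unfolding isomorphic_def by blast
  \<comment> \<open>Finitely many generators of \<open>B\<close> come from a single copy
    \<open>k\<close>, so \<open>e k\<close> is onto. Comparing \<open>e (Suc k) x\<close> with
    \<open>e k y = e (Suc k) (f y)\<close> then yields \<open>x = f y\<close>.\<close>
  have "generates L B (map h as)"
    by (rule surj_generates[OF A B iso_hom[OF h] iso_image[OF h] gen])
  moreover then have "set (map h as) \<subseteq> dom B" unfolding generates_def by blast
  then obtain k xs where xs: "set xs \<subseteq> dom A" "map h as = map (e k) xs"
    using cover by blast
  ultimately have onto: "e k ` dom A = dom B"
    using hom_generates[OF A B e(1) xs(1)] by metis
  have "x \<in> f ` dom A" if x: "x \<in> dom A" for x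
  proof -
    have "e (Suc k) x \<in> dom B" using hom_dom[OF e(1) x] .
    then obtain y where y: "y \<in> dom A" "e (Suc k) x = e k y" using onto by fastforce
    then have "e (Suc k) x = e (Suc k) (f y)" using e_f by simp
    then have "x = f y" using inj_onD[OF e(2)] x hom_dom[OF f(1) y(1)] by blast
    then show ?thesis using y by blast
  qed
  then show ?thesis using f(1) unfolding hom_def by blast
qed

section \<open>Orbits\<close>

definition orbit :: "lang \<Rightarrow> 'a struct \<Rightarrow> 'a list \<Rightarrow> 'a list set" where
  "orbit L A v = {map h v |h. automorphism L A h}"

text \<open>\<open>A\<close> is presented by \<open>v\<close> and \<open>\<psi>\<close> relative to the class of its isomorphic copies,
  which is all that is left of the ambient class.\<close>

definition presented_by :: "lang \<Rightarrow> 'a struct \<Rightarrow> 'a list \<Rightarrow> (tm \<times> tm) list \<Rightarrow> bool" where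
  "presented_by L A v \<psi> \<longleftrightarrow> generates L A v \<and>
    (\<forall>(s, t)\<in>set \<psi>. wf_tm L (length v) s \<and> wf_tm L (length v) t \<and> val A v s = val A v t) \<and>
    (\<forall>w\<in>tuples A (length v). (\<forall>(s, t)\<in>set \<psi>. val A w s = val A w t) \<longrightarrow>
      (\<exists>h. hom L A A h \<and> map h v = w))"

text \<open>The universal property is applied to the copy \<open>A'\<close> of \<open>A\<close> in
  \<open>K\<close>, and the resulting map is brought back to \<open>A\<close> by the inverse
  isomorphism.\<close>

lemma finitely_presented_presented_by:
  fixes A :: "'a struct" and K :: "'b struct set"
  assumes "finitely_presented L K A" and K: "\<forall>B\<in>K. structure_of L B" and A: "structure_of L A"
  obtains v \<psi> where "presented_by L A v \<psi>"
proof -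
  obtain A' g n v \<psi> where A': "A' \<in> K" and g: "iso L A A' g"
    and v: "v \<in> tuples A n" "generates L A v"
    and wf: "\<forall>(s, t)\<in>set \<psi>. wf_tm L n s \<and> wf_tm L n t"
    and sat: "\<forall>(s, t)\<in>set \<psi>. val A v s = val A v t"
    and univ: "\<forall>B\<in>K. \<forall>bs\<in>tuples B n. (\<forall>(s, t)\<in>set \<psi>. val B bs s = val B bs t) \<longrightarrow>
      (\<exists>h. hom L A B h \<and> map h v = bs)"
    using assms(1) unfolding finitely_presented_def isomorphic_def by blast
  have n: "length v = n" using v by (simp add: tuples_def)
  let ?g' = "inv_into (dom A) g"
  have g': "hom L A' A ?g'" using iso_hom[OF iso_inv[OF A g]] .
  have "\<exists>h. hom L A A h \<and> map h v = w"
    if w: "w \<in> tuples A n" and eqs: "\<forall>(s, t)\<in>set \<psi>. val A w s = val A w t" for w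
  proof -
    have w': "set w \<subseteq> dom A" "length w = n" using w by (auto simp: tuples_def)
    have "\<forall>(s, t)\<in>set \<psi>. val A' (map g w) s = val A' (map g w) t"
    proof safe
      fix s t assume "(s, t) \<in> set \<psi>"
      then show "val A' (map g w) s = val A' (map g w) t"
        using wf eqs val_hom[OF A iso_hom[OF g] w'(1)] w'(2) by fastforce
    qed
    then obtain h where h: "hom L A A' h" "map h v = map g w"
      using univ A' hom_tuples[OF iso_hom[OF g] w] by blast
    have "map (?g' \<circ> h) v = map ?g' (map g w)" using h(2) by (metis map_map)
    also have "\<dots> = w" using w'(1) iso_inj[OF g] by (auto intro!: map_idI)
    finally show ?thesis using hom_comp[OF h(1) g'] by blast
  qed
  then have "presented_by L A v \<psi>"
    unfolding presented_by_def n using v(2) wf sat by (auto simp: case_prod_unfold)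
  then show thesis by (rule that)
qed

lemma surj_hom_orbit:
  assumes "hopfian L A" "hom L A A h" "h ` dom A = dom A"
  shows "map h v \<in> orbit L A v"
  using assms unfolding hopfian_def orbit_def by blast

lemma orbit_tuples: "set v \<subseteq> dom A \<Longrightarrow> w \<in> orbit L A v \<Longrightarrow> w \<in> tuples A (length v)"
  unfolding orbit_def tuples_def using hom_dom[OF iso_hom] by fastforce

lemma iso_comp: "iso L A B g \<Longrightarrow> iso L B C h \<Longrightarrow> iso L A C (h \<circ> g)"
  unfolding iso_def using hom_comp bij_betw_trans by blast

lemma iso_id: "iso L A A (\<lambda>x. x)"
  unfolding iso_def hom_def by (auto simp: bij_betw_def)

lemma orbitI: "automorphism L A h \<Longrightarrow> map h v \<in> orbit L A v"
  unfolding orbit_def by (intro CollectI exI[of _ h] conjI refl)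

lemma orbit_refl: "v \<in> orbit L A v"
  using orbitI[OF iso_id] by simp

lemma generates_if_subset:
  assumes A: "structure_of L A" and v: "generates L A v" and w: "set w \<subseteq> dom A"
    and vw: "set v \<subseteq> generated L A (set w)"
  shows "generates L A w"
proof -
  have "x \<in> generated L A (set w)" if "x \<in> generated L A (set v)" for x
    using that by induction (use vw in \<open>auto intro: generated.app\<close>)
  then show ?thesis
    using v w generated_subset[OF A w] unfolding generates_def by blast
qed

text \<open>The value of a term at \<open>v\<close> is sent to its value at \<open>w\<close>. One
  direction of \<open>eq_iff\<close> makes this well defined, the other makes it injective.\<close>

lemma embedding_if_same_equations:
  assumes A: "structure_of L A" and B: "structure_of L B" and gen: "generates L A v"
    and wd: "set w \<subseteq> dom B" and len: "length w = length v"
    and eq_iff: "\<And>t u. wf_tm L (length v) t \<Longrightarrow> wf_tm L (length v) u \<Longrightarrow>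
      val A v t = val A v u \<longleftrightarrow> val B w t = val B w u"
  obtains f where "hom L A B f" "inj_on f (dom A)" "map f v = w"
    "\<And>t. wf_tm L (length v) t \<Longrightarrow> f (val A v t) = val B w t"
proof -
  define f where "f x = val B w (SOME t. wf_tm L (length v) t \<and> val A v t = x)" for x
  have f_val: "f (val A v t) = val B w t" if t: "wf_tm L (length v) t" for t
  proof -
    have "wf_tm L (length v) (SOME u. wf_tm L (length v) u \<and> val A v u = val A v t) \<and>
      val A v (SOME u. wf_tm L (length v) u \<and> val A v u = val A v t) = val A v t"
      by (rule someI[of _ t]) (use t in blast)
    then show ?thesis unfolding f_def using eq_iff t by blast
  qed
  have tm: "\<exists>t. wf_tm L (length v) t \<and> val A v t = x" if "x \<in> dom A" for x
    using gen that generates_iff_val[OF A] by blast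
  have "hom L A B f"
    unfolding hom_def
  proof (intro conjI allI impI ballI)
    show "f ` dom A \<subseteq> dom B"
      using tm f_val val_in_dom[OF B wd] len by force
    fix i xs assume i: "i < length L" and xs: "xs \<in> tuples A (L ! i)"
    then have "set xs \<subseteq> dom A" by (simp add: tuples_def)
    then obtain ts where ts: "\<forall>t\<in>set ts. wf_tm L (length v) t" "map (val A v) ts = xs"
      using generates_vals[OF A gen] by blast
    have wf: "wf_tm L (length v) (App i ts)"
      using i xs ts by (auto simp: tuples_def list_all_iff)
    have "map f xs = map (val B w) ts" using ts f_val by auto
    then show "f (fn A i xs) = fn B i (map f xs)" using f_val[OF wf] ts(2) by simp
  qed
  moreover have "inj_on f (dom A)"
    using tm f_val eq_iff by (intro inj_onI) metis
  moreover have "map f v = w"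
  proof (rule nth_equalityI)
    fix i assume "i < length (map f v)"
    then show "map f v ! i = w ! i" using f_val[of "Var i"] by simp
  qed (simp add: len)
  ultimately show thesis using f_val by (rule that)
qed

lemma val_rel_tm_code:
  "val_rel L A 0 a (tm_code t) y \<longleftrightarrow> set (list_decode a) \<subseteq> dom A \<and>
    wf_tm L (length (list_decode a)) t \<and> y = val A (list_decode a) t"
  unfolding val_rel_def by (auto simp: tm_code_inject)

lemma vals_rel_tm_code:
  "vals_rel L A 0 a (list_encode (map tm_code ts)) y \<longleftrightarrow> set (list_decode a) \<subseteq> dom A \<and>
    (\<forall>t\<in>set ts. wf_tm L (length (list_decode a)) t) \<and>
    y = list_encode (map (val A (list_decode a)) ts)"
proof -
  have "inj tm_code" by (simp add: inj_def tm_code_inject)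
  then have "map tm_code ts = map tm_code ts' \<longleftrightarrow> ts = ts'" for ts'
    by (rule inj_map_eq_map)
  then show ?thesis unfolding vals_rel_def shift_tm_0 list_encode_eq by simp
qed

context
  fixes L :: lang and A :: "nat struct"
  assumes comp: "computable_structure L A"
begin

text \<open>The generating tuple \<open>v\<close> need not be the presenting tuple
  \<open>v0\<close>. Terms \<open>ts\<close> and \<open>ss\<close> that express each of them by the
  other translate the condition on \<open>w\<close> into one on \<open>u = ts(w)\<close>.\<close>

lemma ce_orbit:
  assumes hopf: "hopfian L A" and pres: "presented_by L A v0 \<psi>" and gen: "generates L A v"
  obtains P where "ce_pred P" "\<And>w. w \<in> orbit L A v \<longleftrightarrow> length w = length v \<and> P (list_encode w)"
proof -
  note A = structure_A[OF comp]
  have "generates L A v0" using pres unfolding presented_by_def by (elim conjE)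
  then have v0: "generates L A v0" "set v0 \<subseteq> dom A" and v: "set v \<subseteq> dom A"
    using gen by (simp_all add: generates_def)
  have \<psi>: "wf_tm L (length v0) (fst p) \<and> wf_tm L (length v0) (snd p) \<and>
      val A v0 (fst p) = val A v0 (snd p)" if "p \<in> set \<psi>" for p
    using pres that unfolding presented_by_def case_prod_unfold by (elim conjE) (erule bspec)
  have univ: "\<forall>w\<in>tuples A (length v0). (\<forall>(s, t)\<in>set \<psi>. val A w s = val A w t) \<longrightarrow>
      (\<exists>h. hom L A A h \<and> map h v0 = w)"
    using pres unfolding presented_by_def by (elim conjE)
  obtain ts where ts: "\<forall>t\<in>set ts. wf_tm L (length v) t" "map (val A v) ts = v0"
    using generates_vals[OF A gen v0(2)] .
  obtain ss where ss: "\<forall>t\<in>set ss. wf_tm L (length v0) t" "map (val A v0) ss = v"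
    using generates_vals[OF A v0(1) v] .
  have len: "length ts = length v0" "length ss = length v"
    using ts(2) ss(2) by (metis length_map)+
  \<comment> \<open>With \<open>c\<close> coding \<open>w\<close> and \<open>d\<close> coding
    \<open>u\<close>, the clauses say: \<open>u = ts(w)\<close>, \<open>w = ss(u)\<close>,
    \<open>u\<close> satisfies \<open>\<psi>\<close>, and every entry of \<open>v\<close> is
    generated by \<open>w\<close>.\<close>
  define P where "P c \<longleftrightarrow> (\<exists>d. vals_rel L A 0 c (list_encode (map tm_code ts)) d \<and>
    vals_rel L A 0 d (list_encode (map tm_code ss)) c \<and>
    (\<forall>p\<in>set \<psi>. \<exists>y. val_rel L A 0 d (tm_code (fst p)) y \<and> val_rel L A 0 d (tm_code (snd p)) y) \<and>
    (\<forall>x\<in>set v. \<exists>t. val_rel L A 0 c t x))" for c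
  have "ce_pred P"
    unfolding P_def
    by (intro ce_vals_rel[OF comp] ce_val_rel[OF comp] ce_pred_all_list ce_pred_ex ce_pred_conj)
      (rule computable_intros)+
  moreover have "w \<in> orbit L A v \<longleftrightarrow> length w = length v \<and> P (list_encode w)" for w
  proof
    assume w: "w \<in> orbit L A v"
    then obtain h where h: "automorphism L A h" "w = map h v" unfolding orbit_def by blast
    have wt: "set w \<subseteq> dom A" "length w = length v"
      using orbit_tuples[OF v w] by (auto simp: tuples_def)
    have d: "map h v0 = map (val A w) ts"
      using map_hom_vals[OF A iso_hom[OF h(1)] v ts(1)] ts(2) h(2) by simp
    have c: "w = map (val A (map h v0)) ss"
      using map_hom_vals[OF A iso_hom[OF h(1)] v0(2) ss(1)] ss(2) h(2) by simp
    have hv0: "set (map h v0) \<subseteq> dom A" using v0(2) hom_dom[OF iso_hom[OF h(1)]] by auto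
    have eqs: "val A (map h v0) (fst p) = val A (map h v0) (snd p)"
      "wf_tm L (length v0) (fst p)" "wf_tm L (length v0) (snd p)" if "p \<in> set \<psi>" for p
      using \<psi>[OF that] val_hom[OF A iso_hom[OF h(1)] v0(2)] by simp_all
    have "generates L A w"
      unfolding h(2) by (rule surj_generates[OF A A iso_hom[OF h(1)] iso_image[OF h(1)] gen])
    then have gen_w: "\<forall>x\<in>dom A. \<exists>t. wf_tm L (length w) t \<and> val A w t = x"
      using generates_iff_val[OF A] by blast
    have vals: "\<exists>t. val_rel L A 0 (list_encode w) t x" if x: "x \<in> set v" for x
    proof -
      obtain t where "wf_tm L (length w) t" "val A w t = x" using gen_w x v by blast
      then have "val_rel L A 0 (list_encode w) (tm_code t) x"
        unfolding val_rel_tm_code list_encode_inverse using wt(1) by simp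
      then show ?thesis by blast
    qed
    have "vals_rel L A 0 (list_encode w) (list_encode (map tm_code ts)) (list_encode (map h v0))"
      unfolding vals_rel_tm_code list_encode_inverse d using wt ts(1) by simp
    moreover have "vals_rel L A 0 (list_encode (map h v0)) (list_encode (map tm_code ss))
        (list_encode w)"
      unfolding vals_rel_tm_code list_encode_inverse c[symmetric] using hv0 ss(1) by simp
    moreover have "\<exists>y. val_rel L A 0 (list_encode (map h v0)) (tm_code (fst p)) y \<and>
        val_rel L A 0 (list_encode (map h v0)) (tm_code (snd p)) y" if "p \<in> set \<psi>" for p
      unfolding val_rel_tm_code list_encode_inverse using hv0 eqs[OF that] by simp
    ultimately have "P (list_encode w)"
      unfolding P_def using vals by blast
    then show "length w = length v \<and> P (list_encode w)" using wt by blast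
  next
    assume w: "length w = length v \<and> P (list_encode w)"
    then obtain d where d: "vals_rel L A 0 (list_encode w) (list_encode (map tm_code ts)) d"
      "vals_rel L A 0 d (list_encode (map tm_code ss)) (list_encode w)"
      "\<forall>p\<in>set \<psi>. \<exists>y. val_rel L A 0 d (tm_code (fst p)) y \<and> val_rel L A 0 d (tm_code (snd p)) y"
      "\<forall>x\<in>set v. \<exists>t. val_rel L A 0 (list_encode w) t x"
      unfolding P_def by blast
    define u where "u = list_decode d"
    have u12: "set w \<subseteq> dom A \<and> d = list_encode (map (val A w) ts)"
      using d(1) unfolding vals_rel_tm_code list_encode_inverse by blast
    then have "u = map (val A w) ts" unfolding u_def by (metis list_encode_inverse)
    moreover have "set u \<subseteq> dom A" "w = map (val A u) ss"
      using d(2) unfolding vals_rel_tm_code list_encode_eq u_def by blast+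
    ultimately have u: "set w \<subseteq> dom A" "u = map (val A w) ts" "set u \<subseteq> dom A"
      "w = map (val A u) ss"
      using u12 by blast+
    have eqs: "\<forall>(s, t)\<in>set \<psi>. val A u s = val A u t"
      using d(3) unfolding val_rel_tm_code u_def by auto
    have "u \<in> tuples A (length v0)"
      using u(3) arg_cong[OF u(2), of length] len(1) by (simp add: tuples_def)
    then obtain h where h: "hom L A A h" "map h v0 = u"
      using bspec[OF univ] eqs by blast
    \<comment> \<open>The endomorphism that sends \<open>v0\<close> to \<open>u\<close> sends
      \<open>v = ss(v0)\<close> to \<open>ss(u) = w\<close>.\<close>
    have hv: "map h v = w"
      using map_hom_vals[OF A h(1) v0(2) ss(1)] unfolding ss(2) h(2) u(4)[symmetric] .
    have "\<forall>x\<in>set v. \<exists>t. wf_tm L (length w) t \<and> val A w t = x"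
    proof
      fix x assume "x \<in> set v"
      then obtain t where "val_rel L A 0 (list_encode w) t x" using d(4) by blast
      then show "\<exists>t. wf_tm L (length w) t \<and> val A w t = x"
        unfolding val_rel_def list_encode_inverse by (elim conjE exE) (intro exI conjI, auto)
    qed
    then have "set v \<subseteq> generated L A (set w)"
      unfolding generated_iff_val subset_iff by blast
    then have "generates L A w" by (rule generates_if_subset[OF A gen u(1)])
    then have "h ` dom A = dom A" using hom_generates[OF A A h(1) v] hv by simp
    then show "w \<in> orbit L A v" using surj_hom_orbit[OF hopf h(1)] hv by blast
  qed
  ultimately show thesis by (rule that)
qed

end

section \<open>Concatenation and length of coded lists\<close>

definition append_rel :: "nat \<Rightarrow> nat \<Rightarrow> nat \<Rightarrow> bool" where
  "append_rel a b c \<longleftrightarrow> list_decode c = list_decode a @ list_decode b"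

lemma ce_pred_append_rel:
  "ce_pred (\<lambda>n. append_rel (pfst n) (pfst (psnd n)) (psnd (psnd n)))"
proof -
  define Ax where "Ax n \<longleftrightarrow> pfst n = 0 \<and> pfst (psnd n) = psnd (psnd n)" for n
  define R where "R n p q \<longleftrightarrow> pfst (psnd n) = pfst (psnd p) \<and>
    (\<exists>x. pfst n = Suc (prod_encode (x, pfst p)) \<and>
      psnd (psnd n) = Suc (prod_encode (x, psnd (psnd p))))" for n p q :: nat
  have ce: "ce_pred (ce_closure Ax R)"
    by (rule ce_pred_closure; unfold Ax_def R_def; intro ce_intros)
  have 1: "append_rel (pfst n) (pfst (psnd n)) (psnd (psnd n))" if "ce_closure Ax R n" for n
    using that by induction (auto simp: Ax_def R_def append_rel_def)
  have 2: "ce_closure Ax R (prod_encode (list_encode xs, prod_encode (b,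
      list_encode (xs @ list_decode b))))" for xs b
  proof (induction xs)
    case Nil
    show ?case by (auto intro!: ce_closure.ax simp: Ax_def)
  next
    case (Cons x xs)
    show ?case by (rule ce_closure.step[OF _ Cons Cons]) (simp add: R_def)
  qed
  have *: "append_rel a b c \<longleftrightarrow> ce_closure Ax R (prod_encode (a, prod_encode (b, c)))" for a b c
  proof
    assume "append_rel a b c"
    then have "c = list_encode (list_decode a @ list_decode b)"
      unfolding append_rel_def by (metis list_decode_inverse)
    then show "ce_closure Ax R (prod_encode (a, prod_encode (b, c)))"
      using 2[of "list_decode a" b] by simp
  qed (use 1[of "prod_encode (a, prod_encode (b, c))"] in simp)
  show ?thesis unfolding * by (intro ce_pred_subst[OF ce] ce_intros)
qed

lemmas ce_append_rel = ce_pred_subst3[of append_rel, OF ce_pred_append_rel]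

text \<open>The length is an argument here, since the number of quantified variables varies with the
  conjunct.\<close>

lemma ce_pred_length_eq: "ce_pred (\<lambda>n. length (list_decode (pfst n)) = psnd n)"
proof -
  define Ax where "Ax n \<longleftrightarrow> pfst n = 0 \<and> psnd n = 0" for n
  define R where "R n p q \<longleftrightarrow> psnd n = Suc (psnd p) \<and>
    (\<exists>x. pfst n = Suc (prod_encode (x, pfst p)))" for n p q :: nat
  have ce: "ce_pred (ce_closure Ax R)"
    by (rule ce_pred_closure; unfold Ax_def R_def; intro ce_intros)
  have 1: "length (list_decode (pfst n)) = psnd n" if "ce_closure Ax R n" for n
    using that by induction (auto simp: Ax_def R_def)
  have 2: "ce_closure Ax R (prod_encode (list_encode xs, length xs))" for xs
  proof (induction xs)
    case Nil
    show ?case by (auto intro!: ce_closure.ax simp: Ax_def)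
  next
    case (Cons x xs)
    show ?case by (rule ce_closure.step[OF _ Cons Cons]) (simp add: R_def)
  qed
  have *: "length (list_decode a) = m \<longleftrightarrow> ce_closure Ax R (prod_encode (a, m))" for a m
    using 1[of "prod_encode (a, m)"] 2[of "list_decode a"] by auto
  show ?thesis unfolding * by (intro ce_pred_subst[OF ce] ce_intros)
qed

lemmas ce_length_eq = ce_pred_subst2[OF ce_pred_length_eq]

section \<open>From a Scott sentence to the weak Whitehead problem\<close>

context
  fixes L :: lang and A :: "nat struct"
  assumes comp: "computable_structure L A"
begin

text \<open>The predicate \<open>Q\<close> lists three verifiable reasons why \<open>w\<close> is
  not in the orbit: an entry outside \<open>A\<close>, a pair of terms whose equality differs at
  \<open>v\<close> and \<open>w\<close>, or a failure of \<open>\<theta>\<close> at a tuple reached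
  from \<open>c\<close> by iterating the map from \<open>v\<close> to \<open>w\<close>.\<close>

lemma ce_orbit_complement:
  assumes gen: "generates L A v"
    and \<phi>: "computable_d_Sigma2 L 0 \<phi>" and scott: "scott_sentence L A \<phi>"
  obtains Q where "ce_pred Q"
    "\<And>w. length w = length v \<Longrightarrow> w \<notin> orbit L A v \<longleftrightarrow> Q (list_encode w)"
proof -
  note A = structure_A[OF comp]
  have v: "set v \<subseteq> dom A" using gen unfolding generates_def by blast
  obtain \<sigma> \<pi> where \<sigma>: "computable_Sigma L 2 0 \<sigma>" and \<pi>: "computable_Pi L 2 0 \<pi>"
    and \<phi>_eq: "\<phi> = Conj (cinsert \<sigma> (csingle \<pi>))"
    using \<phi> unfolding computable_d_Sigma2_def by blast
  obtain S where S: "\<forall>(m, \<theta>)\<in>S. \<exists>j\<le>1. \<exists>e. pi_index L j m e \<theta>"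
    and "\<forall>B :: nat struct. sat B \<sigma> [] \<longleftrightarrow> (\<exists>(m, \<theta>)\<in>S. \<exists>ys\<in>tuples B m. sat B \<theta> ys)"
    using computable_Sigma_2_sat[OF \<sigma>] by (elim exE conjE)
  note sat_\<sigma> = this(2)[rule_format]
  have "isomorphic L A A" unfolding isomorphic_def using iso_id by blast
  then have "sat A \<phi> []" using scott A unfolding scott_sentence_def by blast
  then have "sat A \<sigma> []" unfolding \<phi>_eq sat_Conj by (simp add: cinsert.rep_eq)
  \<comment> \<open>The disjunct and the tuple \<open>c\<close> are fixed nonuniformly; only the
    enumeration of the conjuncts of this one \<open>\<theta>\<close> enters the search.\<close>
  then obtain m0 \<theta> c where \<theta>_S: "(m0, \<theta>) \<in> S" and c: "c \<in> tuples A m0" and \<theta>_c: "sat A \<theta> c"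
    unfolding sat_\<sigma> by blast
  then obtain j d where j: "j \<le> 1" "pi_index L j m0 d \<theta>" using S by blast
  obtain W where W: "\<forall>(m, q)\<in>W. wf_qf L (m0 + m) q"
    and ceW: "ce_pred (\<lambda>c. \<exists>m q. c = prod_encode (m, qf_code q) \<and> (m, q) \<in> W)"
    and "\<forall>(B :: nat struct) v. sat B \<theta> v \<longleftrightarrow>
      (\<forall>(m, q)\<in>W. \<forall>ys\<in>tuples B m. sat_qf B (v @ ys) q)"
    using pi_index_le_1[OF j(2,1)] by (elim exE conjE)
  note sat_\<theta> = this(3)[rule_format]
  have c': "set c \<subseteq> dom A" "length c = m0" using c by (auto simp: tuples_def)
  \<comment> \<open>Transport of \<open>x\<close> along the map that sends \<open>a\<close> to
    \<open>b\<close>: the same terms yield \<open>x\<close> at \<open>a\<close> and \<open>y\<close>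
    at \<open>b\<close>.\<close>
  define move where "move a b x y \<longleftrightarrow> (\<exists>ts. vals_rel L A 0 a ts x \<and> vals_rel L A 0 b ts y)"
    for a b x y
  \<comment> \<open>The nodes code pairs \<open>(b, x)\<close>. For \<open>b\<close> coding
    \<open>w\<close>, the closure collects the tuples obtained from \<open>c\<close> by repeated
    transport from \<open>v\<close> to \<open>w\<close>.\<close>
  define Ax where "Ax n \<longleftrightarrow> psnd n = list_encode c" for n
  define R where "R n p q \<longleftrightarrow> pfst n = pfst p \<and>
    move (list_encode v) (pfst p) (psnd p) (psnd n)" for n p q :: nat
  have ceI: "ce_pred (ce_closure Ax R)"
    by (rule ce_pred_closure; unfold Ax_def R_def move_def; intro ce_vals_rel[OF comp] ce_intros)
  \<comment> \<open>A failure of \<open>\<theta>\<close> at \<open>x\<close> is witnessed by a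
    conjunct and a tuple \<open>y\<close> at which it evaluates to 0.\<close>
  define bad where "bad x \<longleftrightarrow> (\<exists>m q. (\<exists>m' q'. prod_encode (m, q) = prod_encode (m', qf_code q') \<and>
      (m', q') \<in> W) \<and> (\<exists>y z. length (list_decode y) = m \<and> set (list_decode y) \<subseteq> dom A \<and>
      append_rel x y z \<and> qf_rel L A 0 z q))" for x
  define Q where "Q b \<longleftrightarrow> (\<exists>i x. nth_rel b i x \<and> x \<notin> dom A) \<or>
    (\<exists>t u y z y' z'. val_rel L A 0 (list_encode v) t y \<and> val_rel L A 0 (list_encode v) u z \<and>
      val_rel L A 0 b t y' \<and> val_rel L A 0 b u z' \<and> (y = z \<and> y' \<noteq> z' \<or> y \<noteq> z \<and> y' = z')) \<or>
    (\<exists>x. ce_closure Ax R (prod_encode (b, x)) \<and> bad x)" for b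
  have ce_bad: "ce_pred bad"
    unfolding bad_def
    by (intro ce_pred_subst[OF ceW] ce_length_eq ce_subset_dom[OF comp] ce_append_rel
        ce_qf_rel[OF comp] ce_pred_ex ce_pred_conj) (rule computable_intros)+
  have "ce_pred Q"
    unfolding Q_def
    by (intro ce_nth_rel ce_val_rel[OF comp] ce_dom[OF comp] ce_pred_subst[OF ceI]
        ce_pred_subst[OF ce_bad] ce_intros)
  moreover have bad_iff: "bad x \<longleftrightarrow> \<not> sat A \<theta> (list_decode x)"
    if x: "list_decode x \<in> tuples A m0" for x
  proof
    assume "bad x"
    then obtain m q y where mq: "(m, q) \<in> W" and y: "list_decode y \<in> tuples A m"
      and q: "\<not> sat_qf A (list_decode x @ list_decode y) q"
      unfolding bad_def append_rel_def qf_rel_def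
      by (auto simp: tuples_def qf_code_inject split: if_splits)
    then show "\<not> sat A \<theta> (list_decode x)" unfolding sat_\<theta> by blast
  next
    assume "\<not> sat A \<theta> (list_decode x)"
    then obtain m q ys where mq: "(m, q) \<in> W" and y: "ys \<in> tuples A m"
      and q: "\<not> sat_qf A (list_decode x @ ys) q"
      unfolding sat_\<theta> by blast
    have "append_rel x (list_encode ys) (list_encode (list_decode x @ ys))"
      by (simp add: append_rel_def)
    moreover have "wf_qf L (m0 + m) q" using W mq by blast
    then have "qf_rel L A 0 (list_encode (list_decode x @ ys)) (qf_code q)"
      unfolding qf_rel_def using x y q by (auto simp: tuples_def)
    moreover have "length (list_decode (list_encode ys)) = m"
      "set (list_decode (list_encode ys)) \<subseteq> dom A" using y by (auto simp: tuples_def)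
    ultimately show "bad x" unfolding bad_def using mq by blast
  qed
  moreover have "w \<notin> orbit L A v \<longleftrightarrow> Q (list_encode w)" if len: "length w = length v" for w
  proof
    assume Q: "Q (list_encode w)"
    show "w \<notin> orbit L A v"
    proof
      assume w: "w \<in> orbit L A v"
      then obtain h where h: "automorphism L A h" "w = map h v" unfolding orbit_def by blast
      note hom = iso_hom[OF h(1)] and inj = iso_inj[OF h(1)]
      have wd: "set w \<subseteq> dom A" using orbit_tuples[OF v w] by (auto simp: tuples_def)
      have val: "val A w t = h (val A v t)" "val A v t \<in> dom A" if "wf_tm L (length v) t" for t
        using val_hom[OF A hom v that] val_in_dom[OF A v that] h(2) by auto
      have eq_iff: "y = z \<longleftrightarrow> y' = z'"
        if t: "val_rel L A 0 (list_encode v) t y" "val_rel L A 0 (list_encode w) t y'"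
          and u: "val_rel L A 0 (list_encode v) u z" "val_rel L A 0 (list_encode w) u z'"
        for t u y z y' z'
      proof -
        obtain t' where t': "t = tm_code t'" using t(1) unfolding val_rel_def by auto
        obtain u' where u': "u = tm_code u'" using u(1) unfolding val_rel_def by auto
        have "y \<in> dom A" "y' = h y" "z \<in> dom A" "z' = h z"
          using t u val unfolding t' u' val_rel_tm_code by auto
        then show ?thesis using inj by (auto dest: inj_onD)
      qed
      from Q show False
        unfolding Q_def
      proof (elim disjE exE conjE)
        fix i x assume "nth_rel (list_encode w) i x" "x \<notin> dom A"
        then show False using wd unfolding nth_rel_def by (auto dest: nth_mem)
      next
        fix t u y z y' z'
        assume "val_rel L A 0 (list_encode v) t y" "val_rel L A 0 (list_encode v) u z"
          "val_rel L A 0 (list_encode w) t y'" "val_rel L A 0 (list_encode w) u z'"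
          "y = z" "y' \<noteq> z'"
        then show False using eq_iff by blast
      next
        fix t u y z y' z'
        assume "val_rel L A 0 (list_encode v) t y" "val_rel L A 0 (list_encode v) u z"
          "val_rel L A 0 (list_encode w) t y'" "val_rel L A 0 (list_encode w) u z'"
          "y \<noteq> z" "y' = z'"
        then show False using eq_iff by blast
      next
        fix x assume I: "ce_closure Ax R (prod_encode (list_encode w, x))" and "bad x"
        \<comment> \<open>If \<open>w\<close> is in the orbit, then transport is application of
          \<open>h\<close>, so every tuple reached is an automorphic image of
          \<open>c\<close>.\<close>
        have "\<exists>g. automorphism L A g \<and> list_decode (psnd n) = map g c"
          if "ce_closure Ax R n" "pfst n = list_encode w" for n
          using that
        proof induction
          case (ax n)
          then show ?case using iso_id unfolding Ax_def by fastforce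
        next
          case (step n p q)
          then obtain g where g: "automorphism L A g" "list_decode (psnd p) = map g c"
            unfolding R_def by auto
          obtain ts where ts: "vals_rel L A 0 (list_encode v) ts (psnd p)"
            "vals_rel L A 0 (list_encode w) ts (psnd n)"
            using step unfolding R_def move_def by auto
          obtain ts' where ts': "ts = list_encode (map tm_code ts')"
            using ts(1) unfolding vals_rel_def by auto
          have "list_decode (psnd n) = map h (list_decode (psnd p))"
            using ts val unfolding ts' vals_rel_tm_code by auto
          then have "list_decode (psnd n) = map (h \<circ> g) c" using g by simp
          then show ?case using iso_comp[OF g(1) h(1)] by blast
        qed
        from this[OF I] obtain g where g: "automorphism L A g" "list_decode x = map g c"
          unfolding pfst_encode psnd_encode by blast
        \<comment> \<open>The universally quantified tuple is pulled back along \<open>g\<close>,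
          and the conjunct is applied at \<open>c\<close>.\<close>
        have "sat_qf A (map g c @ ys) q" if mq: "(m, q) \<in> W" and ys: "ys \<in> tuples A m" for m q ys
        proof -
          define r where "r = inv_into (dom A) g"
          have r: "r y \<in> dom A \<and> g (r y) = y" if "y \<in> set ys" for y
          proof -
            have "y \<in> g ` dom A"
              unfolding iso_image[OF g(1)] using ys that by (auto simp: tuples_def)
            then show ?thesis unfolding r_def by (simp add: inv_into_into f_inv_into_f)
          qed
          have xs: "map r ys \<in> tuples A m" using r ys by (auto simp: tuples_def)
          have eq: "map g c @ ys = map g (c @ map r ys)"
            using r by (simp add: map_idI)
          have wf: "wf_qf L (length (c @ map r ys)) q" "set (c @ map r ys) \<subseteq> dom A"
            using W mq c' xs by (auto simp: tuples_def)
          have "sat_qf A (c @ map r ys) q" using \<theta>_c mq xs unfolding sat_\<theta> by blast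
          then show ?thesis
            unfolding eq
            using sat_qf_hom[OF A iso_hom[OF g(1)] iso_inj[OF g(1)] wf(2,1)] by blast
        qed
        then have "sat A \<theta> (map g c)" unfolding sat_\<theta> by blast
        moreover have "list_decode x \<in> tuples A m0"
          using hom_tuples[OF iso_hom[OF g(1)] c] g(2) by simp
        ultimately show False using bad_iff \<open>bad x\<close> g(2) by auto
      qed
    qed
  next
    assume w: "w \<notin> orbit L A v"
    show "Q (list_encode w)"
    proof (rule ccontr)
      assume nQ: "\<not> Q (list_encode w)"
      have wd: "set w \<subseteq> dom A"
      proof
        fix x assume "x \<in> set w"
        then obtain i where "nth_rel (list_encode w) i x"
          unfolding nth_rel_def by (auto simp: in_set_conv_nth)
        then show "x \<in> dom A" using nQ unfolding Q_def by blast
      qed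
      have val_rel: "val_rel L A 0 (list_encode v) (tm_code t) (val A v t)"
        "val_rel L A 0 (list_encode w) (tm_code t) (val A w t)" if "wf_tm L (length v) t" for t
        using that v wd len by (simp_all add: val_rel_tm_code)
      have eq_iff: "val A v t = val A v u \<longleftrightarrow> val A w t = val A w u"
        if "wf_tm L (length v) t" "wf_tm L (length v) u" for t u
        using nQ val_rel[OF that(1)] val_rel[OF that(2)] unfolding Q_def by blast
      \<comment> \<open>The first two reasons being excluded, \<open>v\<close> is mapped to
        \<open>w\<close> by an embedding. The third one then ensures \<open>\<theta>\<close> along
        all iterates of this embedding.\<close>
      obtain f where hom: "hom L A A f" and inj: "inj_on f (dom A)" and fv: "map f v = w"
        and f_val: "\<And>t. wf_tm L (length v) t \<Longrightarrow> f (val A v t) = val A w t"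
        using embedding_if_same_equations[OF A A gen wd len eq_iff] by blast
      have fkc: "(map (f ^^ k) c) \<in> tuples A m0" for k
        using hom_tuples[OF hom_funpow[OF hom] c] .
      have "ce_closure Ax R (prod_encode (list_encode w, list_encode (map (f ^^ k) c)))" for k
      proof (induction k)
        case 0
        show ?case by (auto intro!: ce_closure.ax simp: Ax_def)
      next
        case (Suc k)
        have "set (map (f ^^ k) c) \<subseteq> dom A" using fkc[of k] by (simp add: tuples_def)
        then obtain ts where ts: "\<forall>t\<in>set ts. wf_tm L (length v) t"
          "map (val A v) ts = map (f ^^ k) c"
          using generates_vals[OF A gen] by blast
        have "map (f ^^ Suc k) c = map f (map (f ^^ k) c)" by simp
        also have "\<dots> = map (val A w) ts" unfolding ts(2)[symmetric] using ts(1) f_val by simp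
        finally have "move (list_encode v) (list_encode w) (list_encode (map (f ^^ k) c))
            (list_encode (map (f ^^ Suc k) c))"
          unfolding move_def using ts v wd len
          by (intro exI[of _ "list_encode (map tm_code ts)"]) (simp add: vals_rel_tm_code)
        then show ?case by (intro ce_closure.step[OF _ Suc Suc]) (simp add: R_def comp_def)
      qed
      then have "\<not> bad (list_encode (map (f ^^ k) c))" for k using nQ unfolding Q_def by blast
      then have sat: "sat A \<theta> (map (f ^^ k) c)" for k
        using bad_iff[of "list_encode (map (f ^^ k) c)"] fkc by simp
      have "f ` dom A = dom A"
      proof (rule surj_if_Pi_1_preserved[OF A gen \<sigma> \<pi> scott[unfolded \<phi>_eq] _ sat_\<theta> _ c'(1) hom inj sat])
        show "wf_qf L (length c + m) q" if "(m, q) \<in> W" for m q using W that c' by blast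
        show "sat B \<sigma> []" if "u \<in> tuples B (length c)" "sat B \<theta> u" for B :: "nat struct" and u
          unfolding sat_\<sigma> using \<theta>_S that c' by blast
      qed
      then have "automorphism L A f" using hom inj unfolding iso_def bij_betw_def by blast
      then show False using w fv unfolding orbit_def by blast
    qed
  qed
  ultimately show thesis using that by blast
qed

theorem decidable_weak_whitehead_if_Scott:
  assumes "hopfian L A" "presented_by L A v0 \<psi>"
    and "computable_d_Sigma2 L 0 \<phi>" "scott_sentence L A \<phi>"
  shows "decidable_weak_whitehead L A"
  unfolding decidable_weak_whitehead_def
proof (intro allI impI)
  fix v assume gen: "generates L A v"
  obtain P where P: "ce_pred P"
    "\<And>w. w \<in> orbit L A v \<longleftrightarrow> length w = length v \<and> P (list_encode w)"
    using ce_orbit[OF comp assms(1,2) gen] by blast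
  obtain Q where Q: "ce_pred Q"
    "\<And>w. length w = length v \<Longrightarrow> w \<notin> orbit L A v \<longleftrightarrow> Q (list_encode w)"
    using ce_orbit_complement[OF gen assms(3,4)] by blast
  have "computable_rel (length v) (orbit L A v)"
    by (rule computable_relI[OF P(1) Q(1)]) (use P(2) Q(2) in auto)
  then show "computable_rel (length v) {map h v |h. automorphism L A h}"
    unfolding orbit_def .
qed

end

section \<open>From the weak Whitehead problem to a Scott sentence\<close>

lemma tuples_iso:
  assumes "iso L A B h"
  shows "tuples B m = map h ` tuples A m"
proof
  show "tuples B m \<subseteq> map h ` tuples A m"
  proof
    fix ys assume ys: "ys \<in> tuples B m"
    let ?xs = "map (inv_into (dom A) h) ys"
    have "y \<in> h ` dom A" if "y \<in> set ys" for y
      unfolding iso_image[OF assms] using ys that by (auto simp: tuples_def)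
    then have "map h ?xs = ys" "?xs \<in> tuples A m"
      using ys by (auto simp: tuples_def f_inv_into_f inv_into_into intro!: map_idI)
    then show "ys \<in> map h ` tuples A m" by (metis imageI)
  qed
  show "map h ` tuples A m \<subseteq> tuples B m"
    using hom_tuples[OF iso_hom[OF assms]] by blast
qed

lemma sat_iso:
  assumes A: "structure_of L A" and h: "iso L A B h"
  shows "set v \<subseteq> dom A \<Longrightarrow> wf_form L \<phi> (length v) \<Longrightarrow> sat B \<phi> (map h v) \<longleftrightarrow> sat A \<phi> v"
proof (induction \<phi> arbitrary: v)
  case (QF q)
  then show ?case using sat_qf_hom[OF A iso_hom[OF h] iso_inj[OF h]] by simp
next
  case (Disj F)
  then show ?case unfolding sat_Disj wf_form_Disj by blast
next
  case (Conj F)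
  then show ?case unfolding sat_Conj wf_form_Conj by blast
next
  case (Ex m \<phi>)
  have "sat B \<phi> (map h v @ map h xs) \<longleftrightarrow> sat A \<phi> (v @ xs)" if "xs \<in> tuples A m" for xs
    using Ex.IH[of "v @ xs"] Ex.prems that by (simp add: tuples_def)
  then show ?case using tuples_iso[OF h, of m] by simp
next
  case (All m \<phi>)
  have "sat B \<phi> (map h v @ map h xs) \<longleftrightarrow> sat A \<phi> (v @ xs)" if "xs \<in> tuples A m" for xs
    using All.IH[of "v @ xs"] All.prems that by (simp add: tuples_def)
  then show ?case using tuples_iso[OF h, of m] by simp
qed simp

section \<open>Formulas with prescribed enumerable sets of conjuncts or disjuncts\<close>

lemma countable_qf_pairs: "countable (W :: (nat \<times> qf) set)"
proof (rule countableI)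
  show "inj_on (\<lambda>(m, q). prod_encode (m, qf_code q)) W"
    by (auto intro!: inj_onI simp: qf_code_inject)
qed

text \<open>Converse of \<open>pi_index_le_1\<close>: a program with domain \<open>W\<close>, each
  pair tagged by level 0, is an index of the conjunction over \<open>W\<close>.\<close>

lemma pi_index_1_ex:
  assumes W: "\<forall>(m, q)\<in>W. wf_qf L (k + m) q"
    and ce: "ce_pred (\<lambda>c. \<exists>m q. c = prod_encode (m, qf_code q) \<and> (m, q) \<in> W)"
  shows "\<exists>e \<theta>. pi_index L (Suc 0) k e \<theta> \<and> wf_form L \<theta> k \<and> (\<forall>(B :: nat struct) v. sat B \<theta> v \<longleftrightarrow>
    (\<forall>(m, q)\<in>W. \<forall>ys\<in>tuples B m. sat_qf B (v @ ys) q))"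
proof -
  have "ce_pred (\<lambda>c. pfst c = 0 \<and> (\<exists>m q. psnd c = prod_encode (m, qf_code q) \<and> (m, q) \<in> W))"
    by (intro ce_pred_conj ce_pred_eq ce_pred_subst[OF ce] computable_intros)
  then obtain f where "ce_set f = {c. pfst c = 0 \<and>
      (\<exists>m q. psnd c = prod_encode (m, qf_code q) \<and> (m, q) \<in> W)}"
    using ce_pred_imp_ce_set by blast
  then have f: "c \<in> ce_set f \<longleftrightarrow>
      (\<exists>m q. c = prod_encode (0, prod_encode (m, qf_code q)) \<and> (m, q) \<in> W)" for c
    by (auto, metis prod_encode_pfst_psnd)
  define F where "F = acset ((\<lambda>(m, q). All m (QF q)) ` W)"
  have F: "rcset F = (\<lambda>(m, q). All m (QF q)) ` W"
    unfolding F_def by (simp add: countable_qf_pairs)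
  have "pi_index L (Suc 0) k (recf_code f) (Conj F)"
    unfolding pi_index_1
  proof (intro exI[of _ f] exI[of _ F] conjI ballI allI refl)
    fix c assume "c \<in> ce_set f"
    then show "\<exists>m q. c = prod_encode (0, prod_encode (m, qf_code q)) \<and> wf_qf L (k + m) q"
      using W unfolding f by blast
  next
    fix \<chi>
    have "prod_encode (0, prod_encode (m, qf_code q)) \<in> ce_set f \<longleftrightarrow> (m, q) \<in> W" for m q
      unfolding f by (simp add: qf_code_inject)
    moreover have "\<chi> \<in> rcset F \<longleftrightarrow> (\<exists>m q. \<chi> = All m (QF q) \<and> (m, q) \<in> W)"
      unfolding F by force
    ultimately show "\<chi> \<in> rcset F \<longleftrightarrow> (\<exists>m q. \<chi> = All m (QF q) \<and>
        prod_encode (0, prod_encode (m, qf_code q)) \<in> ce_set f \<and> wf_qf L (k + m) q)"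
      using W by blast
  qed
  moreover have "wf_form L (Conj F) k"
    unfolding wf_form_Conj F using W by auto
  moreover have "sat B (Conj F) v \<longleftrightarrow> (\<forall>(m, q)\<in>W. \<forall>ys\<in>tuples B m. sat_qf B (v @ ys) q)"
    for B :: "nat struct" and v
    unfolding sat_Conj F by (simp add: case_prod_unfold)
  ultimately show ?thesis by blast
qed

lemma sigma_index_1_ex:
  assumes W: "\<forall>(m, q)\<in>W. wf_qf L (k + m) q"
    and ce: "ce_pred (\<lambda>c. \<exists>m q. c = prod_encode (m, qf_code q) \<and> (m, q) \<in> W)"
  shows "\<exists>e \<theta>. sigma_index L (Suc 0) k e \<theta> \<and> wf_form L \<theta> k \<and> (\<forall>(B :: nat struct) v. sat B \<theta> v \<longleftrightarrow>
    (\<exists>(m, q)\<in>W. \<exists>ys\<in>tuples B m. sat_qf B (v @ ys) q))"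
proof -
  have "ce_pred (\<lambda>c. pfst c = 0 \<and> (\<exists>m q. psnd c = prod_encode (m, qf_code q) \<and> (m, q) \<in> W))"
    by (intro ce_pred_conj ce_pred_eq ce_pred_subst[OF ce] computable_intros)
  then obtain f where "ce_set f = {c. pfst c = 0 \<and>
      (\<exists>m q. psnd c = prod_encode (m, qf_code q) \<and> (m, q) \<in> W)}"
    using ce_pred_imp_ce_set by blast
  then have f: "c \<in> ce_set f \<longleftrightarrow>
      (\<exists>m q. c = prod_encode (0, prod_encode (m, qf_code q)) \<and> (m, q) \<in> W)" for c
    by (auto, metis prod_encode_pfst_psnd)
  define F where "F = acset ((\<lambda>(m, q). Ex m (QF q)) ` W)"
  have F: "rcset F = (\<lambda>(m, q). Ex m (QF q)) ` W"
    unfolding F_def by (simp add: countable_qf_pairs)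
  have "sigma_index L (Suc 0) k (recf_code f) (Disj F)"
    unfolding sigma_index_1
  proof (intro exI[of _ f] exI[of _ F] conjI ballI allI refl)
    fix c assume "c \<in> ce_set f"
    then show "\<exists>m q. c = prod_encode (0, prod_encode (m, qf_code q)) \<and> wf_qf L (k + m) q"
      using W unfolding f by blast
  next
    fix \<chi>
    have "prod_encode (0, prod_encode (m, qf_code q)) \<in> ce_set f \<longleftrightarrow> (m, q) \<in> W" for m q
      unfolding f by (simp add: qf_code_inject)
    moreover have "\<chi> \<in> rcset F \<longleftrightarrow> (\<exists>m q. \<chi> = Ex m (QF q) \<and> (m, q) \<in> W)"
      unfolding F by force
    ultimately show "\<chi> \<in> rcset F \<longleftrightarrow> (\<exists>m q. \<chi> = Ex m (QF q) \<and>
        prod_encode (0, prod_encode (m, qf_code q)) \<in> ce_set f \<and> wf_qf L (k + m) q)"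
      using W by blast
  qed
  moreover have "wf_form L (Disj F) k"
    unfolding wf_form_Disj F using W by auto
  moreover have "sat B (Disj F) v \<longleftrightarrow> (\<exists>(m, q)\<in>W. \<exists>ys\<in>tuples B m. sat_qf B (v @ ys) q)"
    for B :: "nat struct" and v
    unfolding sat_Disj F by (simp add: case_prod_unfold)
  ultimately show ?thesis by blast
qed

lemma ce_set_singleton: "\<exists>f. ce_set f = {c}"
  using ce_pred_imp_ce_set[OF ce_pred_eq[OF computable_fun_id computable_fun_const[of c]]]
  by simp

lemma rcset_csingle: "rcset (csingle x) = {x}"
  by (simp add: cinsert.rep_eq bot_cset.rep_eq)

text \<open>The code determines the program and the program determines the set of conjuncts. Hence a
  program that halts on a single code describes exactly one disjunct in
  \<open>computable_Sigma_2_Ex\<close>.\<close>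

lemma pi_index_1_unique:
  assumes "pi_index L (Suc 0) k e \<phi>" "pi_index L (Suc 0) k e \<phi>'"
  shows "\<phi> = \<phi>'"
proof -
  obtain f F f' F' where 1: "e = recf_code f" "\<phi> = Conj F"
      "\<forall>\<chi>. \<chi> \<in> rcset F \<longleftrightarrow> (\<exists>m q. \<chi> = All m (QF q) \<and>
        prod_encode (0, prod_encode (m, qf_code q)) \<in> ce_set f \<and> wf_qf L (k + m) q)"
    and 2: "e = recf_code f'" "\<phi>' = Conj F'"
      "\<forall>\<chi>. \<chi> \<in> rcset F' \<longleftrightarrow> (\<exists>m q. \<chi> = All m (QF q) \<and>
        prod_encode (0, prod_encode (m, qf_code q)) \<in> ce_set f' \<and> wf_qf L (k + m) q)"
    using assms unfolding pi_index_1 by (elim exE conjE) (rule that)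
  have "f = f'" using 1(1) 2(1) recf_code_inject by simp
  then have "rcset F = rcset F'" using 1(3) 2(3) by (intro set_eqI) simp
  then show ?thesis using 1(2) 2(2) by (simp add: rcset_inject)
qed

lemma sigma_index_1_unique:
  assumes "sigma_index L (Suc 0) k e \<phi>" "sigma_index L (Suc 0) k e \<phi>'"
  shows "\<phi> = \<phi>'"
proof -
  obtain f F f' F' where 1: "e = recf_code f" "\<phi> = Disj F"
      "\<forall>\<chi>. \<chi> \<in> rcset F \<longleftrightarrow> (\<exists>m q. \<chi> = Ex m (QF q) \<and>
        prod_encode (0, prod_encode (m, qf_code q)) \<in> ce_set f \<and> wf_qf L (k + m) q)"
    and 2: "e = recf_code f'" "\<phi>' = Disj F'"
      "\<forall>\<chi>. \<chi> \<in> rcset F' \<longleftrightarrow> (\<exists>m q. \<chi> = Ex m (QF q) \<and>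
        prod_encode (0, prod_encode (m, qf_code q)) \<in> ce_set f' \<and> wf_qf L (k + m) q)"
    using assms unfolding sigma_index_1 by (elim exE conjE) (rule that)
  have "f = f'" using 1(1) 2(1) recf_code_inject by simp
  then have "rcset F = rcset F'" using 1(3) 2(3) by (intro set_eqI) simp
  then show ?thesis using 1(2) 2(2) by (simp add: rcset_inject)
qed

lemma computable_Sigma_2_Ex:
  assumes "pi_index L (Suc 0) m e \<theta>"
  shows "computable_Sigma L 2 0 (Disj (csingle (Ex m \<theta>)))"
proof -
  obtain f where f: "ce_set f = {prod_encode (Suc 0, prod_encode (m, e))}"
    using ce_set_singleton by blast
  have "sigma_index L (Suc (Suc 0)) 0 (recf_code f) (Disj (csingle (Ex m \<theta>)))"
    unfolding sigma_index.simps(2)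
  proof (intro exI[of _ f] exI[of _ "csingle (Ex m \<theta>)"] conjI ballI allI refl)
    fix c assume "c \<in> ce_set f"
    then show "\<exists>j\<in>{..Suc 0}. \<exists>m d \<theta>. c = prod_encode (j, prod_encode (m, d)) \<and>
        pi_index L j (0 + m) d \<theta>"
      unfolding f using assms by (intro bexI[of _ "Suc 0"]) auto
  next
    fix \<chi>
    show "\<chi> \<in> rcset (csingle (Ex m \<theta>)) \<longleftrightarrow> (\<exists>j\<in>{..Suc 0}. \<exists>m d \<theta>. \<chi> = Ex m \<theta> \<and>
        prod_encode (j, prod_encode (m, d)) \<in> ce_set f \<and> pi_index L j (0 + m) d \<theta>)"
      unfolding f rcset_csingle
    proof
      assume "\<chi> \<in> {Ex m \<theta>}"
      then show "\<exists>j\<in>{..Suc 0}. \<exists>m' d \<theta>'. \<chi> = Ex m' \<theta>' \<and> prod_encode (j, prod_encode (m', d)) \<in>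
          {prod_encode (Suc 0, prod_encode (m, e))} \<and> pi_index L j (0 + m') d \<theta>'"
        using assms by (intro bexI[of _ "Suc 0"]) auto
    next
      assume "\<exists>j\<in>{..Suc 0}. \<exists>m' d \<theta>'. \<chi> = Ex m' \<theta>' \<and> prod_encode (j, prod_encode (m', d)) \<in>
          {prod_encode (Suc 0, prod_encode (m, e))} \<and> pi_index L j (0 + m') d \<theta>'"
      then obtain \<theta>' where "\<chi> = Ex m \<theta>'" "pi_index L (Suc 0) m e \<theta>'"
        by (auto simp del: pi_index.simps)
      then show "\<chi> \<in> {Ex m \<theta>}" using pi_index_1_unique[OF assms] by blast
    qed
  qed
  then show ?thesis unfolding computable_Sigma_def numeral_2_eq_2 by blast
qed

lemma computable_Pi_2_All:
  assumes "sigma_index L (Suc 0) m e \<theta>"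
  shows "computable_Pi L 2 0 (Conj (csingle (All m \<theta>)))"
proof -
  obtain f where f: "ce_set f = {prod_encode (Suc 0, prod_encode (m, e))}"
    using ce_set_singleton by blast
  have "pi_index L (Suc (Suc 0)) 0 (recf_code f) (Conj (csingle (All m \<theta>)))"
    unfolding pi_index.simps(2)
  proof (intro exI[of _ f] exI[of _ "csingle (All m \<theta>)"] conjI ballI allI refl)
    fix c assume "c \<in> ce_set f"
    then show "\<exists>j\<in>{..Suc 0}. \<exists>m d \<theta>. c = prod_encode (j, prod_encode (m, d)) \<and>
        sigma_index L j (0 + m) d \<theta>"
      unfolding f using assms by (intro bexI[of _ "Suc 0"]) auto
  next
    fix \<chi>
    show "\<chi> \<in> rcset (csingle (All m \<theta>)) \<longleftrightarrow> (\<exists>j\<in>{..Suc 0}. \<exists>m d \<theta>. \<chi> = All m \<theta> \<and>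
        prod_encode (j, prod_encode (m, d)) \<in> ce_set f \<and> sigma_index L j (0 + m) d \<theta>)"
      unfolding f rcset_csingle
    proof
      assume "\<chi> \<in> {All m \<theta>}"
      then show "\<exists>j\<in>{..Suc 0}. \<exists>m' d \<theta>'. \<chi> = All m' \<theta>' \<and> prod_encode (j, prod_encode (m', d)) \<in>
          {prod_encode (Suc 0, prod_encode (m, e))} \<and> sigma_index L j (0 + m') d \<theta>'"
        using assms by (intro bexI[of _ "Suc 0"]) auto
    next
      assume "\<exists>j\<in>{..Suc 0}. \<exists>m' d \<theta>'. \<chi> = All m' \<theta>' \<and> prod_encode (j, prod_encode (m', d)) \<in>
          {prod_encode (Suc 0, prod_encode (m, e))} \<and> sigma_index L j (0 + m') d \<theta>'"
      then obtain \<theta>' where "\<chi> = All m \<theta>'" "sigma_index L (Suc 0) m e \<theta>'"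
        by (auto simp del: sigma_index.simps)
      then show "\<chi> \<in> {All m \<theta>}" using sigma_index_1_unique[OF assms] by blast
    qed
  qed
  then show ?thesis unfolding computable_Pi_def numeral_2_eq_2 by blast
qed

text \<open>There is no constant for truth among the quantifier-free formulas, so a formula
  \<open>q\<close> takes the place of the empty conjunction.\<close>

primrec conj_eqs :: "qf \<Rightarrow> (tm \<times> tm) list \<Rightarrow> qf" where
  "conj_eqs q [] = q"
| "conj_eqs q (p # ps) = And (Eq (fst p) (snd p)) (conj_eqs q ps)"

lemma sat_conj_eqs:
  "sat_qf A v (conj_eqs q ps) \<longleftrightarrow> sat_qf A v q \<and> (\<forall>p\<in>set ps. val A v (fst p) = val A v (snd p))"
  by (induction ps) auto

lemma wf_conj_eqs:
  "wf_qf L k (conj_eqs q ps) \<longleftrightarrow>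
    wf_qf L k q \<and> (\<forall>p\<in>set ps. wf_tm L k (fst p) \<and> wf_tm L k (snd p))"
  by (induction ps) auto

text \<open>Computes the code of a conjunction from the code \<open>c\<close> of the list of
  right-hand sides, the left-hand sides being fixed. Here \<open>c - 1\<close> undoes the successor
  in \<open>list_encode\<close>; the result is meaningful when both lists have the same
  length.\<close>

primrec conj_eqs_code :: "nat \<Rightarrow> tm list \<Rightarrow> nat \<Rightarrow> nat" where
  "conj_eqs_code b [] c = b"
| "conj_eqs_code b (l # ls) c = prod_encode (2, prod_encode (
    prod_encode (0, prod_encode (tm_code l, pfst (c - 1))), conj_eqs_code b ls (psnd (c - 1))))"

lemma conj_eqs_code:
  "length ts = length ls \<Longrightarrow> conj_eqs_code (qf_code q) ls (list_encode (map tm_code ts)) =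
    qf_code (conj_eqs q (zip ls ts))"
  by (induction ts ls rule: list_induct2) auto

lemma computable_conj_eqs_code: "computable_fun (conj_eqs_code b ls)"
proof (induction ls)
  case (Cons l ls)
  show ?case
    unfolding conj_eqs_code.simps by (intro computable_fun_compose[OF Cons] computable_intros)
qed (simp add: computable_fun_const)

lemma wf_tm_mono: "wf_tm L k t \<Longrightarrow> k \<le> l \<Longrightarrow> wf_tm L l t"
  by (induction t) (auto simp: list_all_iff)

lemma val_append: "wf_tm L (length v) t \<Longrightarrow> val A (v @ w) t = val A v t"
proof (induction t)
  case (App i ts)
  then have "map (val A (v @ w)) ts = map (val A v) ts"
    by (simp add: list_all_iff)
  then show ?case by (simp only: val.simps)
qed (simp add: nth_append)

section \<open>The formulas of the Scott sentence\<close>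

context
  fixes L :: lang and A :: "nat struct" and v :: "nat list" and \<psi> :: "(tm \<times> tm) list"
  assumes comp: "computable_structure L A"
    and hopf: "hopfian L A"
    and pres: "presented_by L A v \<psi>"
    and dec: "computable_rel (length v) (orbit L A v)"
begin

private abbreviation "n \<equiv> length v"

text \<open>The formulas below have the variables \<open>y = (0, \<dots>, n - 1)\<close>, \<open>z = n\<close> and
  \<open>x = (n + 1, \<dots>, 2 n)\<close>. The tuple \<open>y\<close> satisfies some \<open>\<exists>x\<close> \<open>q\<close> with \<open>q\<close> in \<open>diag_neg\<close> if
  it does not have the same equations as \<open>v\<close>. In \<open>A\<close>, it satisfies some
  \<open>\<exists>x\<close> \<open>q\<close> with \<open>q\<close> in \<open>orbit_neg\<close> if and only if it is not in the orbit of \<open>v\<close>.\<close>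

private definition diag_neg :: "(nat \<times> qf) set" where
  "diag_neg = {(0, if val A v s = val A v t then Neg (Eq s t) else Eq s t) |s t.
    wf_tm L n s \<and> wf_tm L n t}"

text \<open>This is \<open>\<psi>\<close> for the block \<open>x\<close>; the trivial equation
  \<open>z = z\<close> stands for the empty conjunction.\<close>

private definition shifted_\<psi> :: qf where
  "shifted_\<psi> = conj_eqs (Eq (Var n) (Var n))
    (map (map_prod (shift_tm (Suc n)) (shift_tm (Suc n))) \<psi>)"

private definition orbit_eqs :: "tm list \<Rightarrow> qf" where
  "orbit_eqs ts = conj_eqs shifted_\<psi> (zip (map Var [0..<n]) (map (shift_tm (Suc n)) ts))"

private definition orbit_neg :: "(nat \<times> qf) set" where
  "orbit_neg = {(n, orbit_eqs ts) |ts. length ts = n \<and> (\<forall>t\<in>set ts. wf_tm L n t) \<and>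
    map (val A v) ts \<notin> orbit L A v}"

text \<open>Taken together as a disjunction, these say that \<open>y\<close> generates
  \<open>z\<close>.\<close>

private definition gen_eqs :: "(nat \<times> qf) set" where
  "gen_eqs = {(0, Eq (Var n) t) |t. wf_tm L n t}"

private lemma basics:
  shows A: "structure_of L A" and gen: "generates L A v" and v_dom: "set v \<subseteq> dom A"
proof -
  show "structure_of L A" by (rule structure_A[OF comp])
  show "generates L A v" using pres unfolding presented_by_def by (elim conjE)
  then show "set v \<subseteq> dom A" unfolding generates_def by blast
qed

private lemma \<psi>_wf: "p \<in> set \<psi> \<Longrightarrow> wf_tm L n (fst p) \<and> wf_tm L n (snd p)"
  and \<psi>_val: "p \<in> set \<psi> \<Longrightarrow> val A v (fst p) = val A v (snd p)"
  using pres unfolding presented_by_def case_prod_unfold by blast+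

private lemma \<psi>_hom:
  assumes "w \<in> tuples A n" "\<And>p. p \<in> set \<psi> \<Longrightarrow> val A w (fst p) = val A w (snd p)"
  obtains h where "hom L A A h" "map h v = w"
  using pres assms unfolding presented_by_def case_prod_unfold by blast

text \<open>The successor accounts for the variable \<open>z\<close> between \<open>y\<close> and
  the \<open>m\<close> quantified variables.\<close>

private lemma wf_sets:
  "(m, q) \<in> diag_neg \<union> orbit_neg \<union> gen_eqs \<Longrightarrow> wf_qf L (n + Suc m) q"
proof -
  have \<psi>: "wf_tm L (Suc n + n) (shift_tm (Suc n) (fst p)) \<and>
      wf_tm L (Suc n + n) (shift_tm (Suc n) (snd p))" if "p \<in> set \<psi>" for p
    using wf_shift_tm \<psi>_wf[OF that] by blast
  have "wf_qf L (Suc n + n) (orbit_eqs ts)" if ts: "\<forall>t\<in>set ts. wf_tm L n t" for ts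
  proof -
    have "wf_tm L (Suc n + n) (fst p) \<and> wf_tm L (Suc n + n) (snd p)"
      if "p \<in> set (zip (map Var [0..<n]) (map (shift_tm (Suc n)) ts))" for p
    proof -
      have p: "(fst p, snd p) \<in> set (zip (map Var [0..<n]) (map (shift_tm (Suc n)) ts))"
        using that by simp
      have "fst p \<in> set (map Var [0..<n])" "snd p \<in> set (map (shift_tm (Suc n)) ts)"
        using set_zip_leftD[OF p] set_zip_rightD[OF p] .
      then show ?thesis using ts wf_shift_tm[of L n _ "Suc n"] by auto
    qed
    then show ?thesis
      unfolding orbit_eqs_def shifted_\<psi>_def wf_conj_eqs using \<psi> by auto
  qed
  moreover assume "(m, q) \<in> diag_neg \<union> orbit_neg \<union> gen_eqs"
  moreover have "wf_tm L n t \<Longrightarrow> wf_tm L (Suc n) t" for t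
    by (erule wf_tm_mono) simp
  ultimately show ?thesis
    unfolding diag_neg_def orbit_neg_def gen_eqs_def by auto
qed

private lemma sat_orbit_eqs:
  assumes y: "length y = n" and x: "length x = n" and ts: "length ts = n" "\<forall>t\<in>set ts. wf_tm L n t"
  shows "sat_qf B (y @ z # x) (orbit_eqs ts) \<longleftrightarrow>
    (\<forall>p\<in>set \<psi>. val B x (fst p) = val B x (snd p)) \<and> y = map (val B x) ts"
proof -
  have val: "val B (y @ z # x) (shift_tm (Suc n) t) = val B x t" if "wf_tm L n t" for t
    using val_shift_tm[of "y @ [z]" "Suc n" L x t B] y x that by simp
  have "sat_qf B (y @ z # x) shifted_\<psi> \<longleftrightarrow> (\<forall>p\<in>set \<psi>. val B x (fst p) = val B x (snd p))"
    unfolding shifted_\<psi>_def sat_conj_eqs using val \<psi>_wf by auto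
  moreover have "(\<forall>p\<in>set (zip (map Var [0..<n]) (map (shift_tm (Suc n)) ts)).
      val B (y @ z # x) (fst p) = val B (y @ z # x) (snd p)) \<longleftrightarrow> (\<forall>i<n. y ! i = val B x (ts ! i))"
    using y ts val by (auto simp: all_set_conv_all_nth nth_append)
  moreover have "(\<forall>i<n. y ! i = val B x (ts ! i)) \<longleftrightarrow> y = map (val B x) ts"
    using y ts by (auto simp: list_eq_iff_nth_eq)
  ultimately show ?thesis unfolding orbit_eqs_def sat_conj_eqs by simp
qed

text \<open>For \<open>diag_neg\<close> this is invariance of equations under automorphisms. For
  \<open>orbit_neg\<close>, the Hopf property makes the endomorphism from \<open>v\<close> to
  \<open>x\<close> an automorphism, and its inverse would bring \<open>y\<close> back to a tuple
  that was supposed to lie outside the orbit.\<close>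

private lemma orbit_imp_not_sat:
  assumes y: "y \<in> orbit L A v" and mq: "(m, q) \<in> diag_neg \<union> orbit_neg" and x: "x \<in> tuples A m"
  shows "\<not> sat_qf A (y @ z # x) q"
proof
  assume sat: "sat_qf A (y @ z # x) q"
  obtain g where g: "automorphism L A g" "y = map g v" using y unfolding orbit_def by blast
  have yd: "set y \<subseteq> dom A" "length y = n" using orbit_tuples[OF v_dom y] by (auto simp: tuples_def)
  from mq show False
  proof
    assume "(m, q) \<in> diag_neg"
    then obtain s t where st: "wf_tm L n s" "wf_tm L n t"
      and q: "q = (if val A v s = val A v t then Neg (Eq s t) else Eq s t)"
      unfolding diag_neg_def by blast
    have "val A (y @ z # x) r = g (val A v r)" if "wf_tm L n r" for r
      using val_append[of L y r A "z # x"] val_hom[OF A iso_hom[OF g(1)] v_dom that] that yd g(2)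
      by simp
    then show False
      using sat q st val_in_dom[OF A v_dom] inj_onD[OF iso_inj[OF g(1)]]
      by (auto split: if_splits)
  next
    assume "(m, q) \<in> orbit_neg"
    then obtain ts where m: "m = n" and q: "q = orbit_eqs ts"
      and ts: "length ts = n" "\<forall>t\<in>set ts. wf_tm L n t" and u: "map (val A v) ts \<notin> orbit L A v"
      unfolding orbit_neg_def by blast
    let ?u = "map (val A v) ts"
    have x': "length x = n" using x m by (simp add: tuples_def)
    have "(\<forall>p\<in>set \<psi>. val A x (fst p) = val A x (snd p)) \<and> y = map (val A x) ts"
      using sat unfolding q sat_orbit_eqs[OF yd(2) x' ts] .
    then have \<psi>x: "\<And>p. p \<in> set \<psi> \<Longrightarrow> val A x (fst p) = val A x (snd p)"
      and yx: "y = map (val A x) ts" by blast+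
    obtain h where h: "hom L A A h" "map h v = x"
      using \<psi>_hom[OF x[unfolded m] \<psi>x] .
    have hu: "map h ?u = y"
      unfolding map_hom_vals[OF A h(1) v_dom ts(2)] h(2) yx ..
    have ud: "set ?u \<subseteq> dom A" using ts(2) val_in_dom[OF A v_dom] by auto
    have "generates L A y"
      unfolding g(2) by (rule surj_generates[OF A A iso_hom[OF g(1)] iso_image[OF g(1)] gen])
    then have "h ` dom A = dom A" using hom_generates[OF A A h(1) ud] hu by simp
    then have aut: "automorphism L A h" using hopf h(1) unfolding hopfian_def by blast
    let ?k = "inv_into (dom A) h"
    have "map ?k y = ?u"
      unfolding hu[symmetric] using ud iso_inj[OF aut] by (auto intro!: map_idI)
    then have "map (?k \<circ> g) v = ?u" using g(2) by (metis map_map)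
    then have "?u \<in> orbit L A v"
      using orbitI[OF iso_comp[OF g(1) iso_inv[OF A aut]]] by metis
    then show False using u by blast
  qed
qed

text \<open>The witness for \<open>x\<close> is \<open>v\<close> itself, with terms that express
  \<open>y\<close> by \<open>v\<close>.\<close>

private lemma not_orbit_imp_sat:
  assumes y: "y \<in> tuples A n" "y \<notin> orbit L A v"
  shows "\<exists>(m, q)\<in>orbit_neg. \<exists>x\<in>tuples A m. sat_qf A (y @ z # x) q"
proof -
  have y': "set y \<subseteq> dom A" "length y = n" using y(1) by (auto simp: tuples_def)
  obtain ts where ts: "\<forall>t\<in>set ts. wf_tm L n t" "map (val A v) ts = y"
    using generates_vals[OF A gen y'(1)] .
  then have len: "length ts = n" using y'(2) by auto
  have "(n, orbit_eqs ts) \<in> orbit_neg"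
    unfolding orbit_neg_def using ts len y(2) by blast
  moreover have "v \<in> tuples A n" using v_dom by (simp add: tuples_def)
  moreover have "sat_qf A (y @ z # v) (orbit_eqs ts)"
    unfolding sat_orbit_eqs[OF y'(2) refl len ts(1)] using ts(2) \<psi>_val by blast
  ultimately show ?thesis by blast
qed

text \<open>Evaluating both terms at \<open>v\<close> decides the sign of the equation; the
  numerical tags are those of \<open>qf_code\<close>.\<close>

private lemma ce_diag_neg: "ce_pred (\<lambda>c. \<exists>m q. c = prod_encode (m, qf_code q) \<and> (m, q) \<in> diag_neg)"
proof -
  let ?v = "list_encode v"
  let ?P = "\<lambda>c. \<exists>s t y z. val_rel L A 0 ?v s y \<and> val_rel L A 0 ?v t z \<and>
    (y = z \<and> c = prod_encode (0, prod_encode (1, prod_encode (0, prod_encode (s, t)))) \<or>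
     y \<noteq> z \<and> c = prod_encode (0, prod_encode (0, prod_encode (s, t))))"
  have "(\<exists>m q. c = prod_encode (m, qf_code q) \<and> (m, q) \<in> diag_neg) \<longleftrightarrow> ?P c" for c
  proof
    assume "\<exists>m q. c = prod_encode (m, qf_code q) \<and> (m, q) \<in> diag_neg"
    then obtain s t where st: "wf_tm L n s" "wf_tm L n t" and c: "c = prod_encode (0, qf_code
        (if val A v s = val A v t then Neg (Eq s t) else Eq s t))"
      unfolding diag_neg_def by blast
    have "val_rel L A 0 ?v (tm_code s) (val A v s)" "val_rel L A 0 ?v (tm_code t) (val A v t)"
      using st v_dom by (simp_all add: val_rel_tm_code)
    moreover have "val A v s = val A v t \<and> c = prod_encode (0, prod_encode (1, prod_encode (0,
          prod_encode (tm_code s, tm_code t)))) \<or>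
        val A v s \<noteq> val A v t \<and> c = prod_encode (0, prod_encode (0,
          prod_encode (tm_code s, tm_code t)))"
      using c by auto
    ultimately show "?P c" by blast
  next
    assume "?P c"
    then obtain s t where st: "wf_tm L n s" "wf_tm L n t" and
      c: "val A v s = val A v t \<and> c = prod_encode (0, prod_encode (1, prod_encode (0,
          prod_encode (tm_code s, tm_code t)))) \<or>
        val A v s \<noteq> val A v t \<and> c = prod_encode (0, prod_encode (0,
          prod_encode (tm_code s, tm_code t)))"
      unfolding val_rel_def shift_tm_0 list_encode_inverse by blast
    have "c = prod_encode (0, qf_code (if val A v s = val A v t then Neg (Eq s t) else Eq s t))"
      using c by auto
    moreover have "(0, if val A v s = val A v t then Neg (Eq s t) else Eq s t) \<in> diag_neg"
      unfolding diag_neg_def using st by blast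
    ultimately show "\<exists>m q. c = prod_encode (m, qf_code q) \<and> (m, q) \<in> diag_neg" by blast
  qed
  then show ?thesis
    by (simp only:) (intro ce_val_rel[OF comp] ce_intros)
qed

text \<open>Decidability of the orbit enters here: the terms are enumerated together with their
  values at \<open>v\<close>, and those with values outside the orbit are retained. The shift by
  \<open>Suc n\<close> delivers codes that already refer to \<open>x\<close>.\<close>

private lemma ce_orbit_neg: "ce_pred (\<lambda>c. \<exists>m q. c = prod_encode (m, qf_code q) \<and> (m, q) \<in> orbit_neg)"
proof -
  let ?v = "list_encode v"
  let ?C = "conj_eqs_code (qf_code shifted_\<psi>) (map Var [0..<n])"
  let ?P = "\<lambda>c. \<exists>d u. vals_rel L A (Suc n) ?v d u \<and>
    (length (list_decode u) = n \<and> list_decode u \<notin> orbit L A v) \<and>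
    c = prod_encode (n, ?C d)"
  have code: "?C (list_encode (map (\<lambda>t. tm_code (shift_tm (Suc n) t)) ts)) =
      qf_code (orbit_eqs ts)" if "length ts = n" for ts
    using conj_eqs_code[of "map (shift_tm (Suc n)) ts" "map Var [0..<n]" shifted_\<psi>] that
    unfolding orbit_eqs_def by (simp add: comp_def)
  have "(\<exists>m q. c = prod_encode (m, qf_code q) \<and> (m, q) \<in> orbit_neg) \<longleftrightarrow> ?P c" for c
  proof
    assume "\<exists>m q. c = prod_encode (m, qf_code q) \<and> (m, q) \<in> orbit_neg"
    then obtain ts where c: "c = prod_encode (n, qf_code (orbit_eqs ts))"
      and ts: "length ts = n" "\<forall>t\<in>set ts. wf_tm L n t" "map (val A v) ts \<notin> orbit L A v"
      unfolding orbit_neg_def by blast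
    have "vals_rel L A (Suc n) ?v (list_encode (map (\<lambda>t. tm_code (shift_tm (Suc n) t)) ts))
        (list_encode (map (val A v) ts))"
      unfolding vals_rel_def list_encode_inverse using v_dom ts(2) by blast
    moreover have "length (list_decode (list_encode (map (val A v) ts))) = n \<and>
        list_decode (list_encode (map (val A v) ts)) \<notin> orbit L A v"
      using ts by simp
    ultimately show "?P c" unfolding c code[OF ts(1), symmetric] by blast
  next
    assume "?P c"
    then obtain d u where du: "vals_rel L A (Suc n) ?v d u" "length (list_decode u) = n"
      "list_decode u \<notin> orbit L A v" "c = prod_encode (n, ?C d)" by blast
    then obtain ts where ts: "d = list_encode (map (\<lambda>t. tm_code (shift_tm (Suc n) t)) ts)"
      "\<forall>t\<in>set ts. wf_tm L n t" "u = list_encode (map (val A v) ts)"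
      unfolding vals_rel_def list_encode_inverse by blast
    have len: "length ts = n" using du(2) ts(3) by simp
    have "(n, orbit_eqs ts) \<in> orbit_neg"
      unfolding orbit_neg_def using len ts(2,3) du(3) by auto
    moreover have "c = prod_encode (n, qf_code (orbit_eqs ts))"
      unfolding du(4) ts(1) code[OF len] ..
    ultimately show "\<exists>m q. c = prod_encode (m, qf_code q) \<and> (m, q) \<in> orbit_neg" by blast
  qed
  moreover have "ce_pred ?P"
    by (intro ce_pred_ex ce_vals_rel[OF comp] ce_pred_subst[OF computable_relD(2)[OF dec]]
        ce_pred_conj ce_pred_eq computable_fun_compose[OF computable_conj_eqs_code]
        computable_intros)
  ultimately show ?thesis by (simp only:)
qed

private lemma ce_gen_eqs: "ce_pred (\<lambda>c. \<exists>m q. c = prod_encode (m, qf_code q) \<and> (m, q) \<in> gen_eqs)"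
proof -
  have "(\<exists>m q. c = prod_encode (m, qf_code q) \<and> (m, q) \<in> gen_eqs) \<longleftrightarrow>
      (\<exists>t y. val_rel L A 0 (list_encode v) t y \<and> c = prod_encode (0, prod_encode (0,
        prod_encode (tm_code (Var n), t))))" for c
  proof
    assume "\<exists>m q. c = prod_encode (m, qf_code q) \<and> (m, q) \<in> gen_eqs"
    then obtain t where t: "wf_tm L n t" and c: "c = prod_encode (0, qf_code (Eq (Var n) t))"
      unfolding gen_eqs_def by blast
    have "val_rel L A 0 (list_encode v) (tm_code t) (val A v t)"
      using t v_dom by (simp add: val_rel_tm_code)
    then show "\<exists>t y. val_rel L A 0 (list_encode v) t y \<and> c = prod_encode (0, prod_encode (0,
        prod_encode (tm_code (Var n), t)))"
      unfolding c qf_code.simps by blast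
  next
    assume "\<exists>t y. val_rel L A 0 (list_encode v) t y \<and> c = prod_encode (0, prod_encode (0,
        prod_encode (tm_code (Var n), t)))"
    then obtain t where t: "wf_tm L n t"
      and c: "c = prod_encode (0, prod_encode (0, prod_encode (tm_code (Var n), tm_code t)))"
      unfolding val_rel_def shift_tm_0 list_encode_inverse by blast
    have "(0, Eq (Var n) t) \<in> gen_eqs" unfolding gen_eqs_def using t by blast
    then show "\<exists>m q. c = prod_encode (m, qf_code q) \<and> (m, q) \<in> gen_eqs"
      unfolding c qf_code.simps(1)[symmetric] by blast
  qed
  then show ?thesis
    by (simp only:) (intro ce_val_rel[OF comp] ce_intros)
qed

theorem Scott_if_orbit_computable:
  "\<exists>\<phi>. computable_d_Sigma2 L 0 \<phi> \<and> scott_sentence L A \<phi>"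
proof -
  \<comment> \<open>In \<open>\<theta>\<close> the variable \<open>z\<close> is bound together with
    \<open>x\<close>, so that \<open>\<theta>\<close> and \<open>\<chi>\<close> use the same
    formulas with the same numbering.\<close>
  define W where "W = (\<lambda>(m, q). (Suc m, Neg q)) ` (diag_neg \<union> orbit_neg)"
  have W_mem: "(m', q') \<in> W \<longleftrightarrow>
      (\<exists>m q. m' = Suc m \<and> q' = Neg q \<and> (m, q) \<in> diag_neg \<union> orbit_neg)" for m' q'
    unfolding W_def by force
  have W_wf: "\<forall>(m, q)\<in>W. wf_qf L (n + m) q"
    unfolding W_def using wf_sets by auto
  have ce_neg: "ce_pred (\<lambda>c. \<exists>m q. c = prod_encode (m, qf_code q) \<and> (m, q) \<in> diag_neg \<union> orbit_neg)"
  proof -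
    have "(\<exists>m q. c = prod_encode (m, qf_code q) \<and> (m, q) \<in> diag_neg \<union> orbit_neg) \<longleftrightarrow>
      (\<exists>m q. c = prod_encode (m, qf_code q) \<and> (m, q) \<in> diag_neg) \<or>
      (\<exists>m q. c = prod_encode (m, qf_code q) \<and> (m, q) \<in> orbit_neg)" for c by blast
    then show ?thesis using ce_pred_disj[OF ce_diag_neg ce_orbit_neg] by (simp only:)
  qed
  have "ce_pred (\<lambda>c. \<exists>m q. c = prod_encode (m, qf_code q) \<and> (m, q) \<in> W)"
  proof -
    have "(\<exists>m q. c = prod_encode (m, qf_code q) \<and> (m, q) \<in> W) \<longleftrightarrow>
      (\<exists>a d. c = prod_encode (Suc a, prod_encode (1, d)) \<and> (\<exists>m q.
        prod_encode (a, d) = prod_encode (m, qf_code q) \<and> (m, q) \<in> diag_neg \<union> orbit_neg))" for c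
    proof
      assume "\<exists>m q. c = prod_encode (m, qf_code q) \<and> (m, q) \<in> W"
      then obtain m q where "c = prod_encode (Suc m, qf_code (Neg q))"
        and mq: "(m, q) \<in> diag_neg \<union> orbit_neg"
        unfolding W_mem by blast
      then have "c = prod_encode (Suc m, prod_encode (1, qf_code q))" by simp
      then show "\<exists>a d. c = prod_encode (Suc a, prod_encode (1, d)) \<and> (\<exists>m q.
          prod_encode (a, d) = prod_encode (m, qf_code q) \<and> (m, q) \<in> diag_neg \<union> orbit_neg)"
        using mq by blast
    next
      assume "\<exists>a d. c = prod_encode (Suc a, prod_encode (1, d)) \<and> (\<exists>m q.
          prod_encode (a, d) = prod_encode (m, qf_code q) \<and> (m, q) \<in> diag_neg \<union> orbit_neg)"
      then obtain m q where "c = prod_encode (Suc m, qf_code (Neg q))"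
        and mq: "(m, q) \<in> diag_neg \<union> orbit_neg"
        by auto
      moreover have "(Suc m, Neg q) \<in> W" unfolding W_mem using mq by blast
      ultimately show "\<exists>m q. c = prod_encode (m, qf_code q) \<and> (m, q) \<in> W" by blast
    qed
    then show ?thesis
      by (simp only:) (intro ce_pred_ex ce_pred_conj ce_pred_eq ce_pred_subst[OF ce_neg]
        computable_intros)
  qed
  from pi_index_1_ex[OF W_wf this] obtain e \<theta> where \<theta>: "pi_index L (Suc 0) n e \<theta>" "wf_form L \<theta> n"
    and "\<forall>(B :: nat struct) v. sat B \<theta> v \<longleftrightarrow> (\<forall>(m, q)\<in>W. \<forall>ys\<in>tuples B m. sat_qf B (v @ ys) q)"
    by (elim exE conjE)
  note sat_W = this(3)[rule_format]
  have tuples_Suc: "ys \<in> tuples B (Suc m) \<longleftrightarrow> (\<exists>z x. ys = z # x \<and> z \<in> dom B \<and> x \<in> tuples B m)"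
    for ys and B :: "nat struct" and m
    by (cases ys) (auto simp: tuples_def)
  have sat_\<theta>: "sat B \<theta> y \<longleftrightarrow> (\<forall>(m, q)\<in>diag_neg \<union> orbit_neg. \<forall>z\<in>dom B. \<forall>x\<in>tuples B m.
      \<not> sat_qf B (y @ z # x) q)" for B :: "nat struct" and y
  proof -
    have "(\<forall>ys\<in>tuples B (Suc m). sat_qf B (y @ ys) (Neg q)) \<longleftrightarrow>
        (\<forall>z\<in>dom B. \<forall>x\<in>tuples B m. \<not> sat_qf B (y @ z # x) q)" for m q
      unfolding Ball_def tuples_Suc by auto
    then show ?thesis unfolding sat_W W_def by (simp add: case_prod_unfold)
  qed
  \<comment> \<open>At \<open>(y, z)\<close>, the formula \<open>\<chi>\<close> says that one of the
    conditions forbidden by \<open>\<theta>\<close> holds at \<open>y\<close>, or that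
    \<open>y\<close> generates \<open>z\<close>.\<close>
  let ?V = "diag_neg \<union> orbit_neg \<union> gen_eqs"
  have V_wf: "\<forall>(m, q)\<in>?V. wf_qf L (Suc n + m) q" using wf_sets by auto
  have "ce_pred (\<lambda>c. \<exists>m q. c = prod_encode (m, qf_code q) \<and> (m, q) \<in> ?V)"
  proof -
    have "(\<exists>m q. c = prod_encode (m, qf_code q) \<and> (m, q) \<in> ?V) \<longleftrightarrow>
      (\<exists>m q. c = prod_encode (m, qf_code q) \<and> (m, q) \<in> diag_neg \<union> orbit_neg) \<or>
      (\<exists>m q. c = prod_encode (m, qf_code q) \<and> (m, q) \<in> gen_eqs)" for c by blast
    then show ?thesis using ce_pred_disj[OF ce_neg ce_gen_eqs] by (simp only:)
  qed
  from sigma_index_1_ex[OF V_wf this] obtain e' \<chi>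
    where \<chi>: "sigma_index L (Suc 0) (Suc n) e' \<chi>" "wf_form L \<chi> (Suc n)"
    and "\<forall>(B :: nat struct) v. sat B \<chi> v \<longleftrightarrow> (\<exists>(m, q)\<in>?V. \<exists>ys\<in>tuples B m. sat_qf B (v @ ys) q)"
    by (elim exE conjE)
  note sat_\<chi> = this(3)[rule_format]
  let ?\<sigma> = "Disj (csingle (Ex n \<theta>))" and ?\<pi> = "Conj (csingle (All (Suc n) \<chi>))"
  let ?\<phi> = "Conj (cinsert ?\<sigma> (csingle ?\<pi>))"
  have d2: "computable_d_Sigma2 L 0 ?\<phi>"
    unfolding computable_d_Sigma2_def
    using computable_Sigma_2_Ex[OF \<theta>(1)] computable_Pi_2_All[OF \<chi>(1)] by blast
  have wf: "wf_form L ?\<phi> 0"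
    using \<theta>(2) \<chi>(2) by (simp add: wf_form_Conj wf_form_Disj cinsert.rep_eq bot_cset.rep_eq
        del: wf_form.simps(3,4))
  have sat_\<phi>: "sat B ?\<phi> [] \<longleftrightarrow> (\<exists>y\<in>tuples B n. sat B \<theta> y) \<and>
      (\<forall>ys\<in>tuples B (Suc n). sat B \<chi> ys)" for B :: "nat struct"
    by (simp add: sat_Conj sat_Disj cinsert.rep_eq bot_cset.rep_eq del: sat.simps(3,4))
  have "sat A ?\<phi> []"
    unfolding sat_\<phi>
  proof (intro conjI ballI)
    have "sat A \<theta> v" unfolding sat_\<theta> using orbit_imp_not_sat[OF orbit_refl] by blast
    then show "\<exists>y\<in>tuples A n. sat A \<theta> y" using v_dom by (auto simp: tuples_def)
  next
    fix ys assume ys: "ys \<in> tuples A (Suc n)"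
    obtain y z where yz: "ys = y @ [z]"
      using ys by (cases ys rule: rev_cases) (auto simp: tuples_def)
    have y: "y \<in> tuples A n" and z: "z \<in> dom A" using ys yz by (auto simp: tuples_def)
    show "sat A \<chi> ys"
    proof (cases "y \<in> orbit L A v")
      case True
      then obtain g where g: "automorphism L A g" "y = map g v" unfolding orbit_def by blast
      have "generates L A y"
        unfolding g(2) by (rule surj_generates[OF A A iso_hom[OF g(1)] iso_image[OF g(1)] gen])
      then have "\<forall>x\<in>dom A. \<exists>t. wf_tm L (length y) t \<and> val A y t = x"
        using generates_iff_val[OF A] by blast
      then obtain t where t: "wf_tm L (length y) t" "val A y t = z" using z by blast
      have len: "length y = n" using y by (simp add: tuples_def)
      have "sat_qf A (ys @ []) (Eq (Var n) t)"
        using val_append[OF t(1), of A "[z]"] t(2) len unfolding yz by (simp add: nth_append)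
      moreover have "(0, Eq (Var n) t) \<in> ?V" unfolding gen_eqs_def using t(1) len by simp
      moreover have "[] \<in> tuples A 0" by simp
      ultimately show ?thesis unfolding sat_\<chi> by blast
    next
      case False
      \<comment> \<open>Outside the orbit a disjunct from \<open>orbit_neg\<close> is true whatever
        \<open>z\<close> is.\<close>
      have "\<exists>(m, q)\<in>orbit_neg. \<exists>x\<in>tuples A m. sat_qf A (ys @ x) q"
        using not_orbit_imp_sat[OF y False, of z] unfolding yz by simp
      then show ?thesis unfolding sat_\<chi> by blast
    qed
  qed
  have "sat B ?\<phi> [] \<longleftrightarrow> isomorphic L A B" if B: "structure_of L B" for B :: "nat struct"
  proof
    assume "isomorphic L A B"
    then obtain h where h: "iso L A B h" unfolding isomorphic_def by blast
    show "sat B ?\<phi> []"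
      using sat_iso[OF A h, of "[]" ?\<phi>] wf \<open>sat A ?\<phi> []\<close> by (simp only: list.map list.size list.set) blast
  next
    assume sat: "sat B ?\<phi> []"
    then obtain y where y: "y \<in> tuples B n" and \<theta>y: "sat B \<theta> y" unfolding sat_\<phi> by blast
    have yd: "set y \<subseteq> dom B" "length y = n" using y by (auto simp: tuples_def)
    \<comment> \<open>An arbitrary element fills the place of \<open>z\<close>; it exists because
      domains are nonempty.\<close>
    obtain z0 where z0: "z0 \<in> dom B" using B unfolding structure_of_def by blast
    have eq_iff: "val A v s = val A v t \<longleftrightarrow> val B y s = val B y t"
      if st: "wf_tm L n s" "wf_tm L n t" for s t
    proof -
      let ?q = "if val A v s = val A v t then Neg (Eq s t) else Eq s t"
      have "(0, ?q) \<in> diag_neg \<union> orbit_neg" unfolding diag_neg_def using st by blast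
      moreover have "[] \<in> tuples B 0" by simp
      ultimately have "\<not> sat_qf B (y @ [z0]) ?q" using \<theta>y z0 unfolding sat_\<theta> by blast
      moreover have "val B (y @ [z0]) r = val B y r" if "wf_tm L n r" for r
        using val_append that yd(2) by metis
      ultimately show ?thesis using st by (auto split: if_splits)
    qed
    obtain h where h: "hom L A B h" "inj_on h (dom A)" "map h v = y"
      using embedding_if_same_equations[OF A B gen yd eq_iff] by blast
    have "\<exists>t. wf_tm L (length y) t \<and> val B y t = z" if z: "z \<in> dom B" for z
    proof -
      have "y @ [z] \<in> tuples B (Suc n)" using y z by (auto simp: tuples_def)
      then have "sat B \<chi> (y @ [z])" using sat unfolding sat_\<phi> by blast
      then obtain m q x where mq: "(m, q) \<in> ?V" "x \<in> tuples B m" "sat_qf B ((y @ [z]) @ x) q"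
        unfolding sat_\<chi> by blast
      \<comment> \<open>Since \<open>y\<close> satisfies \<open>\<theta>\<close>, only the disjuncts
        in \<open>gen_eqs\<close> can make \<open>\<chi>\<close> true, so \<open>z\<close> is
        generated by \<open>y\<close>.\<close>
      have "(m, q) \<notin> diag_neg \<union> orbit_neg"
      proof
        assume "(m, q) \<in> diag_neg \<union> orbit_neg"
        then have "\<not> sat_qf B (y @ z # x) q" using \<theta>y z mq(2) unfolding sat_\<theta> by blast
        then show False using mq(3) by simp
      qed
      then have "(m, q) \<in> gen_eqs" using mq(1) by blast
      then obtain t where t: "m = 0" "q = Eq (Var n) t" "wf_tm L n t" unfolding gen_eqs_def by blast
      then have "val B (y @ [z]) t = z" using mq(2,3) yd(2) by (auto simp: nth_append)
      then show ?thesis using val_append[of L y t B "[z]"] t(3) yd(2) by auto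
    qed
    then have "generates L B y" using generates_iff_val[OF B] yd(1) by blast
    then have "h ` dom A = dom B" using hom_generates[OF A B h(1) v_dom] h(3) by simp
    then have "iso L A B h" using h unfolding iso_def bij_betw_def by blast
    then show "isomorphic L A B" unfolding isomorphic_def by blast
  qed
  then show ?thesis using d2 wf unfolding scott_sentence_def by blast
qed

end

theorem theorem1p4:
  fixes L :: lang and A :: "nat struct" and K :: "'b struct set"
  assumes "\<forall>B \<in> K. structure_of L B"
    and "computable_structure L A"
    and "hopfian L A"
    and "finitely_presented L K A"
  shows "(\<exists>\<phi>. computable_d_Sigma2 L 0 \<phi> \<and> scott_sentence L A \<phi>) \<longleftrightarrow>
    decidable_weak_whitehead L A"
proof -
  obtain v \<psi> where pres: "presented_by L A v \<psi>"
    using finitely_presented_presented_by[OF assms(4,1) structure_A[OF assms(2)]] .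
  have "generates L A v" using pres unfolding presented_by_def by (elim conjE)
  then have "computable_rel (length v) (orbit L A v)" if "decidable_weak_whitehead L A"
    using that unfolding decidable_weak_whitehead_def orbit_def by blast
  then show ?thesis
    using Scott_if_orbit_computable[OF assms(2,3) pres]
      decidable_weak_whitehead_if_Scott[OF assms(2,3) pres] by blast
qed

end
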